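(* Let assumptions $\mathrm{Asm}_1$–$\mathrm{Asm}_4$ (stated in the context) hold for the depth function $D$ and the distribution $P$, with a common exponent $\beta\in(1/2,1]$, and let $m,n\to\infty$ with $\frac{m}{m+n}\to\tau$ for some $0<\tau<1$. Then, under the null hypothesis $P=Q$, (a) $\displaystyle\sqrt{\frac{6\,m\,n}{m+n}}\cdot\frac{\mathcal{LS}(\widehat P_m,\widehat Q_n)-\mathcal{LS}(\widehat Q_n,\widehat P_m)}{\sqrt2}\xrightarrow{\mathcal D}N(0,1)$, (b) $\displaystyle\frac{12\,m\,n}{m+n}\left[\max\left(\left|\mathcal{LS}(\widehat P_m,\widehat Q_n)-\frac12\right|,\left|\mathcal{LS}(\widehat Q_n,\widehat P_m)-\frac12\right|\right)\right]^2\xrightarrow{\mathcal D}\chi_1^2$, where $\chi^2_1$ is the chi-square distribution with 1 degree of freedom.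
   Context: $\Omega$ is a measurable space, $\mathcal P_\Omega$ the collection of probability measures on it, and $D:\Omega\times\mathcal P_\Omega\to\mathbb R_{\ge0}$ a depth function. $X,X_1,\dots,X_m$ are i.i.d. with distribution $P$, independent of $Y,Y_1,\dots,Y_n$ i.i.d. with distribution $Q$, all with values in $\Omega$. $\widehat P_m$ and $\widehat Q_n$ are the empirical measures of $X_1,\dots,X_m$ and $Y_1,\dots,Y_n$. For an index set $I$, $\widehat P_m^{-I}$ is the empirical measure of $\{X_i: i\in\{1,\dots,m\}\setminus I\}$. The $\mathcal{LS}$-statistic is $$\mathcal{LS}(\widehat P_m,\widehat Q_n)=\frac1{mn}\sum_{i=1}^m\sum_{j=1}^n\left(\mathbb 1_{\{D(X_i,\widehat P_m)<D(Y_j,\widehat P_m)\}}+\tfrac12\mathbb 1_{\{D(X_i,\widehat P_m)=D(Y_j,\widehat P_m)\}}\right),$$ and $\mathcal{LS}(\widehat Q_n,\widehat P_m)$ is obtained by exchanging the roles of the two samples (depths computed with respect to $\widehat Q_n$). Assumptions, for some $1/2<\beta\le1$: $\mathrm{Asm}_1$: there is $C>0$ with $\mathbb P(D(X,P)\in[y_1,y_2])\le C|y_2-y_1|^\beta$ for all $y_1,y_2\in\mathbb R_{\ge0}$. $\mathrm{Asm}_2$: $\mathbb E\big(\sup_{x\in\Omega}|D(x,\widehat P_m)-D(x,P)|^{2\beta}\big)=O(m^{-\beta})$. $\mathrm{Asm}_3$: there exist a deterministic constant $C_{\det}$ and an index $m_0$ such that for every $m\ge m_0$, $\sup_{x\in\Omega}|D(x,\widehat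 P_m)-D(x,\widehat P_m^{-\{1\}})|\le C_{\det}/m$ almost surely. $\mathrm{Asm}_4$: with $X$ an independent copy of $X_1,\dots,X_m$, for any constant $C>0$, $\mathbb E\Big(\big[\mathbb P\big(|D(X_1,\widehat P_m^{-\{1\}})-D(X,\widehat P_m^{-\{1\}})|\le \tfrac Cm\,\big|\,X_2,\dots,X_m\big)\big]^2\Big)=O(m^{-2\beta})$. $\xrightarrow{\mathcal D}$ denotes convergence in distribution. *)

theory Defs
  imports "HOL-Probability.Probability" "HOL-Library.Landau_Symbols"
begin

text \<open>The empirical measure of the points \<open>x i\<close>, \<open>i \<in> I\<close>, for a finite nonempty \<open>I\<close>; leaving out
  observation 1 of a sample of size \<open>m\<close> means taking \<open>I = {1..m} - {1}\<close>.\<close>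

definition empirical :: "'b measure \<Rightarrow> nat set \<Rightarrow> (nat \<Rightarrow> 'b) \<Rightarrow> 'b measure" where
  "empirical \<Omega> I x = distr (uniform_count_measure I) \<Omega> x"

lemma measure_empirical:
  assumes "finite I" "I \<noteq> {}" "\<And>i. i \<in> I \<Longrightarrow> x i \<in> space \<Omega>" "A \<in> sets \<Omega>"
  shows "measure (empirical \<Omega> I x) A = card {i \<in> I. x i \<in> A} / card I"
proof -
  have meas: "x \<in> measurable (uniform_count_measure I) \<Omega>"
    using assms by (auto simp: measurable_def space_uniform_count_measure sets_uniform_count_measure)
  have "x -` A \<inter> I = {i \<in> I. x i \<in> A}" by auto
  then show ?thesis
    using assms meas unfolding empirical_def
    by (simp add: measure_distr space_uniform_count_measure measure_uniform_count_measure)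
qed

text \<open>Observations are indexed from 1; \<open>X 0\<close> and \<open>Y 0\<close> are the additional independent copies
  of \<open>X i\<close> and \<open>Y i\<close>. The sum-indexed family \<open>case_sum X Y\<close> expresses that all the observations,
  of both samples together, are independent.
  The last two assumptions say that the depths that occur below are random variables. They
  hold in particular if \<open>D\<close> is jointly measurable on \<open>\<Omega> \<Otimes>\<^sub>M prob_algebra \<Omega>\<close>.\<close>

locale two_sample_depth = prob_space M
  for M :: "'a measure" +
  fixes \<Omega> :: "'b measure"
    and D :: "'b \<Rightarrow> 'b measure \<Rightarrow> real"
    and P Q :: "'b measure"
    and X Y :: "nat \<Rightarrow> 'a \<Rightarrow> 'b"
  assumes P_distribution: "P \<in> space (prob_algebra \<Omega>)"
    and Q_distribution: "Q \<in> space (prob_algebra \<Omega>)"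
    and D_nonneg: "x \<in> space \<Omega> \<Longrightarrow> \<mu> \<in> space (prob_algebra \<Omega>) \<Longrightarrow> 0 \<le> D x \<mu>"
    and indep: "indep_vars (\<lambda>_. \<Omega>) (case_sum X Y) UNIV"
    and X_distribution: "distr M \<Omega> (X i) = P"
    and Y_distribution: "distr M \<Omega> (Y i) = Q"
    and D_measurable: "\<mu> \<in> {P, Q} \<Longrightarrow> (\<lambda>x. D x \<mu>) \<in> borel_measurable \<Omega>"
    and D_empirical_measurable:
      "k \<ge> 1 \<Longrightarrow> (\<lambda>(x, w). D x (empirical \<Omega> {1..k} w))
        \<in> borel_measurable (\<Omega> \<Otimes>\<^sub>M (\<Pi>\<^sub>M i\<in>{1..k}. \<Omega>))"

text \<open>\<open>LS D \<Omega> m n x y\<close> is the statistic with depths taken with respect to the empirical measure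
  of the first sample \<open>x 1, \<dots>, x m\<close>; exchanging the two samples gives \<open>LS D \<Omega> n m y x\<close>.\<close>

definition LS :: "('b \<Rightarrow> 'b measure \<Rightarrow> real) \<Rightarrow> 'b measure \<Rightarrow> nat \<Rightarrow> nat
    \<Rightarrow> (nat \<Rightarrow> 'b) \<Rightarrow> (nat \<Rightarrow> 'b) \<Rightarrow> real" where
  "LS D \<Omega> m n x y =
    (let Pm = empirical \<Omega> {1..m} x in
      1 / (real m * real n) *
      (\<Sum>i=1..m. \<Sum>j=1..n.
         of_bool (D (x i) Pm < D (y j) Pm) + 1 / 2 * of_bool (D (x i) Pm = D (y j) Pm)))"

text \<open>Extended nonnegative values are used because the supremum over \<open>\<Omega>\<close> may be infinite.\<close>

definition depth_dist :: "('b \<Rightarrow> 'b measure \<Rightarrow> real) \<Rightarrow> 'b measure \<Rightarrow> 'b measure \<Rightarrow> 'b measure \<Rightarrow> ennreal"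
  where "depth_dist D \<Omega> \<mu> \<nu> = (SUP x\<in>space \<Omega>. ennreal \<bar>D x \<mu> - D x \<nu>\<bar>)"

definition ennreal_powr :: "ennreal \<Rightarrow> real \<Rightarrow> ennreal" where
  "ennreal_powr x a = (if x = \<infinity> then \<infinity> else ennreal (enn2real x powr a))"

definition Asm1 :: "'a measure \<Rightarrow> ('b \<Rightarrow> 'b measure \<Rightarrow> real) \<Rightarrow> 'b measure
    \<Rightarrow> (nat \<Rightarrow> 'a \<Rightarrow> 'b) \<Rightarrow> real \<Rightarrow> bool" where
  "Asm1 M D P X \<beta> \<longleftrightarrow>
    (\<exists>C>0. \<forall>y1\<ge>0. \<forall>y2\<ge>0.
       \<P>(\<omega> in M. D (X 0 \<omega>) P \<in> {y1..y2}) \<le> C * \<bar>y2 - y1\<bar> powr \<beta>)"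

text \<open>The expectation is an extended nonnegative integral, so the bound includes its finiteness.
  Measurability of the supremum is not required: if it fails, the integral is the lower integral
  and the assumption is only weaker.\<close>

definition Asm2 :: "'a measure \<Rightarrow> 'b measure \<Rightarrow> ('b \<Rightarrow> 'b measure \<Rightarrow> real) \<Rightarrow> 'b measure
    \<Rightarrow> (nat \<Rightarrow> 'a \<Rightarrow> 'b) \<Rightarrow> real \<Rightarrow> bool" where
  "Asm2 M \<Omega> D P X \<beta> \<longleftrightarrow>
    (\<exists>C. \<forall>\<^sub>F m in sequentially.
       (\<integral>\<^sup>+ \<omega>. ennreal_powr (depth_dist D \<Omega> (empirical \<Omega> {1..m} (\<lambda>i. X i \<omega>)) P) (2 * \<beta>) \<partial>M)
         \<le> ennreal (C * real m powr (- \<beta>)))"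

definition Asm3 :: "'a measure \<Rightarrow> 'b measure \<Rightarrow> ('b \<Rightarrow> 'b measure \<Rightarrow> real)
    \<Rightarrow> (nat \<Rightarrow> 'a \<Rightarrow> 'b) \<Rightarrow> bool" where
  "Asm3 M \<Omega> D X \<longleftrightarrow>
    (\<exists>C m0. \<forall>m\<ge>m0. AE \<omega> in M.
       depth_dist D \<Omega> (empirical \<Omega> {1..m} (\<lambda>i. X i \<omega>)) (empirical \<Omega> ({1..m} - {1}) (\<lambda>i. X i \<omega>))
         \<le> ennreal (C / real m))"

text \<open>The sub-sigma-algebra of \<open>M\<close> generated by \<open>X i\<close>, \<open>i \<in> I\<close>.\<close>

definition generated_by :: "'a measure \<Rightarrow> 'b measure \<Rightarrow> (nat \<Rightarrow> 'a \<Rightarrow> 'b) \<Rightarrow> nat set \<Rightarrow> 'a measure" where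
  "generated_by M \<Omega> X I =
    vimage_algebra (space M) (\<lambda>\<omega>. \<lambda>i\<in>I. X i \<omega>) (\<Pi>\<^sub>M i\<in>I. \<Omega>)"

text \<open>Here \<open>X 0\<close> is the copy of the observations that is independent of \<open>X 1, \<dots>, X m\<close>.\<close>

definition Asm4 :: "'a measure \<Rightarrow> 'b measure \<Rightarrow> ('b \<Rightarrow> 'b measure \<Rightarrow> real)
    \<Rightarrow> (nat \<Rightarrow> 'a \<Rightarrow> 'b) \<Rightarrow> real \<Rightarrow> bool" where
  "Asm4 M \<Omega> D X \<beta> \<longleftrightarrow>
    (\<forall>C>0.
      (\<lambda>m. \<integral>\<omega>. (real_cond_exp M (generated_by M \<Omega> X {2..m})
          (indicator {\<omega> \<in> space M.
             let P1 = empirical \<Omega> ({1..m} - {1}) (\<lambda>i. X i \<omega>)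
             in \<bar>D (X 1 \<omega>) P1 - D (X 0 \<omega>) P1\<bar> \<le> C / real m}) \<omega>)\<^sup>2 \<partial>M)
        \<in> O(\<lambda>m. real m powr (- 2 * \<beta>)))"

definition chi_square_distribution :: "nat \<Rightarrow> real measure" where
  "chi_square_distribution d =
    distr (\<Pi>\<^sub>M i\<in>{..<d}. std_normal_distribution) borel (\<lambda>z. \<Sum>i<d. (z i)\<^sup>2)"

end

theory Submission
  imports Defs
begin

text \<open>Write \<open>h\<close> for the mid-rank transform of the depth, \<open>h x = P(D(X, P) < D(x, P)) + P(D(X, P) = D(x, P)) / 2\<close>.
  By \<open>Asm1\<close> there are no ties, so \<open>h(X)\<close> has mean \<open>1/2\<close> and variance \<open>1/12\<close>. The heart of the matter is that
  \<open>LS(P\<^sub>m, Q\<^sub>n) - 1/2\<close> equals the mean of the \<open>h(Y\<^sub>j)\<close> minus the mean of the \<open>h(X\<^sub>i)\<close> up to an error that is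
  \<open>o(m\<^sup>-\<^sup>1\<^sup>/\<^sup>2)\<close> in \<open>L\<^sup>1\<close>; both statements then follow from the central limit theorem, the error of
  \<open>LS(Q\<^sub>n, P\<^sub>m)\<close> being covered because the joint law of all observations is invariant under every injective
  reindexing, in particular under exchanging the samples.

  In the term \<open>(i, j)\<close> of the statistic one may leave \<open>X\<^sub>i\<close> out of the empirical measure: by \<open>Asm3\<close> this matters only
  when the depths of \<open>X\<^sub>i\<close> and \<open>Y\<^sub>j\<close> are within \<open>O(1/m)\<close>, which by \<open>Asm4\<close> has probability
  \<open>O(m\<^sup>-\<^sup>\<beta>) = o(m\<^sup>-\<^sup>1\<^sup>/\<^sup>2)\<close>. The centred leave-one-out terms are antisymmetric under exchanging
  \<open>X\<^sub>i\<close> and \<open>Y\<^sub>j\<close>. Terms with distinct \<open>i\<close> and distinct \<open>j\<close> would therefore be uncorrelated if both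
  observations were left out; the product of the two errors of this replacement has expectation \<open>O(m\<^sup>-\<^sup>2\<^sup>\<beta>)\<close>, which is the
  second moment of a conditional probability in \<open>Asm4\<close>. Terms that share an index are only asymptotically uncorrelated
  (by \<open>Asm1\<close> and \<open>Asm2\<close>), but there are few of them.\<close>

section \<open>Weak convergence\<close>

text \<open>The obstacle is the size of the error: consistency of the kernel, which is what
  \<open>Asm1\<close> and \<open>Asm2\<close> are used for, does not survive multiplication by
  \<open>sqrt m\<close>. The rate has to come from cancellation, so products of residuals are sorted
  by the indices that they share. Only those without a shared index are numerous enough to require a
  covariance of order o(1/m); if one index is shared, a covariance tending to zero is enough, and
  there population depths may replace empirical ones. Leaving one observation out of
  \<open>Suc m\<close> gives, after renaming, a full sample of size \<open>m\<close> together with a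
  fresh observation of index 0; this links statements at \<open>Suc m\<close> to statements at
  \<open>m\<close>. Errors are measured in L^1, where characteristic functions control them
  directly. The factor 12 m n / (m + n) is the reciprocal of the variance (1/12) (1/m + 1/n) of the
  difference of the rank means. So scaled, the two statistics have leading terms W and -W: in (a)
  their difference is halved (\<open>sqrt 6 / sqrt 2 = sqrt 12 / 2\<close>), in (b) both have
  absolute value |W|.\<close>

lemma (in prob_space) expectation_abs_le_sqrt:
  fixes f :: "'a \<Rightarrow> real"
  assumes "f \<in> borel_measurable M" "integrable M (\<lambda>x. (f x)\<^sup>2)"
  shows "expectation (\<lambda>x. \<bar>f x\<bar>) \<le> sqrt (expectation (\<lambda>x. (f x)\<^sup>2))"
proof -
  have i: "integrable M f"
    using square_integrable_imp_integrable assms by blast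
  have "variance (\<lambda>x. \<bar>f x\<bar>) = expectation (\<lambda>x. \<bar>f x\<bar>\<^sup>2) - (expectation (\<lambda>x. \<bar>f x\<bar>))\<^sup>2"
    using i assms by (intro variance_eq) auto
  moreover have "0 \<le> variance (\<lambda>x. \<bar>f x\<bar>)" by (rule variance_positive)
  ultimately show ?thesis by (intro real_le_rsqrt) simp
qed

text \<open>Slutsky's theorem for an L^1-null perturbation: the characteristic functions at
  \<open>t\<close> differ by at most \<open>\<bar>t\<bar>\<close> times the mean of
  \<open>\<bar>R k\<bar>\<close>, and Levy's continuity theorem does the rest.\<close>

lemma (in prob_space) weak_conv_m_add_L1_null:
  fixes W R :: "nat \<Rightarrow> 'a \<Rightarrow> real"
  assumes [measurable]: "\<And>k. W k \<in> borel_measurable M"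
    and R: "\<And>k. integrable M (R k)" "(\<lambda>k. expectation (\<lambda>\<omega>. \<bar>R k \<omega>\<bar>)) \<longlonglongrightarrow> 0"
    and \<mu>: "real_distribution \<mu>" "weak_conv_m (\<lambda>k. distr M borel (W k)) \<mu>"
  shows "weak_conv_m (\<lambda>k. distr M borel (\<lambda>\<omega>. W k \<omega> + R k \<omega>)) \<mu>"
proof (rule levy_continuity[OF _ \<mu>(1)])
  have [measurable]: "R k \<in> borel_measurable M" for k using R(1) by auto
  show "real_distribution (distr M borel (\<lambda>\<omega>. W k \<omega> + R k \<omega>))" for k by simp
  fix t :: real
  have c: "(\<lambda>k. char (distr M borel (W k)) t) \<longlonglongrightarrow> char \<mu> t"
    using \<mu> by (intro levy_continuity1) auto
  have bd: "norm (char (distr M borel (\<lambda>\<omega>. W k \<omega> + R k \<omega>)) t - char (distr M borel (W k)) t)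
      \<le> expectation (\<lambda>\<omega>. \<bar>R k \<omega>\<bar>) * \<bar>t\<bar>" for k
  proof -
    have "char (distr M borel (\<lambda>\<omega>. W k \<omega> + R k \<omega>)) t - char (distr M borel (W k)) t
        = (CLINT \<omega>|M. iexp (t * (W k \<omega> + R k \<omega>))) - (CLINT \<omega>|M. iexp (t * W k \<omega>))"
      by (simp add: char_def integral_distr)
    also have "\<dots> = (CLINT \<omega>|M. iexp (t * (W k \<omega> + R k \<omega>)) - iexp (t * W k \<omega>))"
      by (intro Bochner_Integration.integral_diff[symmetric] integrable_iexp) auto
    also have "norm \<dots> \<le> expectation (\<lambda>\<omega>. norm (iexp (t * (W k \<omega> + R k \<omega>)) - iexp (t * W k \<omega>)))"
      by (rule integral_norm_bound)
    also have "\<dots> \<le> expectation (\<lambda>\<omega>. \<bar>R k \<omega>\<bar> * \<bar>t\<bar>)"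
    proof (rule integral_mono)
      show "integrable M (\<lambda>\<omega>. norm (iexp (t * (W k \<omega> + R k \<omega>)) - iexp (t * W k \<omega>)))"
        by (intro integrable_norm Bochner_Integration.integrable_diff integrable_iexp) auto
      show "integrable M (\<lambda>\<omega>. \<bar>R k \<omega>\<bar> * \<bar>t\<bar>)" using R(1) by auto
      fix \<omega>
      have "iexp (t * (W k \<omega> + R k \<omega>)) - iexp (t * W k \<omega>)
          = iexp (t * W k \<omega>) * (iexp (t * R k \<omega>) - 1)"
        by (simp add: algebra_simps flip: exp_add)
      also have "norm \<dots> = norm (iexp (t * R k \<omega>) - 1)" by (simp add: norm_mult)
      \<comment> \<open>Order 0 of the Taylor estimate is |exp(i x) - 1| \<le> |x|.\<close>
      also have "\<dots> \<le> \<bar>R k \<omega>\<bar> * \<bar>t\<bar>"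
        using iexp_approx1[of "t * R k \<omega>" 0] by (simp add: abs_mult mult.commute)
      finally show "norm (iexp (t * (W k \<omega> + R k \<omega>)) - iexp (t * W k \<omega>)) \<le> \<bar>R k \<omega>\<bar> * \<bar>t\<bar>" .
    qed
    also have "\<dots> = expectation (\<lambda>\<omega>. \<bar>R k \<omega>\<bar>) * \<bar>t\<bar>" by simp
    finally show ?thesis .
  qed
  have "(\<lambda>k. char (distr M borel (\<lambda>\<omega>. W k \<omega> + R k \<omega>)) t - char (distr M borel (W k)) t) \<longlonglongrightarrow> 0"
    by (rule Lim_null_comparison[where g="\<lambda>k. expectation (\<lambda>\<omega>. \<bar>R k \<omega>\<bar>) * \<bar>t\<bar>"])
      (use bd R(2) in \<open>auto intro!: tendsto_eq_intros\<close>)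
  from tendsto_add[OF this c]
  show "(\<lambda>k. char (distr M borel (\<lambda>\<omega>. W k \<omega> + R k \<omega>)) t) \<longlonglongrightarrow> char \<mu> t" by simp
qed

text \<open>For fixed \<open>t\<close> the map x |-> exp(i t f(x)) is bounded and continuous, and
  its integral is the characteristic function at \<open>t\<close> of the image under
  \<open>f\<close>.\<close>

lemma weak_conv_m_distr_continuous:
  fixes f :: "real \<Rightarrow> real"
  assumes \<mu>: "\<And>k. real_distribution (\<mu> k)" "real_distribution \<nu>" "weak_conv_m \<mu> \<nu>"
    and f: "\<And>x. isCont f x"
  shows "weak_conv_m (\<lambda>k. distr (\<mu> k) borel f) (distr \<nu> borel f)"
proof -
  have fm: "f \<in> borel_measurable borel"
    using f by (intro borel_measurable_continuous_onI continuous_at_imp_continuous_on) auto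
  have m: "f \<in> borel_measurable \<rho>" if "real_distribution \<rho>" for \<rho>
    using fm real_distribution.events_eq_borel[OF that] measurable_cong_sets by blast
  have d: "real_distribution (distr \<rho> borel f)" if "real_distribution \<rho>" for \<rho>
    using prob_space.real_distribution_distr real_distribution.axioms(1)[OF that] m[OF that] by blast
  show ?thesis
  proof (rule levy_continuity)
    fix t
    have "(\<lambda>k. integral\<^sup>L (\<mu> k) (\<lambda>x. iexp (t * f x))) \<longlonglongrightarrow> integral\<^sup>L \<nu> (\<lambda>x. iexp (t * f x))"
      by (rule weak_conv_imp_integral_bdd_continuous_conv[where B=1, OF \<mu>])
        (use f in \<open>auto intro!: continuous_intros\<close>)
    then show "(\<lambda>k. char (distr (\<mu> k) borel f) t) \<longlonglongrightarrow> char (distr \<nu> borel f) t"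
      by (simp add: char_def integral_distr m \<mu>)
  qed (use d \<mu> in auto)
qed

text \<open>The limit law is needed as an image of the one-dimensional normal law, the form in which
  squaring produces it.\<close>

lemma chi_square_distribution_1:
  "chi_square_distribution 1 = distr std_normal_distribution borel (\<lambda>x. x\<^sup>2)"
proof -
  interpret real_distribution std_normal_distribution by (rule real_dist_normal_dist)
  interpret P: product_prob_space "\<lambda>_. std_normal_distribution" "{..<1::nat}" ..
  have "distr (\<Pi>\<^sub>M i\<in>{..<1::nat}. std_normal_distribution) borel (\<lambda>z. (z 0)\<^sup>2)
    = distr (distr (\<Pi>\<^sub>M i\<in>{..<1::nat}. std_normal_distribution) std_normal_distribution (\<lambda>z. z 0)) borel (\<lambda>x. x\<^sup>2)"
    by (subst distr_distr) (auto simp: comp_def)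
  also have "distr (\<Pi>\<^sub>M i\<in>{..<1::nat}. std_normal_distribution) std_normal_distribution (\<lambda>z. z 0)
      = std_normal_distribution"
    by (intro P.PiM_component) auto
  finally show ?thesis by (simp add: chi_square_distribution_def)
qed

text \<open>The weights may depend on \<open>k\<close> because the second moments are uniformly bounded, so that
  replacing the weights by their limits is an \<open>L\<^sup>1\<close>-null perturbation.\<close>

lemma (in prob_space) weak_conv_m_indep_combination:
  fixes A B :: "nat \<Rightarrow> 'a \<Rightarrow> real"
  assumes ind: "\<And>i j. indep_var borel (A i) borel (B j)"
    and A: "\<And>k. integrable M (\<lambda>\<omega>. (A k \<omega>)\<^sup>2)" "\<And>k. expectation (\<lambda>\<omega>. (A k \<omega>)\<^sup>2) \<le> 1"
       "weak_conv_m (\<lambda>k. distr M borel (A k)) std_normal_distribution"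
    and B: "\<And>k. integrable M (\<lambda>\<omega>. (B k \<omega>)\<^sup>2)" "\<And>k. expectation (\<lambda>\<omega>. (B k \<omega>)\<^sup>2) \<le> 1"
       "weak_conv_m (\<lambda>k. distr M borel (B k)) std_normal_distribution"
    and ab: "a \<longlonglongrightarrow> a0" "b \<longlonglongrightarrow> b0" "a0\<^sup>2 + b0\<^sup>2 = (1::real)"
    and n: "filterlim n at_top sequentially" and m: "filterlim m at_top sequentially"
  shows "weak_conv_m (\<lambda>k. distr M borel (\<lambda>\<omega>. a k * A (n k) \<omega> + b k * B (m k) \<omega>)) std_normal_distribution"
proof -
  have [measurable]: "A k \<in> borel_measurable M" "B k \<in> borel_measurable M" for k
    using ind[of k k] indep_var_rv1 indep_var_rv2 by blast+
  have iA: "integrable M (A k)" and iB: "integrable M (B k)" for k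
    using A(1) B(1) square_integrable_imp_integrable[of "A k"] square_integrable_imp_integrable[of "B k"] by auto
  have eA: "expectation (\<lambda>\<omega>. \<bar>A k \<omega>\<bar>) \<le> 1" and eB: "expectation (\<lambda>\<omega>. \<bar>B k \<omega>\<bar>) \<le> 1" for k
    using expectation_abs_le_sqrt[of "A k"] expectation_abs_le_sqrt[of "B k"] A(1,2)[of k] B(1,2)[of k]
      real_sqrt_le_1_iff[of "expectation (\<lambda>\<omega>. (A k \<omega>)\<^sup>2)"] real_sqrt_le_1_iff[of "expectation (\<lambda>\<omega>. (B k \<omega>)\<^sup>2)"]
    by (auto intro: order.trans)
  define R where "R k \<omega> = (a k - a0) * A (n k) \<omega> + (b k - b0) * B (m k) \<omega>" for k \<omega>
  have "weak_conv_m (\<lambda>k. distr M borel (\<lambda>\<omega>. (a0 * A (n k) \<omega> + b0 * B (m k) \<omega>) + R k \<omega>)) std_normal_distribution"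
  proof (rule weak_conv_m_add_L1_null)
    show "integrable M (R k)" for k unfolding R_def using iA iB by auto
    have le: "expectation (\<lambda>\<omega>. \<bar>R k \<omega>\<bar>) \<le> \<bar>a k - a0\<bar> + \<bar>b k - b0\<bar>" for k
    proof -
      have "expectation (\<lambda>\<omega>. \<bar>R k \<omega>\<bar>)
        \<le> expectation (\<lambda>\<omega>. \<bar>a k - a0\<bar> * \<bar>A (n k) \<omega>\<bar> + \<bar>b k - b0\<bar> * \<bar>B (m k) \<omega>\<bar>)"
        unfolding R_def using iA iB
        by (intro integral_mono) (auto intro!: order.trans[OF abs_triangle_ineq] simp: abs_mult)
      also have "\<dots> = \<bar>a k - a0\<bar> * expectation (\<lambda>\<omega>. \<bar>A (n k) \<omega>\<bar>) + \<bar>b k - b0\<bar> * expectation (\<lambda>\<omega>. \<bar>B (m k) \<omega>\<bar>)"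
        using iA iB by simp
      also have "\<dots> \<le> \<bar>a k - a0\<bar> * 1 + \<bar>b k - b0\<bar> * 1"
        by (intro add_mono mult_left_mono eA eB) auto
      finally show ?thesis by simp
    qed
    have "(\<lambda>k. \<bar>a k - a0\<bar> + \<bar>b k - b0\<bar>) \<longlonglongrightarrow> 0"
      using tendsto_add[OF tendsto_rabs_zero[OF LIM_zero[OF ab(1)]] tendsto_rabs_zero[OF LIM_zero[OF ab(2)]]]
      by simp
    then show "(\<lambda>k. expectation (\<lambda>\<omega>. \<bar>R k \<omega>\<bar>)) \<longlonglongrightarrow> 0"
      by (rule tendsto_sandwich[OF always_eventually always_eventually tendsto_const, rotated 2])
        (simp_all add: le)
    show "weak_conv_m (\<lambda>k. distr M borel (\<lambda>\<omega>. a0 * A (n k) \<omega> + b0 * B (m k) \<omega>)) std_normal_distribution"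
    proof (rule levy_continuity[OF _ real_dist_normal_dist])
      fix t
      have scale: "char (distr M borel (\<lambda>\<omega>. c * f \<omega>)) t = char (distr M borel f) (t * c)"
        if "f \<in> borel_measurable M" for f :: "'a \<Rightarrow> real" and c
        using that by (simp add: char_def integral_distr mult_ac)
      have "indep_var borel (\<lambda>\<omega>. a0 * A (n k) \<omega>) borel (\<lambda>\<omega>. b0 * B (m k) \<omega>)" for k
        using indep_var_compose[OF ind[of "n k" "m k"], of "\<lambda>x. a0 * x" borel "\<lambda>x. b0 * x" borel]
        by (simp add: comp_def)
      then have eq: "char (distr M borel (\<lambda>\<omega>. a0 * A (n k) \<omega> + b0 * B (m k) \<omega>)) t
          = char (distr M borel (A (n k))) (t * a0) * char (distr M borel (B (m k))) (t * b0)" for k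
        by (simp add: char_distr_add scale)
      have "(\<lambda>k. char (distr M borel (A k)) (t * a0)) \<longlonglongrightarrow> char std_normal_distribution (t * a0)"
        "(\<lambda>k. char (distr M borel (B k)) (t * b0)) \<longlonglongrightarrow> char std_normal_distribution (t * b0)"
        using A(3) B(3) real_dist_normal_dist by (auto intro!: levy_continuity1)
      then have "(\<lambda>k. char (distr M borel (A (n k))) (t * a0) * char (distr M borel (B (m k))) (t * b0))
          \<longlonglongrightarrow> char std_normal_distribution (t * a0) * char std_normal_distribution (t * b0)"
        by (intro tendsto_mult filterlim_compose[OF _ n] filterlim_compose[OF _ m])
      \<comment> \<open>The Gaussian characteristic functions at \<open>t * a0\<close> and
        \<open>t * b0\<close> multiply to the one at \<open>t\<close> because
        \<open>a0\<^sup>2 + b0\<^sup>2 = 1\<close>.\<close>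
      also have "char std_normal_distribution (t * a0) * char std_normal_distribution (t * b0)
          = exp (- (t * a0)\<^sup>2 / 2 + - (t * b0)\<^sup>2 / 2)"
        by (simp add: char_std_normal_distribution del: of_real_exp flip: of_real_mult exp_add)
      also have "- (t * a0)\<^sup>2 / 2 + - (t * b0)\<^sup>2 / 2 = - t\<^sup>2 * (a0\<^sup>2 + b0\<^sup>2) / 2"
        by (simp add: field_simps power2_eq_square)
      also have "complex_of_real (exp (- t\<^sup>2 * (a0\<^sup>2 + b0\<^sup>2) / 2)) = char std_normal_distribution t"
        by (simp add: ab(3) char_std_normal_distribution)
      finally show "(\<lambda>k. char (distr M borel (\<lambda>\<omega>. a0 * A (n k) \<omega> + b0 * B (m k) \<omega>)) t)
          \<longlonglongrightarrow> char std_normal_distribution t" by (simp add: eq)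
    qed simp
  qed (auto simp: real_dist_normal_dist)
  then show ?thesis by (simp add: R_def algebra_simps)
qed

section \<open>Independent identically distributed families\<close>

text \<open>The empirical measure counts indices, so an injective renaming preserves all weights
  even if observations coincide.\<close>

lemma empirical_reindex:
  assumes "finite I" "inj_on f I" "\<And>i. i \<in> I \<Longrightarrow> x (f i) \<in> space \<Omega>"
  shows "empirical \<Omega> (f ` I) x = empirical \<Omega> I (\<lambda>i. x (f i))"
unfolding empirical_def
proof (rule measure_eqI)
    fix A assume "A \<in> sets (distr (uniform_count_measure (f ` I)) \<Omega> x)"
    then have A: "A \<in> sets \<Omega>" by simp
    have eq: "x -` A \<inter> f ` I = f ` ((\<lambda>i. x (f i)) -` A \<inter> I)" by auto
    have "card (x -` A \<inter> f ` I) = card ((\<lambda>i. x (f i)) -` A \<inter> I)"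
      unfolding eq using assms(2) by (intro card_image) (auto intro: inj_on_subset)
    moreover have "card (f ` I) = card I" using assms(2) by (rule card_image)
    ultimately show "emeasure (distr (uniform_count_measure (f ` I)) \<Omega> x) A =
        emeasure (distr (uniform_count_measure I) \<Omega> (\<lambda>i. x (f i))) A"
      using A assms
      by (subst (1 2) emeasure_distr)
        (auto simp: measurable_def space_uniform_count_measure sets_uniform_count_measure emeasure_uniform_count_measure)
qed simp

text \<open>Fubini for the product law of \<open>U\<close> and \<open>V\<close>, with boundedness of
  \<open>g\<close> for integrability. It stands in for conditioning on \<open>V\<close>.\<close>

lemma (in prob_space) indep_var_integrate_out:
  fixes g :: "'b \<times> 'b \<Rightarrow> real"
  assumes ind: "indep_var S U T V" and g: "g \<in> borel_measurable (S \<Otimes>\<^sub>M T)"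
    and B: "\<And>u v. u \<in> space S \<Longrightarrow> v \<in> space T \<Longrightarrow> \<bar>g (u, v)\<bar> \<le> B"
  shows "expectation (\<lambda>\<omega>. g (U \<omega>, V \<omega>)) = expectation (\<lambda>\<omega>. \<integral>u. g (u, V \<omega>) \<partial>distr M S U)"
proof -
  note [measurable] = indep_var_rv1[OF ind] indep_var_rv2[OF ind] g
  interpret U: prob_space "distr M S U" by (rule prob_space_distr) simp
  interpret V: prob_space "distr M T V" by (rule prob_space_distr) simp
  interpret UV: pair_prob_space "distr M S U" "distr M T V" ..
  have eq: "distr M S U \<Otimes>\<^sub>M distr M T V = distr M (S \<Otimes>\<^sub>M T) (\<lambda>x. (U x, V x))"
    using ind indep_var_distribution_eq by blast
  have int: "integrable (distr M S U \<Otimes>\<^sub>M distr M T V) (\<lambda>(u, v). g (u, v))"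
    by (rule UV.integrable_const_bound[where B=B]) (use B in \<open>auto simp: space_pair_measure\<close>)
  have "expectation (\<lambda>\<omega>. g (U \<omega>, V \<omega>)) = integral\<^sup>L (distr M (S \<Otimes>\<^sub>M T) (\<lambda>x. (U x, V x))) g"
    by (simp add: integral_distr)
  also have "\<dots> = integral\<^sup>L (distr M S U \<Otimes>\<^sub>M distr M T V) (\<lambda>(u, v). g (u, v))" by (simp add: eq)
  also have "\<dots> = (\<integral>v. \<integral>u. g (u, v) \<partial>distr M S U \<partial>distr M T V)"
    using UV.integral_snd[OF int] by simp
  also have "\<dots> = expectation (\<lambda>\<omega>. \<integral>u. g (u, V \<omega>) \<partial>distr M S U)"
    by (subst integral_distr) auto
  finally show ?thesis .
qed

lemma (in prob_space) indep_vars_distr_reindex: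
  fixes Z :: "'i \<Rightarrow> 'a \<Rightarrow> 'b" and \<sigma> :: "'j \<Rightarrow> 'i"
  assumes ind: "indep_vars (\<lambda>_. N) Z UNIV" and Z: "\<And>p. distr M N (Z p) = P" and \<sigma>: "inj \<sigma>"
  shows "distr M (\<Pi>\<^sub>M j\<in>UNIV. N) (\<lambda>\<omega> j. Z (\<sigma> j) \<omega>) = (\<Pi>\<^sub>M j\<in>UNIV. P)"
proof -
  have [measurable]: "Z p \<in> measurable M N" for p
    using ind by (auto simp: indep_vars_def)
  have P: "prob_space P" using Z prob_space_distr[of "Z undefined" N] by auto
  have sP[simp]: "sets P = sets N" using Z by (metis sets_distr)
  have setsPi: "sets (\<Pi>\<^sub>M j\<in>UNIV. P) = sets (\<Pi>\<^sub>M j\<in>UNIV. N)" by (intro sets_PiM_cong) auto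
  have "distr M (\<Pi>\<^sub>M p\<in>UNIV. N) (\<lambda>\<omega> p. Z p \<omega>) = (\<Pi>\<^sub>M p\<in>UNIV. P)"
    using indep_vars_iff_distr_eq_PiM'[of UNIV Z "\<lambda>_. N"] ind by (simp add: Z restrict_def)
  then have all: "(\<Pi>\<^sub>M p\<in>UNIV. P) = distr M (\<Pi>\<^sub>M p\<in>UNIV. N) (\<lambda>\<omega> p. Z p \<omega>)" ..
  have [measurable]: "(\<lambda>z j. z (\<sigma> j)) \<in> measurable (\<Pi>\<^sub>M p\<in>UNIV. N) (\<Pi>\<^sub>M j\<in>UNIV. N)"
    "(\<lambda>\<omega> p. Z p \<omega>) \<in> measurable M (\<Pi>\<^sub>M p\<in>UNIV. N)"
    by (rule measurable_PiM_single'; auto simp: space_PiM measurable_space[OF \<open>Z _ \<in> measurable M N\<close>])+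
  have "distr M (\<Pi>\<^sub>M j\<in>UNIV. N) (\<lambda>\<omega> j. Z (\<sigma> j) \<omega>)
      = distr (\<Pi>\<^sub>M p\<in>UNIV. P) (\<Pi>\<^sub>M j\<in>UNIV. N) (\<lambda>z j. z (\<sigma> j))"
    unfolding all by (subst distr_distr) (auto simp: comp_def)
  also have "\<dots> = distr (\<Pi>\<^sub>M p\<in>UNIV. P) (\<Pi>\<^sub>M j\<in>UNIV. P) (\<lambda>z. \<lambda>j\<in>UNIV. z (\<sigma> j))"
    by (intro distr_cong) (auto simp: setsPi)
  also have "\<dots> = (\<Pi>\<^sub>M j\<in>UNIV. P)"
    using distr_PiM_reindex[of UNIV "\<lambda>_. P" \<sigma> UNIV] P \<sigma> by auto
  finally show ?thesis .
qed

section \<open>Pooled observations under the null hypothesis\<close>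

locale two_sample_null = two_sample_depth M \<Omega> D P P X Y
  for M :: "'a measure" and \<Omega> :: "'b measure" and D P X Y
begin

text \<open>With P = Q the pooled observations are one i.i.d. family. Permuting a sample, shifting
  its indices, exchanging one X with one Y and exchanging whole samples all become
  \<open>obs \<omega> \<circ> \<sigma>\<close> for an injective \<open>\<sigma>\<close>.\<close>

definition obs :: "'a \<Rightarrow> nat + nat \<Rightarrow> 'b" where
  "obs \<omega> p = case_sum X Y p \<omega>"

definition N :: "(nat + nat \<Rightarrow> 'b) measure" where
  "N = (\<Pi>\<^sub>M p\<in>UNIV. \<Omega>)"

lemma obs_simps [simp]: "obs \<omega> (Inl i) = X i \<omega>" "obs \<omega> (Inr j) = Y j \<omega>"
  by (simp_all add: obs_def)

lemma observation_measurable [measurable]: "(\<lambda>\<omega>. obs \<omega> p) \<in> measurable M \<Omega>"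
  using indep by (auto simp: indep_vars_def obs_def)

lemma X_measurable [measurable]: "X i \<in> measurable M \<Omega>" and Y_measurable [measurable]: "Y j \<in> measurable M \<Omega>"
  using observation_measurable[of "Inl i"] observation_measurable[of "Inr j"] by simp_all

lemma distr_observation: "distr M \<Omega> (\<lambda>\<omega>. obs \<omega> p) = P"
  using X_distribution Y_distribution by (cases p) (simp_all add: obs_def)

lemma indep_observations: "indep_vars (\<lambda>_. \<Omega>) (\<lambda>p \<omega>. obs \<omega> p) UNIV"
  using indep by (simp add: obs_def eta_contract_eq)

lemma sets_P [measurable_cong]: "sets P = sets \<Omega>"
  using P_distribution by (auto simp: space_prob_algebra)

lemma space_P: "space P = space \<Omega>"
  by (rule sets_eq_imp_space_eq) (rule sets_P)

lemma prob_space_P: "prob_space P"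
  using P_distribution by (auto simp: space_prob_algebra)

lemma space_N_iff: "z \<in> space N \<longleftrightarrow> (\<forall>p. z p \<in> space \<Omega>)"
  by (auto simp: N_def space_PiM)

lemma coordinate_measurable [measurable]: "(\<lambda>z. z p) \<in> measurable N \<Omega>"
  unfolding N_def by measurable

lemma measurable_N_I: "(\<And>p. (\<lambda>x. f x p) \<in> measurable L \<Omega>) \<Longrightarrow> f \<in> measurable L N"
  unfolding N_def by (rule measurable_PiM_single') (auto simp: measurable_def)

lemma obs_comp_measurable: "(\<lambda>\<omega>. obs \<omega> \<circ> \<sigma>) \<in> measurable M N"
  by (rule measurable_N_I) simp

lemma obs_measurable [measurable]: "obs \<in> measurable M N"
  by (rule measurable_N_I) simp

lemma obs_space: "\<omega> \<in> space M \<Longrightarrow> obs \<omega> \<in> space N"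
  using measurable_space[OF obs_measurable] by blast

lemma distr_obs_comp: 
  assumes "inj \<sigma>"
  shows "distr M N (\<lambda>\<omega>. obs \<omega> \<circ> \<sigma>) = distr M N obs"
  using indep_vars_distr_reindex[OF indep_observations distr_observation assms]
    indep_vars_distr_reindex[OF indep_observations distr_observation inj_on_id2]
  by (simp add: N_def comp_def)

lemma expectation_obs_comp:
  fixes f :: "_ \<Rightarrow> real"
  assumes "inj \<sigma>" and [measurable]: "f \<in> borel_measurable N"
  shows "expectation (\<lambda>\<omega>. f (obs \<omega> \<circ> \<sigma>)) = expectation (\<lambda>\<omega>. f (obs \<omega>))"
proof -
  have "expectation (\<lambda>\<omega>. f (obs \<omega> \<circ> \<sigma>)) = integral\<^sup>L (distr M N (\<lambda>\<omega>. obs \<omega> \<circ> \<sigma>)) f"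
    by (rule integral_distr[symmetric, OF obs_comp_measurable assms(2)])
  also have "\<dots> = integral\<^sup>L (distr M N obs) f" unfolding distr_obs_comp[OF assms(1)] ..
  also have "\<dots> = expectation (\<lambda>\<omega>. f (obs \<omega>))" by (rule integral_distr) auto
  finally show ?thesis .
qed

text \<open>\<open>Asm3\<close> bounds almost surely the effect of removing observation 1; this
  carries such bounds over to other indices.\<close>

lemma AE_obs_comp:
  assumes "inj \<sigma>" and [measurable]: "Measurable.pred N R" and "AE \<omega> in M. R (obs \<omega>)"
  shows "AE \<omega> in M. R (obs \<omega> \<circ> \<sigma>)"
proof -
  have "AE z in distr M N obs. R z"
    using assms(3) by (subst AE_distr_iff) (auto simp: pred_def[symmetric])
  then have "AE z in distr M N (\<lambda>\<omega>. obs \<omega> \<circ> \<sigma>). R z" unfolding distr_obs_comp[OF assms(1)] .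
  then show ?thesis using obs_comp_measurable[of \<sigma>] by (subst (asm) AE_distr_iff) (auto simp: pred_def[symmetric])
qed

text \<open>The last hypothesis says that the second argument of \<open>g\<close> is not read at
  \<open>p\<close>. Hence \<open>obs \<omega> p\<close> is independent of all else that enters and
  can be integrated out against \<open>P\<close>, which serves as conditioning on the other
  observations.\<close>

lemma expectation_integrate_out:
  fixes g :: "'b \<Rightarrow> (nat + nat \<Rightarrow> 'b) \<Rightarrow> real"
  assumes g: "case_prod g \<in> borel_measurable (\<Omega> \<Otimes>\<^sub>M N)"
    and B: "\<And>x z. x \<in> space \<Omega> \<Longrightarrow> z \<in> space N \<Longrightarrow> \<bar>g x z\<bar> \<le> B"
    and p: "\<And>x y z. x \<in> space \<Omega> \<Longrightarrow> y \<in> space \<Omega> \<Longrightarrow> z \<in> space N \<Longrightarrow> g x (z(p := y)) = g x z"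
  shows "expectation (\<lambda>\<omega>. g (obs \<omega> p) (obs \<omega>)) = expectation (\<lambda>\<omega>. \<integral>x. g x (obs \<omega>) \<partial>P)"
proof -
  let ?A = "\<Pi>\<^sub>M i\<in>{p}. \<Omega>" and ?B = "\<Pi>\<^sub>M i\<in>-{p}. \<Omega>"
  let ?U = "\<lambda>\<omega>. \<lambda>i\<in>{p}. obs \<omega> i" and ?V = "\<lambda>\<omega>. \<lambda>i\<in>-{p}. obs \<omega> i"
  \<comment> \<open>\<open>h\<close> reassembles a full point from two independent blocks. The
    restricted \<open>v\<close> is \<open>undefined\<close> at \<open>p\<close>, so this coordinate
    must be filled in before \<open>g\<close> is applied.\<close>
  define h where "h = (\<lambda>(u :: nat + nat \<Rightarrow> 'b, v). g (u p) (v(p := u p)))"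
  have ind: "indep_var ?A ?U ?B ?V"
    by (rule indep_var_restrict[OF indep_observations]) auto
  have m: "(\<lambda>(u, v). v(p := u p)) \<in> measurable (?A \<Otimes>\<^sub>M ?B) N"
  proof (rule measurable_N_I)
    fix q show "(\<lambda>x. (case x of (u, v) \<Rightarrow> v(p := u p)) q) \<in> measurable (?A \<Otimes>\<^sub>M ?B) \<Omega>"
      by (cases "q = p") (auto simp: case_prod_beta)
  qed
  have hm: "h \<in> borel_measurable (?A \<Otimes>\<^sub>M ?B)"
    unfolding h_def case_prod_beta
    using measurable_compose[OF measurable_Pair[OF _ m] g, of "\<lambda>x. fst x p"]
    by (simp add: case_prod_beta)
  have upd: "(?V \<omega>)(p := x) = (obs \<omega>)(p := x)" for \<omega> x by auto
  have "expectation (\<lambda>\<omega>. g (obs \<omega> p) (obs \<omega>)) = expectation (\<lambda>\<omega>. h (?U \<omega>, ?V \<omega>))"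
    by (intro Bochner_Integration.integral_cong refl) (simp add: h_def upd)
  also have "\<dots> = expectation (\<lambda>\<omega>. \<integral>u. h (u, ?V \<omega>) \<partial>distr M ?A ?U)"
  proof (rule indep_var_integrate_out[OF ind hm])
    fix u v assume uv: "u \<in> space ?A" "v \<in> space ?B"
    then have "v(p := u p) \<in> space N" by (auto simp: space_N_iff space_PiM PiE_iff)
    then show "\<bar>h (u, v)\<bar> \<le> B" using uv unfolding h_def by (auto intro!: B simp: space_PiM)
  qed
  also have "\<dots> = expectation (\<lambda>\<omega>. \<integral>x. g x (obs \<omega>) \<partial>P)"
  proof (intro Bochner_Integration.integral_cong refl)
    fix \<omega> assume \<omega>: "\<omega> \<in> space M"
    have [measurable]: "(\<lambda>x. g x (obs \<omega>)) \<in> borel_measurable \<Omega>"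
      using measurable_Pair1[OF g obs_space[OF \<omega>]] by (simp add: case_prod_beta)
    have "?V \<omega> \<in> space ?B" using obs_space[OF \<omega>] by (auto simp: space_PiM space_N_iff)
    then have [measurable]: "(\<lambda>u. h (u, ?V \<omega>)) \<in> borel_measurable ?A"
      by (rule measurable_Pair1[OF hm])
    have "(\<integral>u. h (u, ?V \<omega>) \<partial>distr M ?A ?U) = (\<integral>\<omega>'. h (?U \<omega>', ?V \<omega>) \<partial>M)"
      by (subst integral_distr) auto
    also have "\<dots> = (\<integral>\<omega>'. g (obs \<omega>' p) (obs \<omega>) \<partial>M)"
      by (intro Bochner_Integration.integral_cong refl)
        (use \<omega> in \<open>auto simp: h_def upd intro!: p obs_space measurable_space[OF observation_measurable]\<close>)
    also have "\<dots> = (\<integral>x. g x (obs \<omega>) \<partial>distr M \<Omega> (\<lambda>\<omega>. obs \<omega> p))"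
      by (subst integral_distr) auto
    finally show "(\<integral>u. h (u, ?V \<omega>) \<partial>distr M ?A ?U) = (\<integral>x. g x (obs \<omega>) \<partial>P)"
      by (simp add: distr_observation)
  qed
  finally show ?thesis .
qed

end

section \<open>The kernel of the statistic and its leave-one-out version\<close>

definition precedes :: "real \<Rightarrow> real \<Rightarrow> real" where
  "precedes a b = of_bool (a < b) + 1 / 2 * of_bool (a = b)"

lemma precedes_bounds: "0 \<le> precedes a b" "precedes a b \<le> 1"
  by (auto simp: precedes_def)

text \<open>The weight 1/2 for ties makes this identity exact even where empirical depths tie; the
  antisymmetry of the centred kernel rests on it.\<close>

lemma precedes_swap: "precedes b a = 1 - precedes a b"
  by (auto simp: precedes_def)

lemma precedes_measurable [measurable (raw)]:
  assumes [measurable]: "f \<in> borel_measurable L" "g \<in> borel_measurable L"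
  shows "(\<lambda>x. precedes (f x) (g x)) \<in> borel_measurable L"
  unfolding precedes_def by measurable

text \<open>Shifting each value by at most \<open>c\<close> can change their order only if they were
  within \<open>2 * c\<close>. The near tie is one of the primed values, so that it can be taken at
  the reduced sample, of which both observations are independent.\<close>

lemma precedes_perturb:
  assumes "\<bar>a - a'\<bar> \<le> c" "\<bar>b - b'\<bar> \<le> c"
  shows "\<bar>precedes a b - precedes a' b'\<bar> \<le> of_bool (\<bar>a' - b'\<bar> \<le> 2 * c)"
proof (cases "\<bar>a' - b'\<bar> \<le> 2 * c")
  case True
  then show ?thesis using precedes_bounds[of a b] precedes_bounds[of a' b'] by auto
next
  case False
  then show ?thesis using assms by (auto simp: precedes_def)
qed

text \<open>Exactly one of three distinct values is the greatest; by symmetry this gives the mid-rank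
  transform the second moment \<open>1/3\<close> without identifying its distribution as uniform.\<close>

lemma precedes_cyclic:
  assumes "a \<noteq> b" "b \<noteq> c" "a \<noteq> c"
  shows "precedes b a * precedes c a + precedes a b * precedes c b + precedes a c * precedes b c = 1"
  using assms by (auto simp: precedes_def)

lemma empirical_cong: 
  assumes "\<And>i. i \<in> I \<Longrightarrow> x i = y i"
  shows "empirical \<Omega> I x = empirical \<Omega> I y"
  unfolding empirical_def by (rule distr_cong) (use assms in \<open>auto simp: space_uniform_count_measure\<close>)

context two_sample_null
begin

definition emp :: "nat set \<Rightarrow> (nat + nat \<Rightarrow> 'b) \<Rightarrow> 'b measure" where
  "emp I z = empirical \<Omega> I (\<lambda>i. z (Inl i))"

definition emp_depth :: "nat set \<Rightarrow> nat + nat \<Rightarrow> (nat + nat \<Rightarrow> 'b) \<Rightarrow> real" where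
  "emp_depth I p z = D (z p) (emp I z)"

definition mid_rank :: "'b \<Rightarrow> real" where
  "mid_rank x = (\<integral>x'. precedes (D x' P) (D x P) \<partial>P)"

definition kernel :: "nat set \<Rightarrow> nat \<Rightarrow> nat \<Rightarrow> (nat + nat \<Rightarrow> 'b) \<Rightarrow> real" where
  "kernel I i j z = precedes (emp_depth I (Inl i) z) (emp_depth I (Inr j) z)"

definition kernel_lim :: "nat \<Rightarrow> nat \<Rightarrow> (nat + nat \<Rightarrow> 'b) \<Rightarrow> real" where
  "kernel_lim i j z = precedes (D (z (Inl i)) P) (D (z (Inr j)) P)"

text \<open>The Hoeffding projection of \<open>kernel_lim\<close>: its conditional means are
  \<open>mid_rank\<close> of the Y value and 1 minus \<open>mid_rank\<close> of the X value; their
  sum less the overall mean 1/2 is this expression.\<close>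

definition proj :: "nat \<Rightarrow> nat \<Rightarrow> (nat + nat \<Rightarrow> 'b) \<Rightarrow> real" where
  "proj i j z = 1 / 2 + mid_rank (z (Inr j)) - mid_rank (z (Inl i))"

lemma emp_cong: "(\<And>i. i \<in> I \<Longrightarrow> z (Inl i) = z' (Inl i)) \<Longrightarrow> emp I z = emp I z'"
  unfolding emp_def by (rule empirical_cong)

lemma emp_upd: "p \<notin> Inl ` I \<Longrightarrow> emp I (z(p := y)) = emp I z"
  by (rule emp_cong) auto

lemma emp_comp:
  assumes "z \<in> space N" "finite I" "inj_on \<pi> I" "\<And>i. i \<in> I \<Longrightarrow> \<sigma> (Inl i) = Inl (\<pi> i)"
  shows "emp I (z \<circ> \<sigma>) = emp (\<pi> ` I) z"
proof -
  have "emp I (z \<circ> \<sigma>) = empirical \<Omega> I (\<lambda>i. z (Inl (\<pi> i)))"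
    unfolding emp_def by (rule empirical_cong) (simp add: assms)
  also have "\<dots> = emp (\<pi> ` I) z"
    unfolding emp_def by (rule empirical_reindex[symmetric]) (use assms in \<open>auto simp: space_N_iff\<close>)
  finally show ?thesis .
qed

lemma emp_depth_comp:
  assumes "z \<in> space N" "finite I" "inj_on \<pi> I" "\<And>i. i \<in> I \<Longrightarrow> \<sigma> (Inl i) = Inl (\<pi> i)"
  shows "emp_depth I p (z \<circ> \<sigma>) = emp_depth (\<pi> ` I) (\<sigma> p) z"
  by (simp add: emp_depth_def emp_comp[OF assms])

text \<open>Measurability is assumed only for the samples \<open>{1..k}\<close>, so \<open>I\<close>
  is first enumerated by \<open>{1..card I}\<close>.\<close>

lemma depth_emp_measurable:
  assumes "finite I" "I \<noteq> {}"
  shows "(\<lambda>(x, z). D x (emp I z)) \<in> borel_measurable (\<Omega> \<Otimes>\<^sub>M N)"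
proof -
  obtain f where f: "bij_betw f {1..card I} I"
    using ex_bij_betw_nat_finite_1[OF assms(1)] by blast
  have k: "card I \<ge> 1" using assms by (simp add: Suc_leI card_gt_0_iff)
  let ?w = "\<lambda>z. \<lambda>i\<in>{1..card I}. z (Inl (f i))"
  have eq: "emp I z = empirical \<Omega> {1..card I} (?w z)" if "z \<in> space N" for z
  proof -
    have "emp I z = emp (f ` {1..card I}) z" using f by (simp add: bij_betw_def)
    also have "\<dots> = empirical \<Omega> {1..card I} (\<lambda>i. z (Inl (f i)))"
      unfolding emp_def by (rule empirical_reindex) (use f that in \<open>auto simp: bij_betw_def space_N_iff\<close>)
    also have "\<dots> = empirical \<Omega> {1..card I} (?w z)" by (rule empirical_cong) simp
    finally show ?thesis .
  qed
  have [measurable]: "?w \<in> measurable N (\<Pi>\<^sub>M i\<in>{1..card I}. \<Omega>)"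
    by (intro measurable_restrict coordinate_measurable)
  have "(\<lambda>y. case (fst y, ?w (snd y)) of (x, w) \<Rightarrow> D x (empirical \<Omega> {1..card I} w)) \<in> borel_measurable (\<Omega> \<Otimes>\<^sub>M N)"
    by (rule measurable_compose[OF _ D_empirical_measurable[OF k]]) measurable
  then show ?thesis
    by (rule measurable_cong[THEN iffD1, rotated]) (auto simp: space_pair_measure eq)
qed

lemma emp_depth_measurable [measurable (raw)]:
  assumes "finite I" "I \<noteq> {}"
  shows "emp_depth I p \<in> borel_measurable N"
proof -
  have "(\<lambda>z. case (z p, z) of (x, z) \<Rightarrow> D x (emp I z)) \<in> borel_measurable N"
    by (rule measurable_compose[OF _ depth_emp_measurable[OF assms]]) measurable
  then show ?thesis by (simp add: emp_depth_def[abs_def])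
qed

lemma depth_P_measurable [measurable]: "(\<lambda>x. D x P) \<in> borel_measurable \<Omega>"
  using D_measurable by simp

lemma mid_rank_measurable [measurable]: "mid_rank \<in> borel_measurable \<Omega>"
proof -
  interpret P: prob_space P by (rule prob_space_P)
  show ?thesis unfolding mid_rank_def[abs_def] by measurable
qed

lemma integrable_P:
  fixes f :: "'b \<Rightarrow> real"
  assumes "f \<in> borel_measurable \<Omega>" "\<And>x. x \<in> space \<Omega> \<Longrightarrow> \<bar>f x\<bar> \<le> B"
  shows "integrable P f"
proof -
  interpret P: prob_space P by (rule prob_space_P)
  show ?thesis using assms by (intro P.integrable_const_bound[of _ B]) (auto simp: space_P measurable_cong_sets[OF sets_P refl])
qed

lemma mid_rank_bounds: "0 \<le> mid_rank x" "mid_rank x \<le> 1"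
proof -
  interpret P: prob_space P by (rule prob_space_P)
  have "integrable P (\<lambda>x'. precedes (D x' P) (D x P))"
    using precedes_bounds by (intro integrable_P[of _ 1]) auto
  then show "0 \<le> mid_rank x" "mid_rank x \<le> 1"
    unfolding mid_rank_def using precedes_bounds P.integral_le_const[of _ 1] by auto
qed

lemma mid_rank_upper: 
  assumes "x \<in> space \<Omega>"
  shows "(\<integral>y. precedes (D x P) (D y P) \<partial>P) = 1 - mid_rank x"
proof -
  interpret P: prob_space P by (rule prob_space_P)
  have "integrable P (\<lambda>x'. precedes (D x' P) (D x P))"
    using precedes_bounds by (intro integrable_P[of _ 1]) auto
  then show ?thesis unfolding mid_rank_def by (subst precedes_swap) (simp add: P.prob_space)
qed

lemma kernel_measurable [measurable (raw)]: "finite I \<Longrightarrow> I \<noteq> {} \<Longrightarrow> kernel I i j \<in> borel_measurable N"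
  unfolding kernel_def[abs_def] by measurable

lemma kernel_lim_measurable [measurable]: "kernel_lim i j \<in> borel_measurable N"
  unfolding kernel_lim_def[abs_def] by measurable

lemma proj_measurable [measurable]: "proj i j \<in> borel_measurable N"
  unfolding proj_def[abs_def] by measurable

lemma kernel_bounds: "\<bar>kernel I i j z - kernel J k l z'\<bar> \<le> 1" "\<bar>kernel I i j z - proj k l z'\<bar> \<le> 2"
  "\<bar>kernel_lim i j z - proj k l z'\<bar> \<le> 2" "\<bar>kernel I i j z - kernel_lim k l z'\<bar> \<le> 1"
  using precedes_bounds[of "emp_depth I (Inl i) z" "emp_depth I (Inr j) z"] 
    precedes_bounds[of "emp_depth J (Inl k) z'" "emp_depth J (Inr l) z'"]
    precedes_bounds[of "D (z (Inl i)) P" "D (z (Inr j)) P"]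
    precedes_bounds[of "D (z' (Inl k)) P" "D (z' (Inr l)) P"]
    mid_rank_bounds[of "z' (Inl k)"] mid_rank_bounds[of "z' (Inr l)"]
  unfolding kernel_def kernel_lim_def proj_def by (simp_all only: abs_le_iff) linarith+

lemma integrable_obs:
  fixes f :: "_ \<Rightarrow> real"
  assumes [measurable]: "f \<in> borel_measurable N" and "\<And>z. z \<in> space N \<Longrightarrow> \<bar>f z\<bar> \<le> B"
  shows "integrable M (\<lambda>\<omega>. f (obs \<omega>))"
  by (rule integrable_const_bound[of _ B]) (use assms(2) in \<open>auto simp: obs_space\<close>)

lemma kernel_comp:
  assumes "z \<in> space N" "finite I" "inj_on \<pi> I" "\<And>i. i \<in> I \<Longrightarrow> \<sigma> (Inl i) = Inl (\<pi> i)"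
     "\<sigma> (Inl i) = Inl i'" "\<sigma> (Inr j) = Inr j'"
  shows "kernel I i j (z \<circ> \<sigma>) = kernel (\<pi> ` I) i' j' z"
  by (simp add: kernel_def emp_depth_comp[OF assms(1-4)] assms(5,6))

lemma proj_comp: "\<sigma> (Inl i) = Inl i' \<Longrightarrow> \<sigma> (Inr j) = Inr j' \<Longrightarrow> proj i j (z \<circ> \<sigma>) = proj i' j' z"
  by (simp add: proj_def)

lemma kernel_lim_comp: "\<sigma> (Inl i) = Inl i' \<Longrightarrow> \<sigma> (Inr j) = Inr j' \<Longrightarrow> kernel_lim i j (z \<circ> \<sigma>) = kernel_lim i' j' z"
  by (simp add: kernel_lim_def)

text \<open>Exchanging \<open>X i\<close> and \<open>Y j\<close> changes the sign of the centred kernel as soon as observation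
  \<open>i\<close> does not enter the empirical measure; this is where leaving one out is needed.\<close>

lemma kernel_proj_swap:
  assumes "z \<in> space N" "finite I" "i \<notin> I"
  shows "kernel I i j (z \<circ> Transposition.transpose (Inl i) (Inr j)) - proj i j (z \<circ> Transposition.transpose (Inl i) (Inr j))
    = - (kernel I i j z - proj i j z)"
proof -
  have e: "emp I (z \<circ> Transposition.transpose (Inl i) (Inr j)) = emp I z"
    using assms(3) by (intro emp_cong) (auto simp: Transposition.transpose_def)
  show ?thesis
    unfolding kernel_def emp_depth_def e proj_def
    using precedes_swap[of "D (z (Inl i)) (emp I z)" "D (z (Inr j)) (emp I z)"] by simp
qed

text \<open>Exchanging \<open>X i\<close> with \<open>Y j\<close> preserves the joint law, fixes the
  factor with indices \<open>k\<close>, \<open>l\<close> and negates the other, so the mean equals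
  its own negative. Both index sets must omit \<open>i\<close>, but the empirical measure of the
  factor with indices \<open>i\<close>, \<open>j\<close> may contain \<open>X k\<close>.\<close>

lemma kernel_proj_orthogonal:
  assumes I: "finite I" "I \<noteq> {}" "i \<notin> I" and J: "finite J" "J \<noteq> {}" "i \<notin> J"
    and ne: "i \<noteq> k" "j \<noteq> l"
  shows "expectation (\<lambda>\<omega>. (kernel J k l (obs \<omega>) - proj k l (obs \<omega>)) * (kernel I i j (obs \<omega>) - proj i j (obs \<omega>))) = 0"
proof -
  let ?s = "Transposition.transpose (Inl i) (Inr j) :: nat + nat \<Rightarrow> nat + nat"
  define f where "f z = (kernel J k l z - proj k l z) * (kernel I i j z - proj i j z)" for z
  have [measurable]: "f \<in> borel_measurable N" unfolding f_def[abs_def] using I J by measurable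
  have "f (z \<circ> ?s) = - f z" if "z \<in> space N" for z
  proof -
    have "emp J (z \<circ> ?s) = emp J z" using J by (intro emp_cong) (auto simp: Transposition.transpose_def)
    then have "kernel J k l (z \<circ> ?s) = kernel J k l z"
      using ne by (simp add: kernel_def emp_depth_def)
    moreover have "proj k l (z \<circ> ?s) = proj k l z" using ne by (intro proj_comp) auto
    ultimately show ?thesis using kernel_proj_swap[OF that, of I i j] I by (simp add: f_def flip: mult_minus_right)
  qed
  then have "expectation (\<lambda>\<omega>. f (obs \<omega> \<circ> ?s)) = expectation (\<lambda>\<omega>. - f (obs \<omega>))"
    by (intro Bochner_Integration.integral_cong) (auto simp: obs_space)
  then have "expectation (\<lambda>\<omega>. f (obs \<omega>)) = - expectation (\<lambda>\<omega>. f (obs \<omega>))"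
    by (simp add: expectation_obs_comp)
  then show ?thesis by (simp add: f_def)
qed

end

lemma permutes_two_points:
  assumes "a \<in> S" "b \<in> S" "i \<in> S" "k \<in> S" "a \<noteq> b" "i \<noteq> k"
  obtains \<pi> where "\<pi> permutes S" "\<pi> a = i" "\<pi> b = k"
proof
  \<comment> \<open>\<open>?c\<close> is the point that \<open>transpose a i\<close> sends to
    \<open>k\<close>. It differs from \<open>a\<close> because \<open>k\<close> differs from
    \<open>i\<close>, so the inner transposition leaves \<open>a\<close> alone.\<close>
  let ?c = "Transposition.transpose a i k"
  show "Transposition.transpose a i \<circ> Transposition.transpose b ?c permutes S"
    using assms by (intro permutes_compose permutes_swap_id) (auto simp: Transposition.transpose_def)
  show "(Transposition.transpose a i \<circ> Transposition.transpose b ?c) a = i"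
    using assms by (auto simp: Transposition.transpose_def)
  show "(Transposition.transpose a i \<circ> Transposition.transpose b ?c) b = k"
    using assms by (auto simp: Transposition.transpose_def)
qed

lemma permutes_one_point:
  assumes "a \<in> S" "i \<in> S"
  obtains \<pi> where "\<pi> permutes S" "\<pi> a = i"
  using assms permutes_swap_id[of a S i] by (auto intro: that)

section \<open>Residuals and their covariances\<close>

context two_sample_null
begin

text \<open>Each term has its own reduced sample, without \<open>i\<close> only. \<open>X k\<close>
  therefore still enters the residual with indices \<open>i\<close>, \<open>j\<close>, and this is
  what can correlate residuals without common indices.\<close>

definition residual :: "nat \<Rightarrow> nat \<Rightarrow> nat \<Rightarrow> (nat + nat \<Rightarrow> 'b) \<Rightarrow> real" where
  "residual m i j z = kernel ({1..m} - {i}) i j z - proj i j z"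

text \<open>For \<open>2 \<le> m\<close> residuals have mean zero by the antisymmetry in
  \<open>kernel_proj_swap\<close>, so this product moment is a covariance. Up to relabelling only
  the indices 1 and 2 occur.\<close>

definition cov :: "nat \<Rightarrow> nat \<Rightarrow> nat \<Rightarrow> real" where
  "cov m k l = expectation (\<lambda>\<omega>. residual m 1 1 (obs \<omega>) * residual m k l (obs \<omega>))"

lemma leave_one_out_nonempty: "2 \<le> m \<Longrightarrow> {1..m} - {i} \<noteq> {}" for m i :: nat
proof -
  assume "2 \<le> m"
  then have "(if i = 1 then 2 else 1) \<in> {1..m} - {i}" by auto
  then show ?thesis by blast
qed

lemma residual_measurable: "2 \<le> m \<Longrightarrow> residual m i j \<in> borel_measurable N"
  unfolding residual_def[abs_def] by (intro borel_measurable_diff kernel_measurable leave_one_out_nonempty) auto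

lemma residual_bound: "\<bar>residual m i j z\<bar> \<le> 2"
  unfolding residual_def by (rule kernel_bounds)

lemma kernel_perm:
  assumes "z \<in> space N" "finite I" "inj \<pi>"
  shows "kernel I i j (z \<circ> map_sum \<pi> \<rho>) = kernel (\<pi> ` I) (\<pi> i) (\<rho> j) z"
  by (rule kernel_comp) (use assms in \<open>auto intro: inj_on_subset\<close>)

lemma residual_perm:
  assumes "z \<in> space N" "\<pi> permutes {1..m}"
  shows "residual m i j (z \<circ> map_sum \<pi> \<rho>) = residual m (\<pi> i) (\<rho> j) z"
proof -
  have "inj \<pi>" using assms(2) by (rule permutes_inj)
  then have "\<pi> ` ({1..m} - {i}) = {1..m} - {\<pi> i}"
    using permutes_image[OF assms(2)] by (simp add: image_set_diff)
  then show ?thesis unfolding residual_def using assms \<open>inj \<pi>\<close>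
    by (simp add: kernel_perm proj_comp)
qed

text \<open>\<open>\<pi>\<close> must preserve \<open>{1..m}\<close>, the set behind the empirical
  measures; Y indices enter no empirical measure, so any injection \<open>\<rho>\<close> will
  do.\<close>

lemma expectation_residual_perm:
  assumes "2 \<le> m" "\<pi> permutes {1..m}" "inj \<rho>"
  shows "expectation (\<lambda>\<omega>. residual m (\<pi> i) (\<rho> j) (obs \<omega>) * residual m (\<pi> k) (\<rho> l) (obs \<omega>))
    = expectation (\<lambda>\<omega>. residual m i j (obs \<omega>) * residual m k l (obs \<omega>))"
proof -
  have [measurable]: "residual m i j \<in> borel_measurable N" for i j using assms by (intro residual_measurable)
  have "expectation (\<lambda>\<omega>. residual m (\<pi> i) (\<rho> j) (obs \<omega>) * residual m (\<pi> k) (\<rho> l) (obs \<omega>))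
      = expectation (\<lambda>\<omega>. (\<lambda>z. residual m i j z * residual m k l z) (obs \<omega> \<circ> map_sum \<pi> \<rho>))"
    by (intro Bochner_Integration.integral_cong refl) (simp add: residual_perm[OF obs_space assms(2)])
  also have "\<dots> = expectation (\<lambda>\<omega>. residual m i j (obs \<omega>) * residual m k l (obs \<omega>))"
    by (rule expectation_obs_comp) (auto intro!: sum.inj_map permutes_inj[OF assms(2)] assms(3) borel_measurable_times residual_measurable assms(1))
  finally show ?thesis .
qed

lemma expectation_residual_product:
  assumes m: "2 \<le> m" and ik: "i \<in> {1..m}" "k \<in> {1..m}"
  shows "expectation (\<lambda>\<omega>. residual m i j (obs \<omega>) * residual m k l (obs \<omega>))
    = cov m (if i = k then 1 else 2) (if j = l then 1 else 2)"
proof -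
  obtain \<pi> where \<pi>: "\<pi> permutes {1..m}" "\<pi> 1 = i" "\<pi> (if i = k then 1 else 2) = k"
  proof (cases "i = k")
    case True
    then show ?thesis using permutes_one_point[of 1 "{1..m}" i] m ik that by auto
  next
    case False
    then show ?thesis using permutes_two_points[of 1 "{1..m}" 2 i k] m ik that by auto
  qed
  obtain \<rho> :: "nat \<Rightarrow> nat" where \<rho>: "\<rho> permutes UNIV" "\<rho> 1 = j" "\<rho> (if j = l then 1 else 2) = l"
  proof (cases "j = l")
    case True
    then show ?thesis using permutes_one_point[of 1 UNIV j] that by auto
  next
    case False
    then show ?thesis using permutes_two_points[of 1 UNIV 2 j l] that by auto
  qed
  show ?thesis
    using expectation_residual_perm[OF m \<pi>(1) permutes_inj[OF \<rho>(1)], of 1 1 "if i = k then 1 else 2" "if j = l then 1 else 2"] \<pi> \<rho>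
    by (simp add: cov_def)
qed

text \<open>Of the \<open>m\<^sup>2 * n\<^sup>2\<close> products, \<open>m * n\<close> share both
  indices, at most \<open>m\<^sup>2 * n\<close> only the Y index and at most
  \<open>m * n\<^sup>2\<close> only the X index. The 4 is the square of the bound in
  \<open>residual_bound\<close>.\<close>

lemma second_moment_residual_sum:
  assumes m: "2 \<le> m" and n: "1 \<le> n"
  shows "expectation (\<lambda>\<omega>. (1 / (real m * real n) * (\<Sum>i=1..m. \<Sum>j=1..n. residual m i j (obs \<omega>)))\<^sup>2)
    \<le> 4 / (real m * real n) + \<bar>cov m 2 1\<bar> / real n + \<bar>cov m 1 2\<bar> / real m + \<bar>cov m 2 2\<bar>"
proof -
  let ?I = "{1..m} \<times> {1..n}"
  have [measurable]: "residual m i j \<in> borel_measurable N" for i j using m by (intro residual_measurable)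
  have int: "integrable M (\<lambda>\<omega>. residual m i j (obs \<omega>) * residual m k l (obs \<omega>))" for i j k l
    using mult_mono[OF residual_bound residual_bound] by (intro integrable_obs[of _ "2 * 2"]) (auto simp: abs_mult)
  have c: "\<bar>cov m k l\<bar> \<le> 4" for k l
  proof -
    have "\<bar>cov m k l\<bar> \<le> expectation (\<lambda>\<omega>. \<bar>residual m 1 1 (obs \<omega>) * residual m k l (obs \<omega>)\<bar>)"
      unfolding cov_def by (rule integral_abs_bound)
    also have "\<dots> \<le> 4"
      using mult_mono[OF residual_bound[of m 1 1] residual_bound[of m k l]]
      by (intro integral_le_const integrable_abs int) (simp add: abs_mult)
    finally show ?thesis .
  qed
  have "expectation (\<lambda>\<omega>. (\<Sum>i=1..m. \<Sum>j=1..n. residual m i j (obs \<omega>))\<^sup>2)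
      = expectation (\<lambda>\<omega>. \<Sum>p\<in>?I. \<Sum>q\<in>?I. residual m (fst p) (snd p) (obs \<omega>) * residual m (fst q) (snd q) (obs \<omega>))"
    by (simp add: sum.cartesian_product power2_eq_square sum_product case_prod_beta)
  also have "\<dots> = (\<Sum>p\<in>?I. \<Sum>q\<in>?I. expectation (\<lambda>\<omega>. residual m (fst p) (snd p) (obs \<omega>) * residual m (fst q) (snd q) (obs \<omega>)))"
    using int by simp
  also have "\<dots> = (\<Sum>p\<in>?I. \<Sum>q\<in>?I. cov m (if fst p = fst q then 1 else 2) (if snd p = snd q then 1 else 2))"
    by (intro sum.cong refl expectation_residual_product m) auto
  \<comment> \<open>Indicators and dummy factors 1 are arranged as products of a function of the
    first and one of the second index, so that each sum over pairs splits.\<close>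
  also have "\<dots> \<le> (\<Sum>p\<in>?I. \<Sum>q\<in>?I. 4 * (of_bool (fst q = fst p) * of_bool (snd q = snd p))
      + \<bar>cov m 2 1\<bar> * (1 * of_bool (snd q = snd p)) + \<bar>cov m 1 2\<bar> * (of_bool (fst q = fst p) * 1) + \<bar>cov m 2 2\<bar> * (1 * 1))"
    by (intro sum_mono) (use c[of 1 1] in \<open>auto simp: abs_le_iff\<close>)
  also have "\<dots> = (\<Sum>p\<in>?I. 4 + \<bar>cov m 2 1\<bar> * m + \<bar>cov m 1 2\<bar> * n + \<bar>cov m 2 2\<bar> * (m * n))"
  proof (intro sum.cong refl)
    fix p assume p: "p \<in> ?I"
    have split: "(\<Sum>q\<in>?I. f (fst q) * g (snd q)) = (\<Sum>i=1..m. f i) * (\<Sum>j=1..n. g j)" for f g :: "nat \<Rightarrow> real"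
      by (simp add: sum_product sum.cartesian_product case_prod_beta)
    have "fst p \<in> {1..m}" "snd p \<in> {1..n}" using p by auto
    then have b: "(\<Sum>i=1..m. of_bool (i = fst p)) = (1::real)" "(\<Sum>j=1..n. of_bool (j = snd p)) = (1::real)"
      by (auto simp: of_bool_def)
    have s1: "(\<Sum>q\<in>?I. of_bool (fst q = fst p) * of_bool (snd q = snd p)) = (1 :: real)"
      using split[of "\<lambda>i. of_bool (i = fst p)" "\<lambda>j. of_bool (j = snd p)"] unfolding b by simp
    have s2: "(\<Sum>q\<in>?I. 1 * of_bool (snd q = snd p)) = real m"
      using split[of "\<lambda>i. 1" "\<lambda>j. of_bool (j = snd p)"] unfolding b by simp
    have s3: "(\<Sum>q\<in>?I. of_bool (fst q = fst p) * 1) = real n"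
      using split[of "\<lambda>i. of_bool (i = fst p)" "\<lambda>j. 1"] unfolding b by simp
    have s4: "(\<Sum>q\<in>?I. 1 * 1) = real (m * n)" by simp
    show "(\<Sum>q\<in>?I. 4 * (of_bool (fst q = fst p) * of_bool (snd q = snd p))
      + \<bar>cov m 2 1\<bar> * (1 * of_bool (snd q = snd p)) + \<bar>cov m 1 2\<bar> * (of_bool (fst q = fst p) * 1) + \<bar>cov m 2 2\<bar> * (1 * 1))
      = 4 + \<bar>cov m 2 1\<bar> * m + \<bar>cov m 1 2\<bar> * n + \<bar>cov m 2 2\<bar> * (m * n)"
      unfolding sum.distrib sum_distrib_left[of "4 :: real", symmetric] sum_distrib_left[of "\<bar>cov m k l\<bar>" for k l, symmetric]
        s1 s2 s3 s4 by simp
  qed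
  also have "\<dots> = m * n * (4 + \<bar>cov m 2 1\<bar> * m + \<bar>cov m 1 2\<bar> * n + \<bar>cov m 2 2\<bar> * (m * n))"
    by simp
  finally have le: "expectation (\<lambda>\<omega>. (\<Sum>i=1..m. \<Sum>j=1..n. residual m i j (obs \<omega>))\<^sup>2)
    \<le> m * n * (4 + \<bar>cov m 2 1\<bar> * m + \<bar>cov m 1 2\<bar> * n + \<bar>cov m 2 2\<bar> * (m * n))" .
  have "expectation (\<lambda>\<omega>. (1 / (real m * real n) * (\<Sum>i=1..m. \<Sum>j=1..n. residual m i j (obs \<omega>)))\<^sup>2)
    = (1 / (real m * real n))\<^sup>2 * expectation (\<lambda>\<omega>. (\<Sum>i=1..m. \<Sum>j=1..n. residual m i j (obs \<omega>))\<^sup>2)"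
    by (simp only: power_mult_distrib integral_mult_right_zero)
  also have "\<dots> \<le> (1 / (real m * real n))\<^sup>2 * (m * n * (4 + \<bar>cov m 2 1\<bar> * m + \<bar>cov m 1 2\<bar> * n + \<bar>cov m 2 2\<bar> * (m * n)))"
    by (intro mult_left_mono le) auto
  also have "\<dots> = 4 / (real m * real n) + \<bar>cov m 2 1\<bar> / real n + \<bar>cov m 1 2\<bar> / real m + \<bar>cov m 2 2\<bar>"
    using m n by (simp add: field_simps power2_eq_square)
  finally show ?thesis .
qed

section \<open>Mid-rank moments and near ties of population depths\<close>

lemma expectation_P_eq:
  assumes [measurable]: "f \<in> borel_measurable \<Omega>"
  shows "(\<integral>x. f x \<partial>P) = expectation (\<lambda>\<omega>. f (obs \<omega> p) :: real)"
  by (subst distr_observation[of p, symmetric], subst integral_distr) auto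

text \<open>Exchanging one X with one Y turns \<open>kernel_lim\<close> into its complement, so its
  mean is 1/2 whatever ties the depth has; integrating out X leaves \<open>mid_rank\<close>.\<close>

lemma integral_mid_rank: "(\<integral>x. mid_rank x \<partial>P) = 1 / 2"
proof -
  let ?s = "Transposition.transpose (Inl 1) (Inr 1) :: nat + nat \<Rightarrow> nat + nat"
  have "expectation (\<lambda>\<omega>. kernel_lim 1 1 (obs \<omega>)) = expectation (\<lambda>\<omega>. kernel_lim 1 1 (obs \<omega> \<circ> ?s))"
    by (rule expectation_obs_comp[symmetric]) auto
  also have "\<dots> = expectation (\<lambda>\<omega>. 1 - kernel_lim 1 1 (obs \<omega>))"
    by (intro Bochner_Integration.integral_cong refl) (simp add: kernel_lim_def precedes_swap[of "D (Y _ _) P"])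
  also have "\<dots> = 1 - expectation (\<lambda>\<omega>. kernel_lim 1 1 (obs \<omega>))"
    using integrable_obs[of "kernel_lim 1 1" 1] precedes_bounds by (simp add: kernel_lim_def prob_space)
  finally have "expectation (\<lambda>\<omega>. kernel_lim 1 1 (obs \<omega>)) = 1 / 2" by simp
  moreover have "expectation (\<lambda>\<omega>. kernel_lim 1 1 (obs \<omega>)) = expectation (\<lambda>\<omega>. mid_rank (obs \<omega> (Inr 1)))"
    unfolding kernel_lim_def mid_rank_def
    by (rule expectation_integrate_out[where g="\<lambda>x z. precedes (D x P) (D (z (Inr 1)) P)" and B=1])
      (use precedes_bounds in auto)
  ultimately show ?thesis by (simp add: expectation_P_eq[of _ "Inr 1"])
qed

text \<open>What remains of \<open>kernel_lim\<close> after its Hoeffding projection integrates to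
  zero in each variable separately. The product of two such terms with one common index vanishes
  once an index that is not shared is integrated out.\<close>

lemma kernel_lim_uncorrelated:
  "expectation (\<lambda>\<omega>. (kernel_lim 1 1 (obs \<omega>) - proj 1 1 (obs \<omega>)) * (kernel_lim 2 1 (obs \<omega>) - proj 2 1 (obs \<omega>))) = 0" (is ?A)
  "expectation (\<lambda>\<omega>. (kernel_lim 1 1 (obs \<omega>) - proj 1 1 (obs \<omega>)) * (kernel_lim 1 2 (obs \<omega>) - proj 1 2 (obs \<omega>))) = 0" (is ?B)
proof -
  interpret P: prob_space P by (rule prob_space_P)
  define h where "h x y = precedes (D x P) (D y P) - (1 / 2 + mid_rank y - mid_rank x)" for x y
  have h: "\<bar>h x y\<bar> \<le> 2" for x y
    using precedes_bounds[of "D x P" "D y P"] mid_rank_bounds[of x] mid_rank_bounds[of y]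
    unfolding h_def abs_le_iff by linarith
  have [measurable]: "case_prod h \<in> borel_measurable (\<Omega> \<Otimes>\<^sub>M \<Omega>)" unfolding h_def by measurable
  have eq: "kernel_lim i j z - proj i j z = h (z (Inl i)) (z (Inr j))" for i j z
    by (simp add: kernel_lim_def proj_def h_def)
  have ip: "integrable P mid_rank" using mid_rank_bounds by (intro integrable_P[of _ 1]) auto
  have ik: "integrable P (\<lambda>x. precedes (D x P) (D y P))" "integrable P (\<lambda>x. precedes (D y P) (D x P))" for y
    using precedes_bounds by (auto intro!: integrable_P[of _ 1])
  have "(\<integral>x. h x y \<partial>P) = (\<integral>x. precedes (D x P) (D y P) \<partial>P) - (1 / 2 + mid_rank y - (\<integral>x. mid_rank x \<partial>P))" for y
    unfolding h_def using ik ip by (simp add: P.prob_space)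
  then have h1: "(\<integral>x. h x y \<partial>P) = 0" for y by (simp add: integral_mid_rank flip: mid_rank_def)
  have "(\<integral>y. h x y \<partial>P) = (\<integral>y. precedes (D x P) (D y P) \<partial>P) - (1 / 2 + (\<integral>y. mid_rank y \<partial>P) - mid_rank x)" for x
    unfolding h_def using ik ip by (simp add: P.prob_space)
  then have h2: "(\<integral>y. h x y \<partial>P) = 0" if "x \<in> space \<Omega>" for x
    using that by (simp add: integral_mid_rank mid_rank_upper)
  have hh: "\<bar>h x y * h x' y'\<bar> \<le> 2 * 2" for x y x' y'
    using mult_mono[OF h h] by (simp add: abs_mult)
  have "expectation (\<lambda>\<omega>. h (obs \<omega> (Inl 1)) (obs \<omega> (Inr 1)) * h (obs \<omega> (Inl 2)) (obs \<omega> (Inr 1)))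
      = expectation (\<lambda>\<omega>. \<integral>x. h x (obs \<omega> (Inr 1)) * h (obs \<omega> (Inl 2)) (obs \<omega> (Inr 1)) \<partial>P)"
    by (rule expectation_integrate_out[where g="\<lambda>x z. h x (z (Inr 1)) * h (z (Inl 2)) (z (Inr 1))" and B="2*2"])
      (use hh in \<open>auto\<close>)
  then show ?A by (simp add: eq h1)
  have "expectation (\<lambda>\<omega>. h (obs \<omega> (Inl 1)) (obs \<omega> (Inr 1)) * h (obs \<omega> (Inl 1)) (obs \<omega> (Inr 2)))
      = expectation (\<lambda>\<omega>. \<integral>y. h (obs \<omega> (Inl 1)) y * h (obs \<omega> (Inl 1)) (obs \<omega> (Inr 2)) \<partial>P)"
    by (rule expectation_integrate_out[where g="\<lambda>y z. h (z (Inl 1)) y * h (z (Inl 1)) (z (Inr 2))" and B="2*2"])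
      (use hh in \<open>auto\<close>)
  also have "\<dots> = expectation (\<lambda>\<omega>. 0)"
    by (intro Bochner_Integration.integral_cong refl) (use h2 measurable_space[OF X_measurable] in auto)
  finally show ?B by (simp add: eq)
qed


text \<open>Given the depth of observation \<open>q\<close>, that of \<open>p\<close> must fall into
  an interval of length \<open>2 * \<delta>\<close>. \<open>C\<close> is the constant of
  \<open>Asm1\<close>, uniform in \<open>\<delta>\<close>, \<open>p\<close> and
  \<open>q\<close>.\<close>

lemma expectation_near_ties:
  assumes "Asm1 M D P X \<beta>" "0 \<le> \<beta>"
  shows "\<exists>C>0. \<forall>\<delta>\<ge>0. \<forall>p q. p \<noteq> q \<longrightarrow> expectation (\<lambda>\<omega>. of_bool (\<bar>D (obs \<omega> p) P - D (obs \<omega> q) P\<bar> \<le> \<delta>)) \<le> C * (2 * \<delta>) powr \<beta>"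
proof -
  obtain C where C: "C > 0" "\<And>a b. a \<ge> 0 \<Longrightarrow> b \<ge> 0 \<Longrightarrow> \<P>(\<omega> in M. D (X 0 \<omega>) P \<in> {a..b}) \<le> C * \<bar>b - a\<bar> powr \<beta>"
    using assms(1) unfolding Asm1_def by blast
  have one: "(\<integral>x. of_bool (\<bar>D x P - t\<bar> \<le> \<delta>) \<partial>P) \<le> C * (2 * \<delta>) powr \<beta>" if "t \<ge> 0" "\<delta> \<ge> 0" for t \<delta> :: real
  proof -
    have "(\<integral>x. of_bool (\<bar>D x P - t\<bar> \<le> \<delta>) \<partial>P) = expectation (\<lambda>\<omega>. of_bool (\<bar>D (X 0 \<omega>) P - t\<bar> \<le> \<delta>) :: real)"
      by (subst expectation_P_eq[of _ "Inl 0"]) auto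
    \<comment> \<open>\<open>Asm1\<close> speaks of nonnegative endpoints; as depths are
      nonnegative, the interval may be cut off at 0.\<close>
    also have "\<dots> = expectation (indicator {\<omega> \<in> space M. D (X 0 \<omega>) P \<in> {max 0 (t - \<delta>)..t + \<delta>}})"
      by (intro Bochner_Integration.integral_cong refl)
        (use D_nonneg[OF measurable_space[OF X_measurable] P_distribution] in \<open>auto simp: indicator_def\<close>)
    also have "\<dots> = \<P>(\<omega> in M. D (X 0 \<omega>) P \<in> {max 0 (t - \<delta>)..t + \<delta>})"
      by (simp add: Int_absorb2 Collect_restrict)
    also have "\<dots> \<le> C * \<bar>(t + \<delta>) - max 0 (t - \<delta>)\<bar> powr \<beta>" using that by (intro C(2)) auto
    also have "\<dots> \<le> C * (2 * \<delta>) powr \<beta>"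
      using that C(1) assms(2) by (intro mult_left_mono powr_mono2) auto
    finally show ?thesis .
  qed
  show ?thesis
  proof (intro exI[of _ C] conjI C(1) allI impI)
    fix \<delta> :: real and p q :: "nat + nat" assume \<delta>: "\<delta> \<ge> 0" and pq: "p \<noteq> q"
    have "expectation (\<lambda>\<omega>. of_bool (\<bar>D (obs \<omega> p) P - D (obs \<omega> q) P\<bar> \<le> \<delta>) :: real)
        = expectation (\<lambda>\<omega>. \<integral>x. of_bool (\<bar>D x P - D (obs \<omega> q) P\<bar> \<le> \<delta>) \<partial>P)"
      by (rule expectation_integrate_out[where g="\<lambda>x z. of_bool (\<bar>D x P - D (z q) P\<bar> \<le> \<delta>)" and B=1])
        (use pq in auto)
    also have "\<dots> \<le> C * (2 * \<delta>) powr \<beta>"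
    proof (cases "integrable M (\<lambda>\<omega>. \<integral>x. of_bool (\<bar>D x P - D (obs \<omega> q) P\<bar> \<le> \<delta>) \<partial>P :: real)")
      case True
      show ?thesis
        by (rule integral_le_const[OF True], rule AE_I2, rule one)
          (use \<delta> D_nonneg[OF measurable_space[OF observation_measurable] P_distribution] in auto)
    next
      \<comment> \<open>Without integrability the Bochner integral is 0 and the bound is
        trivial.\<close>
      case False
      then show ?thesis using C(1) by (simp add: not_integrable_integral_eq)
    qed
    finally show "expectation (\<lambda>\<omega>. of_bool (\<bar>D (obs \<omega> p) P - D (obs \<omega> q) P\<bar> \<le> \<delta>)) \<le> C * (2 * \<delta>) powr \<beta>" .
  qed
qed

text \<open>For \<open>\<delta> = 0\<close> the preceding bound is 0.\<close>

lemma AE_no_ties: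
  assumes "Asm1 M D P X \<beta>" "0 < \<beta>" "p \<noteq> q"
  shows "AE \<omega> in M. D (obs \<omega> p) P \<noteq> D (obs \<omega> q) P"
proof -
  obtain C where C: "C > 0" "\<forall>\<delta>\<ge>0. \<forall>p q. p \<noteq> q \<longrightarrow>
      expectation (\<lambda>\<omega>. of_bool (\<bar>D (obs \<omega> p) P - D (obs \<omega> q) P\<bar> \<le> \<delta>)) \<le> C * (2 * \<delta>) powr \<beta>"
    using expectation_near_ties[OF assms(1) less_imp_le[OF assms(2)]] by blast
  from C(2)[rule_format, of 0 p q] have "expectation (\<lambda>\<omega>. of_bool (\<bar>D (obs \<omega> p) P - D (obs \<omega> q) P\<bar> \<le> 0)) \<le> (0 :: real)"
    using assms by simp
  then have "expectation (\<lambda>\<omega>. of_bool (\<bar>D (obs \<omega> p) P - D (obs \<omega> q) P\<bar> \<le> 0)) = (0 :: real)"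
    by (intro antisym) auto
  moreover have "integrable M (\<lambda>\<omega>. of_bool (\<bar>D (obs \<omega> p) P - D (obs \<omega> q) P\<bar> \<le> 0) :: real)"
    by (rule integrable_const_bound[of _ 1]) simp_all
  ultimately have "AE \<omega> in M. of_bool (\<bar>D (obs \<omega> p) P - D (obs \<omega> q) P\<bar> \<le> 0) = (0 :: real)"
    by (subst (asm) integral_nonneg_eq_0_iff_AE) simp_all
  then show ?thesis by eventually_elim auto
qed

text \<open>\<open>(mid_rank x)\<^sup>2\<close> is the mean of the product of two comparisons of
  \<open>x\<close> with independent observations. Permuting the three observations gives three
  products of equal mean whose sum is almost surely 1.\<close>

lemma expectation_mid_rank_square:
  assumes "Asm1 M D P X \<beta>" "0 < \<beta>"
  shows "expectation (\<lambda>\<omega>. (mid_rank (obs \<omega> p))\<^sup>2) = 1 / 3"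
proof -
  define c where "c a b z = precedes (D (z (Inl a)) P) (D (z (Inl b)) P)" for a b and z :: "nat + nat \<Rightarrow> 'b"
  have [measurable]: "c a b \<in> borel_measurable N" for a b unfolding c_def[abs_def] by measurable
  have c01: "0 \<le> c a b z" "c a b z \<le> 1" for a b z using precedes_bounds by (auto simp: c_def)
  have cc: "\<bar>c a b z * c a' b' z'\<bar> \<le> 1" for a b z a' b' z'
    using c01[of a b z] c01[of a' b' z'] by (auto simp: abs_mult mult_le_one)
  have int: "integrable M (\<lambda>\<omega>. c a b (obs \<omega>) * c a' b' (obs \<omega>))" for a b a' b'
    by (rule integrable_obs[of "\<lambda>z. c a b z * c a' b' z" 1]) (use cc in auto)
  have "expectation (\<lambda>\<omega>. c 1 0 (obs \<omega>) * c 2 0 (obs \<omega>))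
      = expectation (\<lambda>\<omega>. \<integral>x. precedes (D x P) (D (obs \<omega> (Inl 0)) P) * c 2 0 (obs \<omega>) \<partial>P)"
    unfolding c_def
    by (rule expectation_integrate_out[where B=1 and g="\<lambda>x z. precedes (D x P) (D (z (Inl 0)) P) *
        precedes (D (z (Inl 2)) P) (D (z (Inl 0)) P)"])
      (use precedes_bounds in \<open>auto simp: abs_mult mult_le_one\<close>)
  also have "\<dots> = expectation (\<lambda>\<omega>. mid_rank (obs \<omega> (Inl 0)) * precedes (D (obs \<omega> (Inl 2)) P) (D (obs \<omega> (Inl 0)) P))"
    by (simp add: mid_rank_def c_def)
  also have "\<dots> = expectation (\<lambda>\<omega>. \<integral>x. mid_rank (obs \<omega> (Inl 0)) * precedes (D x P) (D (obs \<omega> (Inl 0)) P) \<partial>P)"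
    by (rule expectation_integrate_out[where B=1 and g="\<lambda>x z. mid_rank (z (Inl 0)) * precedes (D x P) (D (z (Inl 0)) P)"])
      (use precedes_bounds mid_rank_bounds in \<open>auto simp: abs_mult mult_le_one\<close>)
  also have "\<dots> = expectation (\<lambda>\<omega>. (mid_rank (obs \<omega> (Inl 0)))\<^sup>2)"
    by (simp add: mid_rank_def power2_eq_square)
  also have "\<dots> = expectation (\<lambda>\<omega>. (mid_rank (obs \<omega> p))\<^sup>2)"
    using expectation_P_eq[of "\<lambda>x. (mid_rank x)\<^sup>2" "Inl 0"] expectation_P_eq[of "\<lambda>x. (mid_rank x)\<^sup>2" p] by simp
  finally have e0: "expectation (\<lambda>\<omega>. c 1 0 (obs \<omega>) * c 2 0 (obs \<omega>)) = expectation (\<lambda>\<omega>. (mid_rank (obs \<omega> p))\<^sup>2)" .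
  have perm: "expectation (\<lambda>\<omega>. c (\<pi> 1) (\<pi> 0) (obs \<omega>) * c (\<pi> 2) (\<pi> 0) (obs \<omega>)) = expectation (\<lambda>\<omega>. c 1 0 (obs \<omega>) * c 2 0 (obs \<omega>))"
    if "inj \<pi>" for \<pi> :: "nat \<Rightarrow> nat"
    using expectation_obs_comp[of "map_sum \<pi> id" "\<lambda>z. c 1 0 z * c 2 0 z"] that
    by (simp add: sum.inj_map c_def)
  have e1: "expectation (\<lambda>\<omega>. c 0 1 (obs \<omega>) * c 2 1 (obs \<omega>)) = expectation (\<lambda>\<omega>. c 1 0 (obs \<omega>) * c 2 0 (obs \<omega>))"
    using perm[of "Transposition.transpose 0 1"] by simp
  have e2: "expectation (\<lambda>\<omega>. c 0 2 (obs \<omega>) * c 1 2 (obs \<omega>)) = expectation (\<lambda>\<omega>. c 1 0 (obs \<omega>) * c 2 0 (obs \<omega>))"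
    using perm[of "Transposition.transpose 0 2"] by (simp add: mult.commute)
  have "AE \<omega> in M. c 1 0 (obs \<omega>) * c 2 0 (obs \<omega>) + c 0 1 (obs \<omega>) * c 2 1 (obs \<omega>) + c 0 2 (obs \<omega>) * c 1 2 (obs \<omega>) = 1"
  proof -
    have "AE \<omega> in M. D (X 0 \<omega>) P \<noteq> D (X 1 \<omega>) P" "AE \<omega> in M. D (X 1 \<omega>) P \<noteq> D (X 2 \<omega>) P"
      "AE \<omega> in M. D (X 0 \<omega>) P \<noteq> D (X 2 \<omega>) P"
      using AE_no_ties[OF assms, of "Inl 0" "Inl 1"] AE_no_ties[OF assms, of "Inl 1" "Inl 2"]
        AE_no_ties[OF assms, of "Inl 0" "Inl 2"] by simp_all
    then show ?thesis
      by eventually_elim (simp add: c_def precedes_cyclic)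
  qed
  then have "expectation (\<lambda>\<omega>. c 1 0 (obs \<omega>) * c 2 0 (obs \<omega>) + c 0 1 (obs \<omega>) * c 2 1 (obs \<omega>) + c 0 2 (obs \<omega>) * c 1 2 (obs \<omega>)) = expectation (\<lambda>\<omega>. 1)"
    by (intro integral_cong_AE) auto
  then show ?thesis using int e0 e1 e2 by (simp add: prob_space)
qed

subsection \<open>Near ties of empirical depths\<close>

text \<open>The conditional probability of \<open>Asm4\<close> as an explicit double integral: with
  the sample \<open>I\<close> held fixed, two fresh observations have depths within
  \<open>c\<close>.\<close>

definition collision :: "nat set \<Rightarrow> real \<Rightarrow> (nat + nat \<Rightarrow> 'b) \<Rightarrow> real" where
  "collision I c z = (\<integral>y. \<integral>x. of_bool (\<bar>D x (emp I z) - D y (emp I z)\<bar> \<le> c) \<partial>P \<partial>P)"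

definition close :: "nat set \<Rightarrow> real \<Rightarrow> nat + nat \<Rightarrow> nat + nat \<Rightarrow> (nat + nat \<Rightarrow> 'b) \<Rightarrow> real" where
  "close I c p q z = of_bool (\<bar>emp_depth I p z - emp_depth I q z\<bar> \<le> c)"

lemma close_measurable: "finite I \<Longrightarrow> I \<noteq> {} \<Longrightarrow> close I c p q \<in> borel_measurable N"
  unfolding close_def[abs_def] by measurable

lemma collision_cong: "emp I z = emp I z' \<Longrightarrow> collision I c z = collision I c z'"
  by (simp add: collision_def)

lemma collision_inner_measurable:
  assumes "finite I" "I \<noteq> {}"
  shows "(\<lambda>(y, z). \<integral>x. of_bool (\<bar>D x (emp I z) - D y (emp I z)\<bar> \<le> c) \<partial>P :: real) \<in> borel_measurable (\<Omega> \<Otimes>\<^sub>M N) "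
proof -
  interpret P: prob_space P by (rule prob_space_P)
  have [measurable]: "(\<lambda>w. D (snd w) (emp I (snd (fst w)))) \<in> borel_measurable ((\<Omega> \<Otimes>\<^sub>M N) \<Otimes>\<^sub>M P)"
    using measurable_compose[OF _ depth_emp_measurable[OF assms], of "\<lambda>w. (snd w, snd (fst w))" "(\<Omega> \<Otimes>\<^sub>M N) \<Otimes>\<^sub>M P"]
    by simp
  have [measurable]: "(\<lambda>w. D (fst (fst w)) (emp I (snd (fst w)))) \<in> borel_measurable ((\<Omega> \<Otimes>\<^sub>M N) \<Otimes>\<^sub>M P)"
    using measurable_compose[OF _ depth_emp_measurable[OF assms], of "fst" "(\<Omega> \<Otimes>\<^sub>M N) \<Otimes>\<^sub>M P"]
    by (simp add: case_prod_beta)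
  have "(\<lambda>(w, x). of_bool (\<bar>D x (emp I (snd w)) - D (fst w) (emp I (snd w))\<bar> \<le> c) :: real)
      \<in> borel_measurable ((\<Omega> \<Otimes>\<^sub>M N) \<Otimes>\<^sub>M P)"
    unfolding case_prod_beta by measurable
  then show ?thesis
    using P.borel_measurable_lebesgue_integral[of "\<lambda>w x. of_bool (\<bar>D x (emp I (snd w)) - D (fst w) (emp I (snd w))\<bar> \<le> c)" "\<Omega> \<Otimes>\<^sub>M N"]
    by (simp add: case_prod_beta)
qed

lemma collision_measurable:
  assumes "finite I" "I \<noteq> {}"
  shows "collision I c \<in> borel_measurable N"
proof -
  interpret P: prob_space P by (rule prob_space_P)
  have "(\<lambda>(z, y). \<integral>x. of_bool (\<bar>D x (emp I z) - D y (emp I z)\<bar> \<le> c) \<partial>P :: real) \<in> borel_measurable (N \<Otimes>\<^sub>M P)"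
    using measurable_compose[OF _ collision_inner_measurable[OF assms], of "\<lambda>w. (snd w, fst w)" "N \<Otimes>\<^sub>M P"]
    by (simp add: case_prod_beta)
  then show ?thesis unfolding collision_def[abs_def] by (rule P.borel_measurable_lebesgue_integral)
qed

lemma integral_P_bounds:
  fixes f :: "'b \<Rightarrow> real"
  assumes "\<And>x. 0 \<le> f x" "\<And>x. f x \<le> 1"
  shows "0 \<le> integral\<^sup>L P f" "integral\<^sup>L P f \<le> 1"
proof -
  interpret P: prob_space P by (rule prob_space_P)
  show "0 \<le> integral\<^sup>L P f" using assms by simp
  show "integral\<^sup>L P f \<le> 1"
    using P.integral_le_const[of f 1] assms by (cases "integrable P f") (auto simp: not_integrable_integral_eq)
qed

lemma collision_bounds: "0 \<le> collision I c z" "collision I c z \<le> 1"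
  unfolding collision_def by (intro integral_P_bounds; simp)+

text \<open>Both fresh observations are integrated out under a factor \<open>h\<close> that reads
  neither. In the applications \<open>h\<close> is the indicator of a sample event, the constant 1,
  the near tie of a second pair, or \<open>collision\<close> itself.\<close>

lemma expectation_close:
  assumes I: "finite I" "I \<noteq> {}" and pq: "p \<notin> Inl ` I" "q \<notin> Inl ` I" "p \<noteq> q"
    and h: "h \<in> borel_measurable N" "\<And>z. \<bar>h z\<bar> \<le> 1"
      "\<And>y z. h (z(p := y)) = h z" "\<And>y z. h (z(q := y)) = h z"
  shows "expectation (\<lambda>\<omega>. close I c p q (obs \<omega>) * h (obs \<omega>)) = expectation (\<lambda>\<omega>. collision I c (obs \<omega>) * h (obs \<omega>))"
proof -
  note [measurable] = h(1) depth_emp_measurable[OF I] collision_inner_measurable[OF I, of c]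
  have [measurable]: "(\<lambda>z. D (z q) (emp I z)) \<in> borel_measurable N"
    using emp_depth_measurable[OF I, of q] by (simp add: emp_depth_def[abs_def])
  have "expectation (\<lambda>\<omega>. close I c p q (obs \<omega>) * h (obs \<omega>))
     = expectation (\<lambda>\<omega>. \<integral>x. of_bool (\<bar>D x (emp I (obs \<omega>)) - D (obs \<omega> q) (emp I (obs \<omega>))\<bar> \<le> c) * h (obs \<omega>) \<partial>P)"
    unfolding close_def emp_depth_def
    by (rule expectation_integrate_out[where B=1 and g="\<lambda>x z. of_bool (\<bar>D x (emp I z) - D (z q) (emp I z)\<bar> \<le> c) * h z"])
      (use pq h(2-3) in \<open>auto simp: emp_upd abs_mult case_prod_beta' intro!: mult_le_one\<close>)
  also have "\<dots> = expectation (\<lambda>\<omega>. (\<integral>x. of_bool (\<bar>D x (emp I (obs \<omega>)) - D (obs \<omega> q) (emp I (obs \<omega>))\<bar> \<le> c) \<partial>P) * h (obs \<omega>))"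
    by simp
  also have "\<dots> = expectation (\<lambda>\<omega>. \<integral>y. (\<integral>x. of_bool (\<bar>D x (emp I (obs \<omega>)) - D y (emp I (obs \<omega>))\<bar> \<le> c) \<partial>P) * h (obs \<omega>) \<partial>P)"
  proof (rule expectation_integrate_out[where B=1 and g="\<lambda>y z. (\<integral>x. of_bool (\<bar>D x (emp I z) - D y (emp I z)\<bar> \<le> c) \<partial>P) * h z"])
    fix y z
    have "0 \<le> (\<integral>x. of_bool (\<bar>D x (emp I z) - D y (emp I z)\<bar> \<le> c) \<partial>P :: real)"
      "(\<integral>x. of_bool (\<bar>D x (emp I z) - D y (emp I z)\<bar> \<le> c) \<partial>P) \<le> (1::real)"
      by (intro integral_P_bounds; simp)+
    then show "\<bar>(\<integral>x. of_bool (\<bar>D x (emp I z) - D y (emp I z)\<bar> \<le> c) \<partial>P) * h z\<bar> \<le> 1"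
      using h(2)[of z] by (simp only: abs_mult) (intro mult_le_one; simp)
  qed (use pq h(4) in \<open>auto simp: emp_upd case_prod_beta'\<close>)
  also have "\<dots> = expectation (\<lambda>\<omega>. collision I c (obs \<omega>) * h (obs \<omega>))"
    by (simp add: collision_def)
  finally show ?thesis .
qed


text \<open>Filling the coordinates outside \<open>I\<close> with a fixed point shows that
  \<open>emp I\<close> factors through the restricted sample; this makes \<open>collision\<close>
  measurable for the generated sigma-algebra.\<close>

lemma collision_restrict:
  obtains f where "f \<in> measurable (\<Pi>\<^sub>M i\<in>I. \<Omega>) N" "\<And>z. emp I (f (\<lambda>i\<in>I. z (Inl i))) = emp I z"
proof -
  obtain x where x: "x \<in> space \<Omega>"
    using not_empty measurable_space[OF X_measurable] by blast
  define f where "f w p = (case p of Inl i \<Rightarrow> if i \<in> I then w i else x | Inr _ \<Rightarrow> x)" for w and p :: "nat + nat"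
  have "f \<in> measurable (\<Pi>\<^sub>M i\<in>I. \<Omega>) N"
  proof (rule measurable_N_I)
    fix p show "(\<lambda>w. f w p) \<in> measurable (\<Pi>\<^sub>M i\<in>I. \<Omega>) \<Omega>"
      using x by (cases p; cases "projl p \<in> I") (auto simp: f_def)
  qed
  moreover have "emp I (f (\<lambda>i\<in>I. z (Inl i))) = emp I z" for z
    by (rule emp_cong) (simp add: f_def)
  ultimately show ?thesis by (rule that)
qed

lemma restrict_obs_measurable: "(\<lambda>\<omega>. \<lambda>i\<in>I. X i \<omega>) \<in> measurable M (\<Pi>\<^sub>M i\<in>I. \<Omega>)"
  by (intro measurable_restrict) simp

lemma sets_generated_by:
  "sets (generated_by M \<Omega> X I) = {(\<lambda>\<omega>. \<lambda>i\<in>I. X i \<omega>) -` B \<inter> space M | B. B \<in> sets (\<Pi>\<^sub>M i\<in>I. \<Omega>)}"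
  unfolding generated_by_def
  by (rule sets_vimage_algebra2[OF funcsetI[OF measurable_space[OF restrict_obs_measurable]]])

lemma subalgebra_generated_by: "subalgebra M (generated_by M \<Omega> X I)"
  unfolding subalgebra_def sets_generated_by
  using measurable_sets[OF restrict_obs_measurable] by (auto simp: generated_by_def)

text \<open>Measurability comes from \<open>collision_restrict\<close>. Integrals over a set of the
  generated sigma-algebra agree by \<open>expectation_close\<close>, with the indicator of that set
  written as a function of the sample.\<close>

lemma real_cond_exp_close:
  assumes I: "finite I" "I \<noteq> {}" "1 \<notin> I" "0 \<notin> I"
  shows "AE \<omega> in M. real_cond_exp M (generated_by M \<Omega> X I) (\<lambda>\<omega>. close I c (Inl 1) (Inl 0) (obs \<omega>)) \<omega>
    = collision I c (obs \<omega>)"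
proof -
  let ?F = "generated_by M \<Omega> X I"
  interpret F: finite_measure_subalgebra M ?F
    by unfold_locales (rule subalgebra_generated_by)
  note [measurable] = collision_measurable[OF I(1,2)] close_measurable[OF I(1,2)]
  show ?thesis
  proof (rule F.real_cond_exp_charact)
    show "integrable M (\<lambda>\<omega>. close I c (Inl 1) (Inl 0) (obs \<omega>))"
      by (rule integrable_obs[of _ 1]) (auto simp: close_def[abs_def] intro: close_measurable[OF I(1,2), unfolded close_def[abs_def]])
    show "integrable M (\<lambda>\<omega>. collision I c (obs \<omega>))"
      using collision_bounds by (intro integrable_obs[of _ 1]) auto
    obtain f where f: "f \<in> measurable (\<Pi>\<^sub>M i\<in>I. \<Omega>) N" "\<And>z. emp I (f (\<lambda>i\<in>I. z (Inl i))) = emp I z"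
      by (rule collision_restrict[of I]) blast
    have "(\<lambda>\<omega>. collision I c (f (\<lambda>i\<in>I. X i \<omega>))) \<in> borel_measurable ?F"
      unfolding generated_by_def
      by (intro measurable_compose[OF measurable_vimage_algebra1[OF funcsetI[OF
            measurable_space[OF restrict_obs_measurable]]] measurable_compose[OF f(1)]]) auto
    moreover have "collision I c (f (\<lambda>i\<in>I. X i \<omega>)) = collision I c (obs \<omega>)" for \<omega>
      using f(2)[of "obs \<omega>"] by (intro collision_cong) simp
    ultimately show "(\<lambda>\<omega>. collision I c (obs \<omega>)) \<in> borel_measurable ?F" by simp
    fix A assume "A \<in> sets ?F"
    then obtain B where B: "B \<in> sets (\<Pi>\<^sub>M i\<in>I. \<Omega>)" "A = (\<lambda>\<omega>. \<lambda>i\<in>I. X i \<omega>) -` B \<inter> space M"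
      unfolding sets_generated_by by blast
    define h where "h z = (indicator B (\<lambda>i\<in>I. z (Inl i)) :: real)" for z :: "nat + nat \<Rightarrow> 'b"
    have "(\<lambda>z. \<lambda>i\<in>I. z (Inl i)) \<in> measurable N (\<Pi>\<^sub>M i\<in>I. \<Omega>)"
      by (intro measurable_restrict) simp
    then have hm[measurable]: "h \<in> borel_measurable N"
      unfolding h_def[abs_def] using B(1) by measurable
    have upd: "h (z(p := y)) = h z" if "p \<notin> Inl ` I" for p y z
      unfolding h_def using that by (intro arg_cong[where f="indicator B"]) (auto simp: restrict_def fun_eq_iff)
    have hA: "h (obs \<omega>) = indicator A \<omega>" if "\<omega> \<in> space M" for \<omega>
      using that by (simp add: h_def B(2) indicator_def)
    have "expectation (\<lambda>\<omega>. close I c (Inl 1) (Inl 0) (obs \<omega>) * h (obs \<omega>)) = expectation (\<lambda>\<omega>. collision I c (obs \<omega>) * h (obs \<omega>))"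
      using I by (intro expectation_close upd hm) (auto simp: h_def indicator_def)
    moreover have "(\<integral>\<omega>\<in>A. g \<omega> \<partial>M) = expectation (\<lambda>\<omega>. g \<omega> * h (obs \<omega>))" for g :: "'a \<Rightarrow> real"
      unfolding set_lebesgue_integral_def
      by (intro Bochner_Integration.integral_cong refl) (simp add: hA)
    ultimately show "(\<integral>\<omega>\<in>A. close I c (Inl 1) (Inl 0) (obs \<omega>) \<partial>M) = (\<integral>\<omega>\<in>A. collision I c (obs \<omega>) \<partial>M)"
      by simp
  qed
qed

text \<open>\<open>m * m powr (- 2 * \<beta>)\<close> tends to 0 exactly when \<beta> > 1/2; here
  the lower bound on the exponent is decisive.\<close>

lemma Asm4_collision:
  assumes "Asm4 M \<Omega> D X \<beta>" "1 / 2 < \<beta>" "C > 0"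
  shows "(\<lambda>m. real m * expectation (\<lambda>\<omega>. (collision {2..m} (C / m) (obs \<omega>))\<^sup>2)) \<longlonglongrightarrow> 0"
proof -
  let ?e = "\<lambda>m. expectation (\<lambda>\<omega>. (collision {2..m} (C / m) (obs \<omega>))\<^sup>2)"
  let ?r = "\<lambda>m. \<integral>\<omega>. (real_cond_exp M (generated_by M \<Omega> X {2..m})
          (indicator {\<omega> \<in> space M.
             let P1 = empirical \<Omega> ({1..m} - {1}) (\<lambda>i. X i \<omega>)
             in \<bar>D (X 1 \<omega>) P1 - D (X 0 \<omega>) P1\<bar> \<le> C / real m}) \<omega>)\<^sup>2 \<partial>M"
  have eq: "?r m = ?e m" if "m \<ge> 2" for m
  proof -
    let ?I = "{2..m}"
    have I: "finite ?I" "?I \<noteq> {}" "1 \<notin> ?I" "0 \<notin> ?I" using that by auto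
    interpret F: finite_measure_subalgebra M "generated_by M \<Omega> X ?I"
      by unfold_locales (rule subalgebra_generated_by)
    note [measurable] = collision_measurable[OF I(1,2)] close_measurable[OF I(1,2)]
    have I': "{1..m} - {1} = ?I" by auto
    define S where "S = {\<omega> \<in> space M. let P1 = empirical \<Omega> ({1..m} - {1}) (\<lambda>i. X i \<omega>)
             in \<bar>D (X 1 \<omega>) P1 - D (X 0 \<omega>) P1\<bar> \<le> C / real m}"
    have S: "S = {\<omega> \<in> space M. close ?I (C / m) (Inl 1) (Inl 0) (obs \<omega>) = 1}"
      unfolding S_def I' by (auto simp: close_def emp_depth_def emp_def Let_def)
    have [measurable]: "S \<in> sets M" unfolding S by measurable
    have "AE \<omega> in M. (indicator S \<omega> :: real) = close ?I (C / m) (Inl 1) (Inl 0) (obs \<omega>)"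
      by (intro AE_I2) (simp add: S close_def indicator_def)
    then have "AE \<omega> in M. real_cond_exp M (generated_by M \<Omega> X ?I) (indicator S) \<omega>
        = real_cond_exp M (generated_by M \<Omega> X ?I) (\<lambda>\<omega>. close ?I (C / m) (Inl 1) (Inl 0) (obs \<omega>)) \<omega>"
      by (rule F.real_cond_exp_cong) measurable
    then have "AE \<omega> in M. (real_cond_exp M (generated_by M \<Omega> X ?I) (indicator S) \<omega>)\<^sup>2 = (collision ?I (C / m) (obs \<omega>))\<^sup>2"
      using real_cond_exp_close[OF I, of "C / m"] by eventually_elim simp
    then have "expectation (\<lambda>\<omega>. (real_cond_exp M (generated_by M \<Omega> X ?I) (indicator S) \<omega>)\<^sup>2) = ?e m"
      by (rule integral_cong_AE[rotated 2]) auto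
    then show ?thesis unfolding S_def .
  qed
  have "?r \<in> O(\<lambda>m. real m powr (- 2 * \<beta>))"
    using assms(1,3) unfolding Asm4_def by blast
  then obtain K where "eventually (\<lambda>m. norm (?r m) \<le> K * norm (real m powr (- 2 * \<beta>))) at_top"
    by (elim landau_o.bigE) blast
  then have ev: "eventually (\<lambda>m. real m * ?e m \<le> K * (real m * real m powr (- 2 * \<beta>))) at_top"
    using eventually_ge_at_top[of 2]
  proof eventually_elim
    case (elim m)
    have "norm (?e m) \<le> K * norm (real m powr (- 2 * \<beta>))"
      using elim(1) unfolding eq[OF elim(2)] .
    then have "?e m \<le> K * real m powr (- 2 * \<beta>)" by simp
    then have "real m * ?e m \<le> real m * (K * real m powr (- 2 * \<beta>))" by (intro mult_left_mono) auto
    then show ?case by (simp add: mult_ac)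
  qed
  have "(\<lambda>m. real m powr (1 - 2 * \<beta>)) \<longlonglongrightarrow> 0"
    using assms(2) by (intro tendsto_neg_powr filterlim_real_sequentially) auto
  then have "(\<lambda>m. real m * real m powr (- 2 * \<beta>)) \<longlonglongrightarrow> 0"
    by (rule Lim_transform_eventually) (use eventually_gt_at_top[of 0] in \<open>auto elim!: eventually_mono simp: powr_diff powr_minus field_simps\<close>)
  from tendsto_mult_right_zero[OF this, of K] show ?thesis
    by (rule tendsto_sandwich[OF _ ev tendsto_const, rotated]) auto
qed

section \<open>Empirical depths of single observations\<close>

lemma Asm3_emp_depth:
  assumes "Asm3 M \<Omega> D X"
  shows "\<exists>C>0. \<exists>m0. \<forall>m\<ge>m0. \<forall>p. AE \<omega> in M. \<bar>emp_depth {1..m} p (obs \<omega>) - emp_depth ({1..m} - {1}) p (obs \<omega>)\<bar> \<le> C / real m"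
proof -
  obtain C m0 where C: "\<And>m. m \<ge> m0 \<Longrightarrow> AE \<omega> in M.
       depth_dist D \<Omega> (empirical \<Omega> {1..m} (\<lambda>i. X i \<omega>)) (empirical \<Omega> ({1..m} - {1}) (\<lambda>i. X i \<omega>))
         \<le> ennreal (C / real m)"
    using assms unfolding Asm3_def by blast
  \<comment> \<open>\<open>Asm4\<close> is available for positive constants, while the constant of
    \<open>Asm3\<close> has no sign; hence \<open>\<bar>C\<bar> + 1\<close>. Any \<open>p\<close> is
    allowed because the supremum runs over the whole space.\<close>
  have "AE \<omega> in M. \<bar>emp_depth {1..m} p (obs \<omega>) - emp_depth ({1..m} - {1}) p (obs \<omega>)\<bar> \<le> (\<bar>C\<bar> + 1) / real m"
    if "m \<ge> m0" for m p
    using C[OF that] AE_space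
  proof eventually_elim
    case (elim \<omega>)
    have "ennreal \<bar>emp_depth {1..m} p (obs \<omega>) - emp_depth ({1..m} - {1}) p (obs \<omega>)\<bar>
      \<le> depth_dist D \<Omega> (empirical \<Omega> {1..m} (\<lambda>i. X i \<omega>)) (empirical \<Omega> ({1..m} - {1}) (\<lambda>i. X i \<omega>))"
      unfolding depth_dist_def emp_depth_def emp_def obs_simps
      by (rule SUP_upper) (use obs_space[OF elim(2)] in \<open>auto simp: space_N_iff\<close>)
    also have "\<dots> \<le> ennreal (C / real m)" by (rule elim)
    also have "\<dots> \<le> ennreal ((\<bar>C\<bar> + 1) / real m)" by (intro ennreal_leI divide_right_mono) auto
    finally show ?case by (subst (asm) ennreal_le_iff) auto
  qed
  then show ?thesis by (intro exI[of _ "\<bar>C\<bar> + 1"] conjI exI[of _ m0]) auto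
qed

text \<open>Markov's inequality for the power \<open>2 * \<beta>\<close> turns the moment bound into
  convergence in probability at each observation.\<close>

lemma Asm2_emp_depth:
  assumes "Asm2 M \<Omega> D P X \<beta>" "0 < \<beta>" "0 < \<epsilon>"
  shows "(\<lambda>m. expectation (\<lambda>\<omega>. of_bool (\<epsilon> < \<bar>emp_depth {1..m} p (obs \<omega>) - D (obs \<omega> p) P\<bar>) :: real)) \<longlonglongrightarrow> 0"
proof -
  let ?S = "\<lambda>m. {\<omega> \<in> space M. \<epsilon> < \<bar>emp_depth {1..m} p (obs \<omega>) - D (obs \<omega> p) P\<bar>}"
  obtain C where C: "\<forall>\<^sub>F m in sequentially.
       (\<integral>\<^sup>+ \<omega>. ennreal_powr (depth_dist D \<Omega> (empirical \<Omega> {1..m} (\<lambda>i. X i \<omega>)) P) (2 * \<beta>) \<partial>M)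
         \<le> ennreal (C * real m powr (- \<beta>))"
    using assms(1) unfolding Asm2_def by blast
  have ev: "\<forall>\<^sub>F m in sequentially. expectation (\<lambda>\<omega>. of_bool (\<epsilon> < \<bar>emp_depth {1..m} p (obs \<omega>) - D (obs \<omega> p) P\<bar>) :: real)
      \<le> (\<bar>C\<bar> / \<epsilon> powr (2 * \<beta>)) * real m powr (- \<beta>)"
    using C eventually_ge_at_top[of 1]
  proof eventually_elim
    case (elim m)
    have [measurable]: "emp_depth {1..m} p \<in> borel_measurable N" using elim(2) by (intro emp_depth_measurable) auto
    have Sm: "?S m \<in> events" by measurable
    \<comment> \<open>Markov's inequality is obtained from a pointwise comparison and monotonicity
      of the nonnegative integral, since the supremum may fail to be measurable.\<close>
    have pt: "ennreal (\<epsilon> powr (2 * \<beta>)) * indicator (?S m) \<omega>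
        \<le> ennreal_powr (depth_dist D \<Omega> (empirical \<Omega> {1..m} (\<lambda>i. X i \<omega>)) P) (2 * \<beta>)" if "\<omega> \<in> space M" for \<omega>
    proof (cases "\<omega> \<in> ?S m")
      case True
      let ?d = "depth_dist D \<Omega> (empirical \<Omega> {1..m} (\<lambda>i. X i \<omega>)) P"
      have le: "ennreal \<bar>emp_depth {1..m} p (obs \<omega>) - D (obs \<omega> p) P\<bar> \<le> ?d"
        unfolding depth_dist_def emp_depth_def emp_def obs_simps
        by (rule SUP_upper) (use obs_space[OF that] in \<open>auto simp: space_N_iff\<close>)
      show ?thesis
      proof (cases ?d)
        case (real r)
        then have "\<epsilon> \<le> r" using le True by simp
        then have "\<epsilon> powr (2 * \<beta>) \<le> r powr (2 * \<beta>)" using assms by (intro powr_mono2) auto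
        then show ?thesis using True real by (simp add: ennreal_powr_def)
      qed (simp add: ennreal_powr_def)
    qed simp
    have "ennreal (\<epsilon> powr (2 * \<beta>)) * emeasure M (?S m) = (\<integral>\<^sup>+ \<omega>. ennreal (\<epsilon> powr (2 * \<beta>)) * indicator (?S m) \<omega> \<partial>M)"
      by (rule nn_integral_cmult_indicator[OF Sm, symmetric])
    also have "\<dots> \<le> ennreal (C * real m powr (- \<beta>))"
      using nn_integral_mono[OF pt] elim(1) by (rule order.trans)
    also have "\<dots> \<le> ennreal (\<bar>C\<bar> * real m powr (- \<beta>))"
      by (intro ennreal_leI mult_right_mono) auto
    finally have "\<epsilon> powr (2 * \<beta>) * prob (?S m) \<le> \<bar>C\<bar> * real m powr (- \<beta>)"
      by (simp add: emeasure_eq_measure flip: ennreal_mult')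
    moreover have "expectation (\<lambda>\<omega>. of_bool (\<epsilon> < \<bar>emp_depth {1..m} p (obs \<omega>) - D (obs \<omega> p) P\<bar>) :: real)
        = expectation (indicator (?S m))"
      by (intro Bochner_Integration.integral_cong refl) (auto simp: indicator_def)
    moreover have "expectation (indicator (?S m)) = prob (?S m)" by (simp add: Int_absorb2 Collect_restrict)
    ultimately show ?case using assms(3) by (simp add: field_simps)
  qed
  have "(\<lambda>m. (\<bar>C\<bar> / \<epsilon> powr (2 * \<beta>)) * real m powr (- \<beta>)) \<longlonglongrightarrow> 0"
    using assms(2) by (intro tendsto_mult_right_zero tendsto_neg_powr filterlim_real_sequentially) auto
  then show ?thesis
    by (rule tendsto_sandwich[OF _ ev tendsto_const, rotated]) auto
qed


text \<open>With \<open>h = 1\<close> and Jensen's inequality, the second-moment rate of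
  \<open>Asm4\<close> yields its square root as a rate for the probability of one near tie.\<close>

lemma expectation_close_le:
  assumes I: "finite I" "I \<noteq> {}" and pq: "p \<notin> Inl ` I" "q \<notin> Inl ` I" "p \<noteq> q"
  shows "expectation (\<lambda>\<omega>. close I c p q (obs \<omega>)) \<le> sqrt (expectation (\<lambda>\<omega>. (collision I c (obs \<omega>))\<^sup>2))"
proof -
  note [measurable] = collision_measurable[OF I]
  have "expectation (\<lambda>\<omega>. close I c p q (obs \<omega>)) = expectation (\<lambda>\<omega>. collision I c (obs \<omega>))"
    using expectation_close[OF I pq, of "\<lambda>_. 1"] by simp
  also have "\<dots> = expectation (\<lambda>\<omega>. \<bar>collision I c (obs \<omega>)\<bar>)" using collision_bounds by simp
  also have "\<dots> \<le> sqrt (expectation (\<lambda>\<omega>. (collision I c (obs \<omega>))\<^sup>2))"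
    by (rule expectation_abs_le_sqrt)
      (auto intro!: integrable_obs[of "\<lambda>z. (collision I c z)\<^sup>2" 1] simp: abs_square_le_1 collision_bounds)
  finally show ?thesis .
qed

lemma close_upd: "r \<notin> Inl ` I \<Longrightarrow> r \<noteq> p \<Longrightarrow> r \<noteq> q \<Longrightarrow> close I c p q (z(r := y)) = close I c p q z"
  by (simp add: close_def emp_depth_def emp_upd)

lemma collision_upd: "r \<notin> Inl ` I \<Longrightarrow> collision I c (z(r := y)) = collision I c z"
  by (intro collision_cong emp_upd)

text \<open>Given the sample, two disjoint fresh pairs are independent, so both near ties together
  have as probability the mean of a squared conditional probability, the quantity in
  \<open>Asm4\<close>. The pairs are integrated out one after the other.\<close>

lemma expectation_close_close:
  assumes I: "finite I" "I \<noteq> {}" and pq: "p \<notin> Inl ` I" "q \<notin> Inl ` I" "p' \<notin> Inl ` I" "q' \<notin> Inl ` I"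
    and d: "distinct [p, q, p', q']"
  shows "expectation (\<lambda>\<omega>. close I c p q (obs \<omega>) * close I c p' q' (obs \<omega>)) = expectation (\<lambda>\<omega>. (collision I c (obs \<omega>))\<^sup>2)"
proof -
  note m = collision_measurable[OF I, of c] close_measurable[OF I, of c]
  have "expectation (\<lambda>\<omega>. close I c p q (obs \<omega>) * close I c p' q' (obs \<omega>))
      = expectation (\<lambda>\<omega>. collision I c (obs \<omega>) * close I c p' q' (obs \<omega>))"
    using pq d m by (intro expectation_close[OF I] close_upd m) (auto simp: close_def)
  also have "\<dots> = expectation (\<lambda>\<omega>. close I c p' q' (obs \<omega>) * collision I c (obs \<omega>))"
    by (simp add: mult.commute)
  also have "\<dots> = expectation (\<lambda>\<omega>. collision I c (obs \<omega>) * collision I c (obs \<omega>))"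
    using pq d m collision_bounds[of I c] by (intro expectation_close[OF I] collision_upd m) auto
  finally show ?thesis by (simp add: power2_eq_square)
qed

text \<open>Removing 1 and 2 from \<open>{1..Suc m}\<close> leaves \<open>m - 1\<close>
  observations, as many as \<open>Asm4\<close> conditions on at size \<open>m\<close>; the shift
  \<open>Suc\<close> matches them.\<close>

lemma expectation_collision_Suc:
  assumes "2 \<le> m"
  shows "expectation (\<lambda>\<omega>. (collision (Suc ` {2..m}) c (obs \<omega>))\<^sup>2) = expectation (\<lambda>\<omega>. (collision {2..m} c (obs \<omega>))\<^sup>2)"
proof -
  have [measurable]: "collision {2..m} c \<in> borel_measurable N"
    using assms by (intro collision_measurable) auto
  have "collision {2..m} c (z \<circ> map_sum Suc id) = collision (Suc ` {2..m}) c z" if "z \<in> space N" for z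
    using emp_comp[OF that, of "{2..m}" Suc "map_sum Suc id"] by (simp add: collision_def)
  then have "expectation (\<lambda>\<omega>. (collision (Suc ` {2..m}) c (obs \<omega>))\<^sup>2)
      = expectation (\<lambda>\<omega>. (\<lambda>z. (collision {2..m} c z)\<^sup>2) (obs \<omega> \<circ> map_sum Suc id))"
    by (intro Bochner_Integration.integral_cong refl) (auto simp: obs_space)
  also have "\<dots> = expectation (\<lambda>\<omega>. (collision {2..m} c (obs \<omega>))\<^sup>2)"
    by (rule expectation_obs_comp) (auto intro!: sum.inj_map)
  finally show ?thesis .
qed

text \<open>With both of the observations left out, the cross terms vanish by \<open>kernel_proj_orthogonal\<close>,
  so only the product of the two replacement errors contributes to the covariance.\<close>

lemma cov_22_le:
  assumes m: "2 \<le> m"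
    and C: "\<And>p. AE \<omega> in M. \<bar>emp_depth {1..m} p (obs \<omega>) - emp_depth ({1..m} - {1}) p (obs \<omega>)\<bar> \<le> c"
  shows "\<bar>cov (Suc m) 2 2\<bar> \<le> expectation (\<lambda>\<omega>. (collision {2..m} (2 * c) (obs \<omega>))\<^sup>2)"
proof -
  \<comment> \<open>\<open>?s\<close> carries \<open>{1..m}\<close> to \<open>?I1\<close> and
    \<open>{1..m} - {1}\<close> to \<open>?J\<close>, so the bound for size \<open>m\<close>
    compares one with two observations removed from \<open>Suc m\<close>. Exchanging 1 and 2 by
    \<open>?t\<close> then gives the same for \<open>?I2\<close>.\<close>
  let ?s = "map_sum Suc id :: nat + nat \<Rightarrow> nat + nat"
  let ?t = "Transposition.transpose 1 2 :: nat \<Rightarrow> nat"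
  let ?J = "Suc ` {2..m}" and ?I1 = "{1..Suc m} - {1}" and ?I2 = "{1..Suc m} - {2}"
  have J: "?J = {3..Suc m}" by (simp add: image_Suc_atLeastAtMost)
  have I1: "?I1 = Suc ` {1..m}" by (auto simp: image_Suc_atLeastAtMost)
  have tJ: "?t ` ?J = ?J" unfolding J by (intro image_cong_simp[THEN trans, OF refl _ image_ident]) (auto simp: Transposition.transpose_def)
  have tI: "?t ` ?I1 = ?I2"
    using permutes_image[OF permutes_swap_id[of 1 "{1..Suc m}" 2]] m by (simp add: image_set_diff)
  have fin: "finite ?J" "?J \<noteq> {}" "finite ?I1" "?I1 \<noteq> {}" "finite ?I2" "?I2 \<noteq> {}"
    using m leave_one_out_nonempty[of "Suc m" 1] leave_one_out_nonempty[of "Suc m" 2] by auto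
  have notin: "1 \<notin> ?J" "2 \<notin> ?J" by auto
  note [measurable] = kernel_measurable[OF fin(1,2)] kernel_measurable[OF fin(3,4)] kernel_measurable[OF fin(5,6)]
    emp_depth_measurable[OF fin(1,2)] emp_depth_measurable[OF fin(3,4)] emp_depth_measurable[OF fin(5,6)] close_measurable[OF fin(1,2)]
  have [measurable]: "emp_depth {1..m} p \<in> borel_measurable N" "emp_depth ({1..m} - {1}) p \<in> borel_measurable N" for p
    using m leave_one_out_nonempty[of m 1] by (auto intro!: emp_depth_measurable)
  have I2': "{1..m} - {1} = {2..m}" by auto
  have shift: "AE \<omega> in M. \<bar>emp_depth ?I1 (?s p) (obs \<omega>) - emp_depth ?J (?s p) (obs \<omega>)\<bar> \<le> c" for p
  proof -
    have "AE \<omega> in M. \<bar>emp_depth {1..m} p (obs \<omega> \<circ> ?s) - emp_depth ({1..m} - {1}) p (obs \<omega> \<circ> ?s)\<bar> \<le> c"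
      by (rule AE_obs_comp[OF sum.inj_map[OF inj_Suc inj_on_id] _ C]) measurable
    then show ?thesis using AE_space
    proof eventually_elim
      case (elim \<omega>)
      then show ?case
        using emp_depth_comp[OF obs_space[OF elim(2)], of "{1..m}" Suc ?s p] 
          emp_depth_comp[OF obs_space[OF elim(2)], of "{1..m} - {1}" Suc ?s p]
        unfolding I1 I2' by simp
    qed
  qed
  have swap: "AE \<omega> in M. \<bar>emp_depth ?I2 (map_sum ?t ?t p) (obs \<omega>) - emp_depth ?J (map_sum ?t ?t p) (obs \<omega>)\<bar> \<le> c"
    if "p = Inl 1 \<or> p = Inr 1" for p
  proof -
    \<comment> \<open>\<open>Inl 1\<close>, which is left out of \<open>?I1\<close>, is the shift of
      \<open>Inl 0\<close>, an observation outside the sample \<open>{1..m}\<close>.\<close>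
    have "p \<in> {?s (Inl 0), ?s (Inr 1)}" using that by auto
    then have "AE \<omega> in M. \<bar>emp_depth ?I1 p (obs \<omega>) - emp_depth ?J p (obs \<omega>)\<bar> \<le> c" using shift by blast
    then have "AE \<omega> in M. \<bar>emp_depth ?I1 p (obs \<omega> \<circ> map_sum ?t ?t) - emp_depth ?J p (obs \<omega> \<circ> map_sum ?t ?t)\<bar> \<le> c"
      by (rule AE_obs_comp[OF sum.inj_map[OF inj_transpose inj_transpose], rotated]) measurable
    then show ?thesis using AE_space
    proof eventually_elim
      case (elim \<omega>)
      then show ?case
        using emp_depth_comp[OF obs_space[OF elim(2)], of ?I1 ?t "map_sum ?t ?t" p] 
          emp_depth_comp[OF obs_space[OF elim(2)], of ?J ?t "map_sum ?t ?t" p]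
        unfolding tI tJ by simp
    qed
  qed
  define a b a' b' where "a \<omega> = kernel ?I1 1 1 (obs \<omega>) - proj 1 1 (obs \<omega>)" and "b \<omega> = kernel ?I2 2 2 (obs \<omega>) - proj 2 2 (obs \<omega>)"
    and "a' \<omega> = kernel ?J 1 1 (obs \<omega>) - proj 1 1 (obs \<omega>)" and "b' \<omega> = kernel ?J 2 2 (obs \<omega>) - proj 2 2 (obs \<omega>)" for \<omega>
  have [measurable]: "a \<in> borel_measurable M" "b \<in> borel_measurable M" "a' \<in> borel_measurable M" "b' \<in> borel_measurable M"
    unfolding a_def[abs_def] b_def[abs_def] a'_def[abs_def] b'_def[abs_def] by measurable
  have bd: "\<bar>a \<omega>\<bar> \<le> 2" "\<bar>b \<omega>\<bar> \<le> 2" "\<bar>a' \<omega>\<bar> \<le> 2" "\<bar>b' \<omega>\<bar> \<le> 2" for \<omega>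
    unfolding a_def b_def a'_def b'_def by (rule kernel_bounds)+
  have int: "integrable M (\<lambda>\<omega>. f \<omega> * g \<omega>)"
    if "f \<in> borel_measurable M" "g \<in> borel_measurable M" "\<And>\<omega>. \<bar>f \<omega>\<bar> \<le> 2" "\<And>\<omega>. \<bar>g \<omega>\<bar> \<le> 2" for f g :: "'a \<Rightarrow> real"
    using that mult_mono[OF that(3,4)] by (intro integrable_const_bound[of _ "2 * 2"]) (auto simp: abs_mult)
  \<comment> \<open>In \<open>a' * b\<close> the exchanged pair is \<open>X 2\<close>,
    \<open>Y 2\<close>, in \<open>b' * a\<close> it is \<open>X 1\<close>, \<open>Y 1\<close>: the
    factor that is negated is the one whose empirical measure keeps the X observation of the
    other.\<close>
  have zero: "expectation (\<lambda>\<omega>. a' \<omega> * b \<omega>) = 0" "expectation (\<lambda>\<omega>. b' \<omega> * a \<omega>) = 0" "expectation (\<lambda>\<omega>. a' \<omega> * b' \<omega>) = 0"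
    unfolding a_def b_def a'_def b'_def using fin notin by (intro kernel_proj_orthogonal; simp)+
  have "cov (Suc m) 2 2 = expectation (\<lambda>\<omega>. a \<omega> * b \<omega>)"
    by (simp add: cov_def residual_def a_def b_def)
  also have "\<dots> = expectation (\<lambda>\<omega>. (a \<omega> - a' \<omega>) * (b \<omega> - b' \<omega>) + a' \<omega> * b \<omega> + b' \<omega> * a \<omega> - a' \<omega> * b' \<omega>)"
    by (intro Bochner_Integration.integral_cong refl) (simp add: algebra_simps)
  also have "\<dots> = expectation (\<lambda>\<omega>. (a \<omega> - a' \<omega>) * (b \<omega> - b' \<omega>))"
    using int bd zero by (simp add: left_diff_distrib right_diff_distrib mult.commute[of "a _" "b' _"])
  finally have "\<bar>cov (Suc m) 2 2\<bar> \<le> expectation (\<lambda>\<omega>. \<bar>(a \<omega> - a' \<omega>) * (b \<omega> - b' \<omega>)\<bar>)"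
    using integral_abs_bound by metis
  also have "\<dots> \<le> expectation (\<lambda>\<omega>. close ?J (2 * c) (Inl 1) (Inr 1) (obs \<omega>) * close ?J (2 * c) (Inl 2) (Inr 2) (obs \<omega>))"
  proof (rule integral_mono_AE)
    show "integrable M (\<lambda>\<omega>. \<bar>(a \<omega> - a' \<omega>) * (b \<omega> - b' \<omega>)\<bar>)"
      using int bd by (simp add: left_diff_distrib right_diff_distrib)
    show "integrable M (\<lambda>\<omega>. close ?J (2 * c) (Inl 1) (Inr 1) (obs \<omega>) * close ?J (2 * c) (Inl 2) (Inr 2) (obs \<omega>))"
      by (intro integrable_obs[of "\<lambda>z. close ?J (2 * c) (Inl 1) (Inr 1) z * close ?J (2 * c) (Inl 2) (Inr 2) z" 1])
        (measurable, simp add: close_def)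
    show "AE \<omega> in M. \<bar>(a \<omega> - a' \<omega>) * (b \<omega> - b' \<omega>)\<bar>
        \<le> close ?J (2 * c) (Inl 1) (Inr 1) (obs \<omega>) * close ?J (2 * c) (Inl 2) (Inr 2) (obs \<omega>)"
      using shift[of "Inl 0"] shift[of "Inr 1"] swap[OF disjI1[OF refl]] swap[OF disjI2[OF refl]]
    proof eventually_elim
      case (elim \<omega>)
      have "\<bar>a \<omega> - a' \<omega>\<bar> \<le> close ?J (2 * c) (Inl 1) (Inr 1) (obs \<omega>)"
        using precedes_perturb[OF elim(1,2)] by (simp add: a_def a'_def kernel_def close_def)
      moreover have "\<bar>b \<omega> - b' \<omega>\<bar> \<le> close ?J (2 * c) (Inl 2) (Inr 2) (obs \<omega>)"
        using precedes_perturb[OF elim(3,4)] by (simp add: b_def b'_def kernel_def close_def)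
      ultimately show ?case unfolding abs_mult by (intro mult_mono) (auto simp: close_def)
    qed
  qed
  also have "\<dots> = expectation (\<lambda>\<omega>. (collision ?J (2 * c) (obs \<omega>))\<^sup>2)"
    by (rule expectation_close_close) (use m in auto)
  also have "\<dots> = expectation (\<lambda>\<omega>. (collision {2..m} (2 * c) (obs \<omega>))\<^sup>2)"
    by (rule expectation_collision_Suc[OF m])
  finally show ?thesis .
qed

section \<open>Limits of the covariances and of the leave-one-out error\<close>

lemma cov_22_limit:
  assumes "Asm3 M \<Omega> D X" "Asm4 M \<Omega> D X \<beta>" "1 / 2 < \<beta>"
  shows "(\<lambda>m. real m * \<bar>cov m 2 2\<bar>) \<longlonglongrightarrow> 0"
proof -
  obtain C m0 where C: "C > 0" "\<forall>m\<ge>m0. \<forall>p. AE \<omega> in M. \<bar>emp_depth {1..m} p (obs \<omega>) - emp_depth ({1..m} - {1}) p (obs \<omega>)\<bar> \<le> C / real m"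
    using Asm3_emp_depth[OF assms(1)] by blast
  let ?e = "\<lambda>m. expectation (\<lambda>\<omega>. (collision {2..m} ((2 * C) / m) (obs \<omega>))\<^sup>2)"
  have lim: "(\<lambda>m. 2 * (real m * ?e m)) \<longlonglongrightarrow> 0"
    using Asm4_collision[OF assms(2,3), of "2 * C"] C(1) by (intro tendsto_mult_right_zero) auto
  \<comment> \<open>The covariance at \<open>Suc m\<close> is bounded by a quantity at
    \<open>m\<close>; the factor 2 absorbs \<open>Suc m \<le> 2 * m\<close>.\<close>
  have ev: "\<forall>\<^sub>F m in sequentially. real (Suc m) * \<bar>cov (Suc m) 2 2\<bar> \<le> 2 * (real m * ?e m)"
    using eventually_ge_at_top[of 2] eventually_ge_at_top[of m0]
  proof eventually_elim
    case (elim m)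
    have "real (Suc m) * \<bar>cov (Suc m) 2 2\<bar> \<le> (2 * real m) * ?e m"
      using cov_22_le[OF elim(1), of "C / m"] C(2) elim by (intro mult_mono) auto
    then show ?case by simp
  qed
  have "(\<lambda>m. real (Suc m) * \<bar>cov (Suc m) 2 2\<bar>) \<longlonglongrightarrow> 0"
    by (rule tendsto_sandwich[OF _ ev tendsto_const lim]) auto
  then show ?thesis by (rule filterlim_sequentially_Suc[THEN iffD1])
qed

text \<open>Relative to \<open>{2..m}\<close> both \<open>X 1\<close> and \<open>Y 1\<close> are
  fresh. Since P = Q, the near-tie probability that \<open>Asm4\<close> bounds for two X
  observations is also that of this mixed pair.\<close>

lemma kernel_leave_one_out_limit:
  assumes "Asm3 M \<Omega> D X" "Asm4 M \<Omega> D X \<beta>" "1 / 2 < \<beta>"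
  shows "(\<lambda>m. sqrt (real m) * expectation (\<lambda>\<omega>. \<bar>kernel {1..m} 1 1 (obs \<omega>) - kernel ({1..m} - {1}) 1 1 (obs \<omega>)\<bar>)) \<longlonglongrightarrow> 0"
proof -
  obtain C m0 where C: "C > 0" "\<forall>m\<ge>m0. \<forall>p. AE \<omega> in M. \<bar>emp_depth {1..m} p (obs \<omega>) - emp_depth ({1..m} - {1}) p (obs \<omega>)\<bar> \<le> C / real m"
    using Asm3_emp_depth[OF assms(1)] by blast
  let ?e = "\<lambda>m. expectation (\<lambda>\<omega>. (collision {2..m} ((2 * C) / m) (obs \<omega>))\<^sup>2)"
  have lim: "(\<lambda>m. sqrt (real m * ?e m)) \<longlonglongrightarrow> 0"
    using tendsto_real_sqrt[OF Asm4_collision[OF assms(2,3), of "2 * C"]] C(1) by simp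
  have ev: "\<forall>\<^sub>F m in sequentially. sqrt (real m) * expectation (\<lambda>\<omega>. \<bar>kernel {1..m} 1 1 (obs \<omega>) - kernel ({1..m} - {1}) 1 1 (obs \<omega>)\<bar>)
      \<le> sqrt (real m * ?e m)"
    using eventually_ge_at_top[of 2] eventually_ge_at_top[of m0]
  proof eventually_elim
    case (elim m)
    have I: "{1..m} - {1} = {2..m}" by auto
    have ne: "{2..m} \<noteq> {}" "{1..m} \<noteq> {}" using elim by auto
    note [measurable] = kernel_measurable[OF _ ne(1)] kernel_measurable[OF _ ne(2)] close_measurable[OF _ ne(1)]
    have "expectation (\<lambda>\<omega>. \<bar>kernel {1..m} 1 1 (obs \<omega>) - kernel {2..m} 1 1 (obs \<omega>)\<bar>)
        \<le> expectation (\<lambda>\<omega>. close {2..m} (2 * (C / m)) (Inl 1) (Inr 1) (obs \<omega>))"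
    proof (rule integral_mono_AE)
      show "integrable M (\<lambda>\<omega>. \<bar>kernel {1..m} 1 1 (obs \<omega>) - kernel {2..m} 1 1 (obs \<omega>)\<bar>)"
        using ne kernel_bounds(1) by (intro integrable_abs integrable_obs[of "\<lambda>z. kernel {1..m} 1 1 z - kernel {2..m} 1 1 z" 1]) auto
      show "integrable M (\<lambda>\<omega>. close {2..m} (2 * (C / m)) (Inl 1) (Inr 1) (obs \<omega>))"
        using ne by (intro integrable_obs[of _ 1] close_measurable) (auto simp: close_def)
      have "AE \<omega> in M. \<bar>emp_depth {1..m} p (obs \<omega>) - emp_depth {2..m} p (obs \<omega>)\<bar> \<le> C / real m" for p
        using C(2) elim unfolding I[symmetric] by blast
      from this[of "Inl 1"] this[of "Inr 1"]
      show "AE \<omega> in M. \<bar>kernel {1..m} 1 1 (obs \<omega>) - kernel {2..m} 1 1 (obs \<omega>)\<bar> \<le> close {2..m} (2 * (C / m)) (Inl 1) (Inr 1) (obs \<omega>)"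
        by eventually_elim (unfold kernel_def close_def, rule precedes_perturb)
    qed
    also have "\<dots> \<le> sqrt (expectation (\<lambda>\<omega>. (collision {2..m} (2 * (C / m)) (obs \<omega>))\<^sup>2))"
      using ne by (intro expectation_close_le) auto
    finally have "expectation (\<lambda>\<omega>. \<bar>kernel {1..m} 1 1 (obs \<omega>) - kernel {2..m} 1 1 (obs \<omega>)\<bar>) \<le> sqrt (?e m)" by simp
    from mult_left_mono[OF this, of "sqrt m"] show ?case unfolding I by (simp add: real_sqrt_mult)
  qed
  show ?thesis by (rule tendsto_sandwich[OF _ ev tendsto_const lim]) auto
qed

text \<open>\<open>X 0\<close> and \<open>Y 1\<close> lie outside the sample. The kernels can differ
  only at a near tie of population depths, controlled by \<open>Asm1\<close>, or if a depth error
  exceeds \<open>\<epsilon>\<close>, controlled by \<open>Asm2\<close>.\<close>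

lemma kernel_limit:
  assumes "Asm1 M D P X \<beta>" "Asm2 M \<Omega> D P X \<beta>" "0 < \<beta>"
  shows "(\<lambda>m. expectation (\<lambda>\<omega>. \<bar>kernel {1..m} 0 1 (obs \<omega>) - kernel_lim 0 1 (obs \<omega>)\<bar>)) \<longlonglongrightarrow> 0"
proof (rule LIMSEQ_I)
  fix \<eta> :: real assume \<eta>: "0 < \<eta>"
  obtain C where C: "C > 0" "\<forall>\<delta>\<ge>0. \<forall>p q. p \<noteq> q \<longrightarrow>
      expectation (\<lambda>\<omega>. of_bool (\<bar>D (obs \<omega> p) P - D (obs \<omega> q) P\<bar> \<le> \<delta>)) \<le> C * (2 * \<delta>) powr \<beta>"
    using expectation_near_ties[OF assms(1)] assms(3) by (meson less_imp_le)
  \<comment> \<open>\<open>\<epsilon>\<close> solves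
    \<open>C * (4 * \<epsilon>) powr \<beta> = \<eta> / 2\<close>; the other half of
    \<open>\<eta>\<close> is spent on depth errors.\<close>
  define \<epsilon> where "\<epsilon> = (\<eta> / (2 * C)) powr (1 / \<beta>) / 4"
  have \<epsilon>: "\<epsilon> > 0" using \<eta> C(1) by (simp add: \<epsilon>_def)
  have \<epsilon>C: "C * (2 * (2 * \<epsilon>)) powr \<beta> = \<eta> / 2"
    using \<eta> C(1) assms(3) by (simp add: \<epsilon>_def powr_powr)
  let ?far = "\<lambda>m p z. of_bool (\<epsilon> < \<bar>emp_depth {1..m} p z - D (z p) P\<bar>) :: real"
  let ?tie = "\<lambda>z. of_bool (\<bar>D (z (Inl 0)) P - D (z (Inr 1)) P\<bar> \<le> 2 * \<epsilon>) :: real"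
  let ?d = "\<lambda>m. expectation (\<lambda>\<omega>. \<bar>kernel {1..m} 0 1 (obs \<omega>) - kernel_lim 0 1 (obs \<omega>)\<bar>)"
  have far: "(\<lambda>m. expectation (\<lambda>\<omega>. ?far m (Inl 0) (obs \<omega>)) + expectation (\<lambda>\<omega>. ?far m (Inr 1) (obs \<omega>))) \<longlonglongrightarrow> 0 + 0"
    by (intro tendsto_add Asm2_emp_depth[OF assms(2,3) \<epsilon>])
  then have "\<forall>\<^sub>F m in sequentially. expectation (\<lambda>\<omega>. ?far m (Inl 0) (obs \<omega>)) + expectation (\<lambda>\<omega>. ?far m (Inr 1) (obs \<omega>)) < \<eta> / 2"
    by (rule order_tendstoD) (use \<eta> in simp)
  then have "\<forall>\<^sub>F m in sequentially. norm (?d m - 0) < \<eta>"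
    using eventually_ge_at_top[of 1]
  proof eventually_elim
    case (elim m)
    have [measurable]: "emp_depth {1..m} p \<in> borel_measurable N" "kernel {1..m} i j \<in> borel_measurable N" for p i j
      using elim by (auto intro!: emp_depth_measurable kernel_measurable)
    have int: "integrable M (\<lambda>\<omega>. ?tie (obs \<omega>))" "integrable M (\<lambda>\<omega>. ?far m (Inl 0) (obs \<omega>))" "integrable M (\<lambda>\<omega>. ?far m (Inr 1) (obs \<omega>))"
      by (rule integrable_const_bound[of _ 1]; (measurable | simp))+
    have "?d m \<le> expectation (\<lambda>\<omega>. ?tie (obs \<omega>) + (?far m (Inl 0) (obs \<omega>) + ?far m (Inr 1) (obs \<omega>)))"
    proof (rule integral_mono)
      show "integrable M (\<lambda>\<omega>. \<bar>kernel {1..m} 0 1 (obs \<omega>) - kernel_lim 0 1 (obs \<omega>)\<bar>)"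
        using elim(2) kernel_bounds(4)
        by (intro integrable_abs integrable_obs[of "\<lambda>z. kernel {1..m} 0 1 z - kernel_lim 0 1 z" 1]
            borel_measurable_diff kernel_measurable) auto
      show "integrable M (\<lambda>\<omega>. ?tie (obs \<omega>) + (?far m (Inl 0) (obs \<omega>) + ?far m (Inr 1) (obs \<omega>)))"
        by (intro Bochner_Integration.integrable_add int)
      fix \<omega>
      show "\<bar>kernel {1..m} 0 1 (obs \<omega>) - kernel_lim 0 1 (obs \<omega>)\<bar> \<le> ?tie (obs \<omega>) + (?far m (Inl 0) (obs \<omega>) + ?far m (Inr 1) (obs \<omega>))"
      proof (cases "\<bar>emp_depth {1..m} (Inl 0) (obs \<omega>) - D (obs \<omega> (Inl 0)) P\<bar> \<le> \<epsilon> \<and> \<bar>emp_depth {1..m} (Inr 1) (obs \<omega>) - D (obs \<omega> (Inr 1)) P\<bar> \<le> \<epsilon>")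
        case True
        then have "\<bar>kernel {1..m} 0 1 (obs \<omega>) - kernel_lim 0 1 (obs \<omega>)\<bar> \<le> ?tie (obs \<omega>)"
          unfolding kernel_def kernel_lim_def by (intro precedes_perturb) auto
        then show ?thesis by (rule order.trans) simp
      next
        case False
        then have "1 \<le> ?far m (Inl 0) (obs \<omega>) + ?far m (Inr 1) (obs \<omega>)" by auto
        then show ?thesis using kernel_bounds(4)[of "{1..m}" 0 1 "obs \<omega>" 0 1 "obs \<omega>"] by (simp add: add_increasing)
      qed
    qed
    also have "\<dots> = expectation (\<lambda>\<omega>. ?tie (obs \<omega>)) + (expectation (\<lambda>\<omega>. ?far m (Inl 0) (obs \<omega>)) + expectation (\<lambda>\<omega>. ?far m (Inr 1) (obs \<omega>)))"
      using int by (simp only: Bochner_Integration.integral_add Bochner_Integration.integrable_add)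
    also have "\<dots> < \<eta> / 2 + \<eta> / 2"
      using C(2)[rule_format, of "2 * \<epsilon>" "Inl 0" "Inr 1"] \<epsilon> elim(1) \<epsilon>C by (intro add_le_less_mono) auto
    finally show ?case by simp
  qed
  then show "\<exists>no. \<forall>m\<ge>no. norm (?d m - 0) < \<eta>" by (simp add: eventually_sequentially)
qed


text \<open>For the reduced sample \<open>X i\<close> is a fresh observation, in the role that
  \<open>X 0\<close> has for a full sample of size \<open>m\<close>.\<close>

lemma kernel_leave_one_out_lim:
  assumes "2 \<le> Suc m" "i \<in> {1..Suc m}"
  shows "expectation (\<lambda>\<omega>. \<bar>kernel ({1..Suc m} - {i}) i j (obs \<omega>) - kernel_lim i j (obs \<omega>)\<bar>)
    = expectation (\<lambda>\<omega>. \<bar>kernel {1..m} 0 1 (obs \<omega>) - kernel_lim 0 1 (obs \<omega>)\<bar>)"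
proof -
  let ?t = "Transposition.transpose 1 i" and ?u = "Transposition.transpose 1 j"
  \<comment> \<open>\<open>?t \<circ> Suc\<close> maps \<open>{1..m}\<close> onto
    \<open>{1..Suc m} - {i}\<close> and 0 to \<open>i\<close>.\<close>
  let ?\<sigma> = "map_sum (?t \<circ> Suc) ?u :: nat + nat \<Rightarrow> nat + nat"
  have inj: "inj (?t \<circ> Suc)" "inj ?u" by (auto intro: inj_compose)
  have "Suc ` {1..m} = {1..Suc m} - {1}" by (auto simp: image_Suc_atLeastAtMost)
  moreover have "?t ` ({1..Suc m} - {1}) = {1..Suc m} - {i}"
    using permutes_image[OF permutes_swap_id[of 1 "{1..Suc m}" i]] assms by (simp add: image_set_diff)
  ultimately have im: "(?t \<circ> Suc) ` {1..m} = {1..Suc m} - {i}" by (simp only: image_comp[symmetric])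
  have [measurable]: "kernel {1..m} 0 1 \<in> borel_measurable N" using assms by (intro kernel_measurable) auto
  have "expectation (\<lambda>\<omega>. \<bar>kernel ({1..Suc m} - {i}) i j (obs \<omega>) - kernel_lim i j (obs \<omega>)\<bar>)
    = expectation (\<lambda>\<omega>. (\<lambda>z. \<bar>kernel {1..m} 0 1 z - kernel_lim 0 1 z\<bar>) (obs \<omega> \<circ> ?\<sigma>))"
  proof (intro Bochner_Integration.integral_cong refl)
    fix \<omega> assume "\<omega> \<in> space M"
    then have "kernel {1..m} 0 1 (obs \<omega> \<circ> ?\<sigma>) = kernel ({1..Suc m} - {i}) i j (obs \<omega>)"
      using kernel_perm[OF obs_space finite_atLeastAtMost inj(1), of \<omega> 1 m 0 1 ?u] unfolding im by simp
    moreover have "kernel_lim 0 1 (obs \<omega> \<circ> ?\<sigma>) = kernel_lim i j (obs \<omega>)" by (rule kernel_lim_comp) auto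
    ultimately show "\<bar>kernel ({1..Suc m} - {i}) i j (obs \<omega>) - kernel_lim i j (obs \<omega>)\<bar>
        = (\<lambda>z. \<bar>kernel {1..m} 0 1 z - kernel_lim 0 1 z\<bar>) (obs \<omega> \<circ> ?\<sigma>)" by simp
  qed
  also have "\<dots> = expectation (\<lambda>\<omega>. \<bar>kernel {1..m} 0 1 (obs \<omega>) - kernel_lim 0 1 (obs \<omega>)\<bar>)"
    by (rule expectation_obs_comp[OF sum.inj_map[OF inj]]) measurable
  finally show ?thesis .
qed

text \<open>In a b - A B = (a - A) b + A (b - B) the factors b and A are bounded by 2, and both
  differences have the same L^1 norm; hence the 4. The projections cancel in the
  differences.\<close>

lemma cov_le_kernel_lim:
  assumes "2 \<le> Suc m" "k \<in> {1..Suc m}"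
    and zero: "expectation (\<lambda>\<omega>. (kernel_lim 1 1 (obs \<omega>) - proj 1 1 (obs \<omega>)) * (kernel_lim k l (obs \<omega>) - proj k l (obs \<omega>))) = 0"
  shows "\<bar>cov (Suc m) k l\<bar> \<le> 4 * expectation (\<lambda>\<omega>. \<bar>kernel {1..m} 0 1 (obs \<omega>) - kernel_lim 0 1 (obs \<omega>)\<bar>)"
proof -
  define d where "d i j \<omega> = residual (Suc m) i j (obs \<omega>) - (kernel_lim i j (obs \<omega>) - proj i j (obs \<omega>))" for i j \<omega>
  have [measurable]: "residual (Suc m) i j \<in> borel_measurable N" for i j using assms by (intro residual_measurable)
  have [measurable]: "d i j \<in> borel_measurable M" for i j unfolding d_def by measurable
  have d: "d i j \<omega> = kernel ({1..Suc m} - {i}) i j (obs \<omega>) - kernel_lim i j (obs \<omega>)" for i j \<omega>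
    by (simp add: d_def residual_def)
  have bd: "\<bar>d i j \<omega>\<bar> \<le> 1" for i j \<omega> unfolding d by (rule kernel_bounds)
  have ed: "expectation (\<lambda>\<omega>. \<bar>d i j \<omega>\<bar>) = expectation (\<lambda>\<omega>. \<bar>kernel {1..m} 0 1 (obs \<omega>) - kernel_lim 0 1 (obs \<omega>)\<bar>)"
    if "i \<in> {1..Suc m}" for i j
    unfolding d using assms(1) that by (rule kernel_leave_one_out_lim)
  have id: "integrable M (\<lambda>\<omega>. \<bar>d i j \<omega>\<bar>)" for i j
    by (rule integrable_const_bound[of _ 1]) (use bd in auto)
  let ?a = "\<lambda>\<omega>. residual (Suc m) 1 1 (obs \<omega>)" and ?b = "\<lambda>\<omega>. residual (Suc m) k l (obs \<omega>)"
    and ?A = "\<lambda>\<omega>. kernel_lim 1 1 (obs \<omega>) - proj 1 1 (obs \<omega>)" and ?B = "\<lambda>\<omega>. kernel_lim k l (obs \<omega>) - proj k l (obs \<omega>)"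
  have b2: "\<bar>?A \<omega>\<bar> \<le> 2" "\<bar>?b \<omega>\<bar> \<le> 2" "\<bar>?a \<omega>\<bar> \<le> 2" "\<bar>?B \<omega>\<bar> \<le> 2" for \<omega>
    by (intro kernel_bounds residual_bound)+
  have int: "integrable M (\<lambda>\<omega>. ?a \<omega> * ?b \<omega>)" "integrable M (\<lambda>\<omega>. ?A \<omega> * ?B \<omega>)"
    using mult_mono[OF b2(3) b2(2)] mult_mono[OF b2(1) b2(4)]
    by (auto intro!: integrable_const_bound[of _ 4] simp: abs_mult)
  have "cov (Suc m) k l = expectation (\<lambda>\<omega>. ?a \<omega> * ?b \<omega>) - expectation (\<lambda>\<omega>. ?A \<omega> * ?B \<omega>)"
    using zero by (simp add: cov_def)
  also have "\<dots> = expectation (\<lambda>\<omega>. ?a \<omega> * ?b \<omega> - ?A \<omega> * ?B \<omega>)"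
    using int by simp
  finally have eq: "cov (Suc m) k l = expectation (\<lambda>\<omega>. ?a \<omega> * ?b \<omega> - ?A \<omega> * ?B \<omega>)" .
  have "\<bar>cov (Suc m) k l\<bar> \<le> expectation (\<lambda>\<omega>. \<bar>?a \<omega> * ?b \<omega> - ?A \<omega> * ?B \<omega>\<bar>)"
    unfolding eq by (rule integral_abs_bound)
  also have "\<dots> \<le> expectation (\<lambda>\<omega>. 2 * \<bar>d 1 1 \<omega>\<bar> + 2 * \<bar>d k l \<omega>\<bar>)"
  proof (rule integral_mono)
    show "integrable M (\<lambda>\<omega>. \<bar>?a \<omega> * ?b \<omega> - ?A \<omega> * ?B \<omega>\<bar>)" using int by simp
    show "integrable M (\<lambda>\<omega>. 2 * \<bar>d 1 1 \<omega>\<bar> + 2 * \<bar>d k l \<omega>\<bar>)" using id by simp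
    fix \<omega>
    have eq: "?a \<omega> * ?b \<omega> - ?A \<omega> * ?B \<omega> = d 1 1 \<omega> * ?b \<omega> + ?A \<omega> * d k l \<omega>"
      unfolding d_def by (simp add: algebra_simps)
    have "\<bar>d 1 1 \<omega> * ?b \<omega>\<bar> \<le> 2 * \<bar>d 1 1 \<omega>\<bar>"
      using mult_left_mono[OF b2(2)[of \<omega>], of "\<bar>d 1 1 \<omega>\<bar>"] by (simp only: abs_mult abs_ge_zero mult.commute[of 2] simp_thms)
    moreover have "\<bar>?A \<omega> * d k l \<omega>\<bar> \<le> 2 * \<bar>d k l \<omega>\<bar>"
      unfolding abs_mult by (rule mult_right_mono[OF b2(1) abs_ge_zero])
    ultimately show "\<bar>?a \<omega> * ?b \<omega> - ?A \<omega> * ?B \<omega>\<bar> \<le> 2 * \<bar>d 1 1 \<omega>\<bar> + 2 * \<bar>d k l \<omega>\<bar>"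
      unfolding eq by linarith
  qed
  also have "\<dots> = 2 * expectation (\<lambda>\<omega>. \<bar>d 1 1 \<omega>\<bar>) + 2 * expectation (\<lambda>\<omega>. \<bar>d k l \<omega>\<bar>)"
    using id by simp
  also have "\<dots> = 4 * expectation (\<lambda>\<omega>. \<bar>kernel {1..m} 0 1 (obs \<omega>) - kernel_lim 0 1 (obs \<omega>)\<bar>)"
    using assms(2) ed[of 1 1] ed[of k l] by simp
  finally show ?thesis .
qed

lemma cov_limit:
  assumes "Asm1 M D P X \<beta>" "Asm2 M \<Omega> D P X \<beta>" "0 < \<beta>"
  shows "(\<lambda>m. \<bar>cov m 2 1\<bar>) \<longlonglongrightarrow> 0" "(\<lambda>m. \<bar>cov m 1 2\<bar>) \<longlonglongrightarrow> 0"
proof -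
  let ?d = "\<lambda>m. 4 * expectation (\<lambda>\<omega>. \<bar>kernel {1..m} 0 1 (obs \<omega>) - kernel_lim 0 1 (obs \<omega>)\<bar>)"
  have lim: "?d \<longlonglongrightarrow> 0" by (intro tendsto_mult_right_zero kernel_limit[OF assms])
  have "(\<lambda>m. \<bar>cov m k l\<bar>) \<longlonglongrightarrow> 0"
    if "k \<in> {1, 2}" and zero: "expectation (\<lambda>\<omega>. (kernel_lim 1 1 (obs \<omega>) - proj 1 1 (obs \<omega>)) * (kernel_lim k l (obs \<omega>) - proj k l (obs \<omega>))) = 0" for k l
  proof -
    have "\<forall>\<^sub>F m in sequentially. \<bar>cov (Suc m) k l\<bar> \<le> ?d m"
      using eventually_ge_at_top[of 1]
      by eventually_elim (rule cov_le_kernel_lim[OF _ _ zero], use that(1) in auto)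
    then have "(\<lambda>m. \<bar>cov (Suc m) k l\<bar>) \<longlonglongrightarrow> 0"
      by (intro tendsto_sandwich[OF _ _ tendsto_const lim]) auto
    then show ?thesis by (rule filterlim_sequentially_Suc[THEN iffD1])
  qed
  from this[OF _ kernel_lim_uncorrelated(1)] this[OF _ kernel_lim_uncorrelated(2)]
  show "(\<lambda>m. \<bar>cov m 2 1\<bar>) \<longlonglongrightarrow> 0" "(\<lambda>m. \<bar>cov m 1 2\<bar>) \<longlonglongrightarrow> 0" by auto
qed

subsection \<open>The linear approximation\<close>

definition stat :: "nat \<Rightarrow> nat \<Rightarrow> (nat + nat \<Rightarrow> 'b) \<Rightarrow> real" where
  "stat m n z = LS D \<Omega> m n (\<lambda>i. z (Inl i)) (\<lambda>j. z (Inr j))"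

text \<open>\<open>s\<close> is \<open>Inl\<close> or \<open>Inr\<close>, so that both samples are
  treated at once.\<close>

definition rank_mean :: "nat \<Rightarrow> (nat \<Rightarrow> nat + nat) \<Rightarrow> (nat + nat \<Rightarrow> 'b) \<Rightarrow> real" where
  "rank_mean n s z = (\<Sum>i=1..n. mid_rank (z (s i)) - 1 / 2) / n"

definition remainder :: "nat \<Rightarrow> nat \<Rightarrow> (nat + nat \<Rightarrow> 'b) \<Rightarrow> real" where
  "remainder m n z = stat m n z - 1 / 2 - (rank_mean n Inr z - rank_mean m Inl z)"

lemma stat_eq: "stat m n z = 1 / (real m * real n) * (\<Sum>i=1..m. \<Sum>j=1..n. kernel {1..m} i j z)"
  by (simp add: stat_def LS_def kernel_def emp_depth_def emp_def precedes_def Let_def)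

lemma integrable_kernel: "I \<noteq> {} \<Longrightarrow> finite I \<Longrightarrow> integrable M (\<lambda>\<omega>. kernel I i j (obs \<omega>))"
  using precedes_bounds by (intro integrable_obs[of _ 1] kernel_measurable) (auto simp: kernel_def)

lemma stat_measurable [measurable]: "stat m n \<in> borel_measurable N"
  unfolding stat_eq[abs_def]
  by (intro borel_measurable_times borel_measurable_const borel_measurable_sum kernel_measurable) auto

lemma integrable_stat: "integrable M (\<lambda>\<omega>. stat m n (obs \<omega>))"
  unfolding stat_eq
  by (intro integrable_mult_right Bochner_Integration.integrable_sum integrable_kernel) auto

lemma integrable_mid_rank: "integrable M (\<lambda>\<omega>. mid_rank (obs \<omega> p))"
  using mid_rank_bounds by (intro integrable_obs[of "\<lambda>z. mid_rank (z p)" 1]) auto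

lemma rank_mean_measurable [measurable]: "rank_mean n s \<in> borel_measurable N"
  unfolding rank_mean_def[abs_def] by measurable

lemma remainder_measurable [measurable]: "remainder m n \<in> borel_measurable N"
  unfolding remainder_def[abs_def] by measurable

lemma integrable_remainder: "integrable M (\<lambda>\<omega>. remainder m n (obs \<omega>))"
  unfolding remainder_def rank_mean_def
  by (intro Bochner_Integration.integrable_diff integrable_divide_zero Bochner_Integration.integrable_sum
      integrable_stat integrable_mid_rank) auto

text \<open>Averaged over all pairs, \<open>proj\<close> is 1/2 plus the difference of the rank
  means, as their centring terms cancel.\<close>

lemma remainder_eq:
  assumes "1 \<le> m" "1 \<le> n"
  shows "remainder m n z = 1 / (real m * real n) * (\<Sum>i=1..m. \<Sum>j=1..n. kernel {1..m} i j z - proj i j z)"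
proof -
  have "(\<Sum>i=1..m. \<Sum>j=1..n. proj i j z)
      = real m * real n / 2 + real m * (\<Sum>j=1..n. mid_rank (z (Inr j))) - real n * (\<Sum>i=1..m. mid_rank (z (Inl i)))"
    by (simp add: proj_def sum.distrib sum_subtractf sum_distrib_left algebra_simps)
  then have "1 / (real m * real n) * (\<Sum>i=1..m. \<Sum>j=1..n. proj i j z) = 1 / 2 + (rank_mean n Inr z - rank_mean m Inl z)"
    using assms unfolding rank_mean_def sum_subtractf by (simp add: field_simps)
  then show ?thesis by (simp add: remainder_def stat_eq sum_subtractf right_diff_distrib)
qed

lemma expectation_kernel_leave_one_out:
  assumes "2 \<le> m" "i \<in> {1..m}"
  shows "expectation (\<lambda>\<omega>. \<bar>kernel {1..m} i j (obs \<omega>) - kernel ({1..m} - {i}) i j (obs \<omega>)\<bar>)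
    = expectation (\<lambda>\<omega>. \<bar>kernel {1..m} 1 1 (obs \<omega>) - kernel ({1..m} - {1}) 1 1 (obs \<omega>)\<bar>)"
proof -
  let ?t = "Transposition.transpose 1 i" and ?u = "Transposition.transpose 1 j"
  let ?\<sigma> = "map_sum ?t ?u :: nat + nat \<Rightarrow> nat + nat"
  have t: "?t permutes {1..m}" using assms by (intro permutes_swap_id) auto
  have im: "?t ` {1..m} = {1..m}" "?t ` ({1..m} - {1}) = {1..m} - {i}"
    using permutes_image[OF t] by (simp_all add: image_set_diff)
  have [measurable]: "kernel {1..m} 1 1 \<in> borel_measurable N" "kernel ({1..m} - {1}) 1 1 \<in> borel_measurable N"
    using assms leave_one_out_nonempty[of m 1] by (auto intro!: kernel_measurable)
  have "expectation (\<lambda>\<omega>. \<bar>kernel {1..m} i j (obs \<omega>) - kernel ({1..m} - {i}) i j (obs \<omega>)\<bar>)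
    = expectation (\<lambda>\<omega>. (\<lambda>z. \<bar>kernel {1..m} 1 1 z - kernel ({1..m} - {1}) 1 1 z\<bar>) (obs \<omega> \<circ> ?\<sigma>))"
  proof (intro Bochner_Integration.integral_cong refl)
    fix \<omega> assume "\<omega> \<in> space M"
    then have "kernel {1..m} 1 1 (obs \<omega> \<circ> ?\<sigma>) = kernel {1..m} i j (obs \<omega>)"
      "kernel ({1..m} - {1}) 1 1 (obs \<omega> \<circ> ?\<sigma>) = kernel ({1..m} - {i}) i j (obs \<omega>)"
      using kernel_perm[where I="{1..m}" and \<pi>="?t" and i=1 and \<rho>="?u" and j=1, OF obs_space _ inj_transpose, of \<omega>]
        kernel_perm[where I="{1..m} - {1}" and \<pi>="?t" and i=1 and \<rho>="?u" and j=1, OF obs_space _ inj_transpose, of \<omega>]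
      unfolding im by simp_all
    then show "\<bar>kernel {1..m} i j (obs \<omega>) - kernel ({1..m} - {i}) i j (obs \<omega>)\<bar>
        = (\<lambda>z. \<bar>kernel {1..m} 1 1 z - kernel ({1..m} - {1}) 1 1 z\<bar>) (obs \<omega> \<circ> ?\<sigma>)" by simp
  qed
  also have "\<dots> = expectation (\<lambda>\<omega>. \<bar>kernel {1..m} 1 1 (obs \<omega>) - kernel ({1..m} - {1}) 1 1 (obs \<omega>)\<bar>)"
    by (rule expectation_obs_comp[OF sum.inj_map[OF inj_transpose inj_transpose]]) measurable
  finally show ?thesis .
qed

text \<open>The first term is the L^1 price of leaving one out; the second bounds the average
  residual by its L^2 norm.\<close>

lemma expectation_remainder_le:
  assumes m: "2 \<le> m" and n: "1 \<le> n"
  shows "expectation (\<lambda>\<omega>. \<bar>remainder m n (obs \<omega>)\<bar>)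
    \<le> expectation (\<lambda>\<omega>. \<bar>kernel {1..m} 1 1 (obs \<omega>) - kernel ({1..m} - {1}) 1 1 (obs \<omega>)\<bar>)
      + sqrt (4 / (real m * real n) + \<bar>cov m 2 1\<bar> / real n + \<bar>cov m 1 2\<bar> / real m + \<bar>cov m 2 2\<bar>)"
proof -
  define w where "w = 1 / (real m * real n)"
  define e where "e i j \<omega> = \<bar>kernel {1..m} i j (obs \<omega>) - kernel ({1..m} - {i}) i j (obs \<omega>)\<bar>" for i j \<omega>
  define S where "S \<omega> = w * (\<Sum>i=1..m. \<Sum>j=1..n. residual m i j (obs \<omega>))" for \<omega>
  have w: "w \<ge> 0" "w * (real m * real n) = 1" using m n by (auto simp: w_def)
  have [measurable]: "residual m i j \<in> borel_measurable N" for i j using m by (intro residual_measurable)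
  have [measurable]: "S \<in> borel_measurable M" unfolding S_def[abs_def] by measurable
  have ie: "integrable M (e i j)" for i j
    unfolding e_def[abs_def] using m leave_one_out_nonempty[OF m, of i]
    by (intro integrable_abs Bochner_Integration.integrable_diff integrable_kernel) auto
  have ires: "integrable M (\<lambda>\<omega>. residual m i j (obs \<omega>))" for i j
    using residual_bound by (intro integrable_obs[of _ 2]) auto
  have iS: "integrable M S"
    unfolding S_def[abs_def] by (intro integrable_mult_right Bochner_Integration.integrable_sum ires)
  have iS2: "integrable M (\<lambda>\<omega>. (S \<omega>)\<^sup>2)"
  proof (rule integrable_const_bound[of _ "2\<^sup>2"])
    have "\<bar>S \<omega>\<bar> \<le> 2" for \<omega>
    proof -
      have "\<bar>S \<omega>\<bar> \<le> w * (\<Sum>i=1..m. \<Sum>j=1..n. 2)"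
        unfolding S_def abs_mult using w
        by (intro mult_mono order.trans[OF sum_abs] sum_mono residual_bound) auto
      also have "\<dots> = 2 * (w * (real m * real n))" by simp
      finally show ?thesis using w by simp
    qed
    then show "AE \<omega> in M. norm ((S \<omega>)\<^sup>2) \<le> 2\<^sup>2"
      using power_mono[of "\<bar>S _\<bar>" 2 2] by simp
  qed simp
  have "expectation (\<lambda>\<omega>. \<bar>remainder m n (obs \<omega>)\<bar>) \<le> expectation (\<lambda>\<omega>. w * (\<Sum>i=1..m. \<Sum>j=1..n. e i j \<omega>) + \<bar>S \<omega>\<bar>)"
  proof (rule integral_mono)
    show "integrable M (\<lambda>\<omega>. \<bar>remainder m n (obs \<omega>)\<bar>)" by (intro integrable_abs integrable_remainder)
    show "integrable M (\<lambda>\<omega>. w * (\<Sum>i=1..m. \<Sum>j=1..n. e i j \<omega>) + \<bar>S \<omega>\<bar>)"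
      by (intro Bochner_Integration.integrable_add integrable_mult_right Bochner_Integration.integrable_sum integrable_abs ie iS)
    fix \<omega>
    have "remainder m n (obs \<omega>) = w * (\<Sum>i=1..m. \<Sum>j=1..n. kernel {1..m} i j (obs \<omega>) - kernel ({1..m} - {i}) i j (obs \<omega>)) + S \<omega>"
      using m n by (subst remainder_eq) (auto simp: S_def w_def residual_def sum_subtractf diff_divide_distrib)
    also have "\<bar>\<dots>\<bar> \<le> w * (\<Sum>i=1..m. \<Sum>j=1..n. e i j \<omega>) + \<bar>S \<omega>\<bar>"
      unfolding e_def using w(1)
      by (intro order.trans[OF abs_triangle_ineq] add_mono order.refl)
        (auto simp: abs_mult intro!: mult_left_mono order.trans[OF sum_abs] sum_mono)
    finally show "\<bar>remainder m n (obs \<omega>)\<bar> \<le> w * (\<Sum>i=1..m. \<Sum>j=1..n. e i j \<omega>) + \<bar>S \<omega>\<bar>" .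
  qed
  also have "\<dots> = w * (\<Sum>i=1..m. \<Sum>j=1..n. expectation (e i j)) + expectation (\<lambda>\<omega>. \<bar>S \<omega>\<bar>)"
    using ie iS by simp
  also have "(\<Sum>i=1..m. \<Sum>j=1..n. expectation (e i j)) = (\<Sum>i=1..m. \<Sum>j=1..n. expectation (e 1 1))"
    unfolding e_def[abs_def] by (intro sum.cong refl expectation_kernel_leave_one_out m)
  also have "w * (\<Sum>i=1..m. \<Sum>j=1..n. expectation (e 1 1)) = (w * (real m * real n)) * expectation (e 1 1)" by simp
  also have "\<dots> = expectation (e 1 1)" using w by simp
  also have "expectation (\<lambda>\<omega>. \<bar>S \<omega>\<bar>) \<le> sqrt (expectation (\<lambda>\<omega>. (S \<omega>)\<^sup>2))"
    using iS2 by (intro expectation_abs_le_sqrt) auto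
  also have "\<dots> \<le> sqrt (4 / (real m * real n) + \<bar>cov m 2 1\<bar> / real n + \<bar>cov m 1 2\<bar> / real m + \<bar>cov m 2 2\<bar>)"
    unfolding S_def w_def by (intro real_sqrt_le_mono second_moment_residual_sum m n)
  finally show ?thesis by (simp add: e_def[abs_def])
qed

text \<open>Multiplying by \<open>sqrt m\<close> puts a factor m under the root, which leaves 4/n,
  (m/n) \<open>\<bar>cov m 2 1\<bar>\<close>, \<open>\<bar>cov m 1 2\<bar>\<close> and m
  \<open>\<bar>cov m 2 2\<bar>\<close>; \<open>K\<close> controls m/n.\<close>

lemma remainder_limit:
  fixes m n :: "nat \<Rightarrow> nat"
  assumes asm: "Asm1 M D P X \<beta>" "Asm2 M \<Omega> D P X \<beta>" "Asm3 M \<Omega> D X" "Asm4 M \<Omega> D X \<beta>" and beta: "1 / 2 < \<beta>"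
    and mn: "filterlim m at_top sequentially" "filterlim n at_top sequentially"
    and K: "\<forall>\<^sub>F k in sequentially. real (m k) \<le> K * real (n k)"
  shows "(\<lambda>k. sqrt (m k) * expectation (\<lambda>\<omega>. \<bar>remainder (m k) (n k) (obs \<omega>)\<bar>)) \<longlonglongrightarrow> 0"
proof -
  let ?a = "\<lambda>m. sqrt (real m) * expectation (\<lambda>\<omega>. \<bar>kernel {1..m} 1 1 (obs \<omega>) - kernel ({1..m} - {1}) 1 1 (obs \<omega>)\<bar>)"
  let ?u = "\<lambda>k. ?a (m k) + sqrt (4 / real (n k) + K * \<bar>cov (m k) 2 1\<bar> + \<bar>cov (m k) 1 2\<bar> + real (m k) * \<bar>cov (m k) 2 2\<bar>)"
  have "0 < \<beta>" using beta by simp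
  note lims = kernel_leave_one_out_limit[OF asm(3,4) beta] cov_limit[OF asm(1,2) \<open>0 < \<beta>\<close>] cov_22_limit[OF asm(3,4) beta]
  note lims' = lims[THEN filterlim_compose, OF mn(1)]
  have nn: "(\<lambda>k. 4 / real (n k)) \<longlonglongrightarrow> 0"
    by (intro real_tendsto_divide_at_top[OF tendsto_const] filterlim_compose[OF filterlim_real_sequentially mn(2)])
  have "?u \<longlonglongrightarrow> 0 + sqrt (0 + K * 0 + 0 + 0)"
    by (intro tendsto_add tendsto_real_sqrt nn tendsto_mult lims' tendsto_const)
  then have lim: "?u \<longlonglongrightarrow> 0" by simp
  have ev: "\<forall>\<^sub>F k in sequentially. sqrt (m k) * expectation (\<lambda>\<omega>. \<bar>remainder (m k) (n k) (obs \<omega>)\<bar>) \<le> ?u k"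
    using K mn(1)[unfolded filterlim_at_top, rule_format, of 2] mn(2)[unfolded filterlim_at_top, rule_format, of 1]
  proof eventually_elim
    case (elim k)
    let ?q = "4 / (real (m k) * real (n k)) + \<bar>cov (m k) 2 1\<bar> / real (n k) + \<bar>cov (m k) 1 2\<bar> / real (m k) + \<bar>cov (m k) 2 2\<bar>"
    have "sqrt (m k) * expectation (\<lambda>\<omega>. \<bar>remainder (m k) (n k) (obs \<omega>)\<bar>) \<le> ?a (m k) + sqrt (m k) * sqrt ?q"
      using mult_left_mono[OF expectation_remainder_le[OF elim(2,3)], of "sqrt (m k)"] by (simp only: distrib_left) simp
    also have "sqrt (m k) * sqrt ?q = sqrt (m k * ?q)" by (simp add: real_sqrt_mult)
    also have "m k * ?q = 4 / real (n k) + (m k / n k) * \<bar>cov (m k) 2 1\<bar> + \<bar>cov (m k) 1 2\<bar> + real (m k) * \<bar>cov (m k) 2 2\<bar>"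
      using elim by (simp add: field_simps)
    also have "sqrt \<dots> \<le> sqrt (4 / real (n k) + K * \<bar>cov (m k) 2 1\<bar> + \<bar>cov (m k) 1 2\<bar> + real (m k) * \<bar>cov (m k) 2 2\<bar>)"
      using elim by (intro real_sqrt_le_mono add_mono mult_right_mono order.refl) (auto simp: field_simps)
    finally show ?case by simp
  qed
  show ?thesis by (rule tendsto_sandwich[OF _ ev tendsto_const lim]) auto
qed

end

section \<open>Limit distributions\<close>

text \<open>The leading terms \<open>w\<close> and \<open>- w\<close> of the two statistics have
  equal absolute value, so the maximum stays close to it.\<close>

lemma max_abs_perturb: "\<bar>max \<bar>w + s\<bar> \<bar>- w + t\<bar> - \<bar>w\<bar>\<bar> \<le> \<bar>s\<bar> + \<bar>t\<bar>" for w s t :: real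
  by (auto simp: max_def)

context two_sample_null
begin

text \<open>On the diagonal 1/3 - 1/2 + 1/4 = 1/12; off it one centred factor is integrated
  out.\<close>

lemma centred_rank_products:
  assumes "Asm1 M D P X \<beta>" "0 < \<beta>"
  shows "expectation (\<lambda>\<omega>. (mid_rank (obs \<omega> p) - 1 / 2) * (mid_rank (obs \<omega> q) - 1 / 2)) = (if p = q then 1 / 12 else 0)"
proof (cases "p = q")
  case True
  have i2: "integrable M (\<lambda>\<omega>. (mid_rank (obs \<omega> q))\<^sup>2)"
    using mid_rank_bounds by (intro integrable_obs[of "\<lambda>z. (mid_rank (z q))\<^sup>2" 1]) (auto simp: abs_square_le_1)
  have "(mid_rank x - 1 / 2) * (mid_rank x - 1 / 2) = (mid_rank x)\<^sup>2 - mid_rank x + 1 / 4" for x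
    by (simp add: power2_eq_square algebra_simps)
  then have "expectation (\<lambda>\<omega>. (mid_rank (obs \<omega> p) - 1 / 2) * (mid_rank (obs \<omega> q) - 1 / 2))
      = expectation (\<lambda>\<omega>. (mid_rank (obs \<omega> q))\<^sup>2) - expectation (\<lambda>\<omega>. mid_rank (obs \<omega> q)) + 1 / 4"
    using True i2 integrable_mid_rank by (simp add: prob_space)
  also have "\<dots> = 1 / 12"
    using expectation_mid_rank_square[OF assms, of q] expectation_P_eq[of mid_rank q] integral_mid_rank by simp
  finally show ?thesis using True by simp
next
  case False
  interpret P: prob_space P by (rule prob_space_P)
  have "integrable P mid_rank" using mid_rank_bounds by (intro integrable_P[of _ 1]) auto
  then have zero: "(\<integral>x. mid_rank x - 1 / 2 \<partial>P) = 0" by (simp add: integral_mid_rank P.prob_space)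
  have b: "\<bar>mid_rank x - 1 / 2\<bar> \<le> 1" for x using mid_rank_bounds[of x] by auto
  have "expectation (\<lambda>\<omega>. (mid_rank (obs \<omega> p) - 1 / 2) * (mid_rank (obs \<omega> q) - 1 / 2))
      = expectation (\<lambda>\<omega>. \<integral>x. (mid_rank x - 1 / 2) * (mid_rank (obs \<omega> q) - 1 / 2) \<partial>P)"
    by (rule expectation_integrate_out[where g="\<lambda>x z. (mid_rank x - 1 / 2) * (mid_rank (z q) - 1 / 2)" and B=1])
      (use False b in \<open>auto simp: abs_mult intro!: mult_le_one\<close>)
  then show ?thesis using False zero by simp
qed

definition normed_rank_sum :: "(nat \<Rightarrow> nat + nat) \<Rightarrow> nat \<Rightarrow> 'a \<Rightarrow> real" where
  "normed_rank_sum s n \<omega> = sqrt (12 * n) * rank_mean n s (obs \<omega>)"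

text \<open>The factor 12 is the reciprocal of the variance of \<open>mid_rank\<close>. An
  inequality is stated because the sum is 0 for \<open>n = 0\<close>.\<close>

lemma normed_rank_sum_square:
  assumes "Asm1 M D P X \<beta>" "0 < \<beta>" "inj s"
  shows "integrable M (\<lambda>\<omega>. (normed_rank_sum s n \<omega>)\<^sup>2)"
    and "expectation (\<lambda>\<omega>. (normed_rank_sum s n \<omega>)\<^sup>2) \<le> 1"
proof -
  define x where "x i \<omega> = mid_rank (obs \<omega> (s i)) - 1 / 2" for i \<omega>
  have [measurable]: "x i \<in> borel_measurable M" for i unfolding x_def[abs_def] by measurable
  have b: "\<bar>x i \<omega>\<bar> \<le> 1" for i \<omega> using mid_rank_bounds[of "obs \<omega> (s i)"] by (auto simp: x_def)
  have int: "integrable M (\<lambda>\<omega>. x i \<omega> * x j \<omega>)" for i j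
    by (rule integrable_const_bound[of _ 1]) (use b in \<open>auto simp: abs_mult intro!: mult_le_one\<close>)
  have ex: "expectation (\<lambda>\<omega>. x i \<omega> * x j \<omega>) = (if i = j then 1 / 12 else 0)" for i j
    unfolding x_def using centred_rank_products[OF assms(1,2), of "s i" "s j"] assms(3) by (simp add: inj_eq)
  have eq: "(normed_rank_sum s n \<omega>)\<^sup>2 = 12 / n * (\<Sum>i=1..n. \<Sum>j=1..n. x i \<omega> * x j \<omega>)" for \<omega>
    unfolding normed_rank_sum_def rank_mean_def x_def[symmetric] sum_product[symmetric]
    by (simp add: power_mult_distrib power_divide) (simp add: power2_eq_square)
  show "integrable M (\<lambda>\<omega>. (normed_rank_sum s n \<omega>)\<^sup>2)"
    unfolding eq by (intro integrable_mult_right Bochner_Integration.integrable_sum int)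
  have "expectation (\<lambda>\<omega>. (normed_rank_sum s n \<omega>)\<^sup>2) = 12 / n * (\<Sum>i=1..n. \<Sum>j=1..n. if i = j then 1 / 12 else 0)"
    unfolding eq using int ex by simp
  also have "\<dots> = 12 / n * (\<Sum>i=1..n. 1 / 12)"
    by (intro arg_cong[where f="\<lambda>t. 12 / n * t"] sum.cong refl) simp
  also have "\<dots> \<le> 1" by simp
  finally show "expectation (\<lambda>\<omega>. (normed_rank_sum s n \<omega>)\<^sup>2) \<le> 1" .
qed

lemma normed_rank_sum_weak_conv:
  assumes "Asm1 M D P X \<beta>" "0 < \<beta>" "inj s"
  shows "weak_conv_m (\<lambda>n. distr M borel (normed_rank_sum s n)) std_normal_distribution"
proof -
  \<comment> \<open>The central limit theorem numbers its summands from 0, the samples start at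
    1.\<close>
  define x where "x i \<omega> = mid_rank (obs \<omega> (s (Suc i)))" for i \<omega>
  have s: "inj (\<lambda>i. s (Suc i))" using inj_compose[OF assms(3) inj_Suc] by (simp add: comp_def)
  have mean: "expectation (x i) = 1 / 2" for i
    unfolding x_def using expectation_P_eq[of mid_rank "s (Suc i)"] integral_mid_rank by simp
  have "indep_vars (\<lambda>_. \<Omega>) (\<lambda>i \<omega>. obs \<omega> (s (Suc i))) UNIV"
  proof (rule indep_vars_iff_distr_eq_PiM'[THEN iffD2])
    show "distr M (\<Pi>\<^sub>M i\<in>UNIV. \<Omega>) (\<lambda>\<omega>. \<lambda>i\<in>UNIV. obs \<omega> (s (Suc i))) = (\<Pi>\<^sub>M i\<in>UNIV. distr M \<Omega> (\<lambda>\<omega>. obs \<omega> (s (Suc i))))"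
      using indep_vars_distr_reindex[OF indep_observations distr_observation s]
      by (simp add: distr_observation restrict_def)
  qed auto
  then have ind: "indep_vars (\<lambda>_. borel) x UNIV"
    unfolding x_def by (rule indep_vars_compose2) simp
  have "weak_conv_m (\<lambda>n. distr M borel (\<lambda>\<omega>. (\<Sum>i<n. x i \<omega> - 1 / 2) / sqrt (n * (sqrt (1 / 12))\<^sup>2))) std_normal_distribution"
  proof (rule central_limit_theorem[OF ind mean])
    show "integrable M (\<lambda>\<omega>. (x i \<omega>)\<^sup>2)" for i
      unfolding x_def using mid_rank_bounds
      by (intro integrable_obs[of "\<lambda>z. (mid_rank (z (s (Suc i))))\<^sup>2" 1]) (auto simp: abs_square_le_1)
    show "variance (x i) = (sqrt (1 / 12))\<^sup>2" for i
      unfolding mean using centred_rank_products[OF assms(1,2), of "s (Suc i)" "s (Suc i)"]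
      by (simp add: x_def power2_eq_square)
    show "distr M borel (x i) = distr P borel mid_rank" for i
      using distr_distr[of mid_rank \<Omega> borel "\<lambda>\<omega>. obs \<omega> (s (Suc i))" M]
      by (simp add: x_def[abs_def] comp_def distr_observation)
  qed simp
  moreover have "(\<Sum>i<n. x i \<omega> - 1 / 2) / sqrt (n * (sqrt (1 / 12))\<^sup>2) = normed_rank_sum s n \<omega>" for n \<omega>
  proof -
    have "(\<Sum>i=1..n. mid_rank (obs \<omega> (s i)) - 1 / 2) = (\<Sum>i<n. x i \<omega> - 1 / 2)"
      unfolding x_def by (rule sum.reindex_bij_witness[of _ Suc "\<lambda>i. i - 1"]) auto
    then show ?thesis
      by (cases "n = 0") (simp_all add: normed_rank_sum_def rank_mean_def real_sqrt_mult real_sqrt_divide field_simps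
          flip: real_sqrt_mult_self[of "real n"])
  qed
  ultimately show ?thesis by simp
qed

lemma normed_rank_sums_indep: "indep_var borel (normed_rank_sum Inr n) borel (normed_rank_sum Inl m)"
proof -
  let ?f = "\<lambda>s n z. sqrt (12 * real n) * rank_mean n s z"
  have f: "?f s n \<in> borel_measurable (\<Pi>\<^sub>M p\<in>range s. \<Omega>)" for s n
    unfolding rank_mean_def by measurable
  have "indep_var borel (?f Inr n \<circ> (\<lambda>\<omega>. \<lambda>p\<in>range Inr. obs \<omega> p)) borel (?f Inl m \<circ> (\<lambda>\<omega>. \<lambda>p\<in>range Inl. obs \<omega> p))"
    by (rule indep_var_compose[OF indep_var_restrict[OF indep_observations] f f]) auto
  then show ?thesis by (simp add: comp_def normed_rank_sum_def[abs_def] rank_mean_def)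
qed

lemma stat_obs: "stat m n (obs \<omega>) = LS D \<Omega> m n (\<lambda>i. X i \<omega>) (\<lambda>j. Y j \<omega>)"
  by (simp add: stat_def)

text \<open>The exchanged statistic is the same function of a reindexed point, so assumptions on the
  X sample alone control its remainder.\<close>

lemma stat_obs_swap: "stat n m (obs \<omega> \<circ> case_sum Inr Inl) = LS D \<Omega> n m (\<lambda>j. Y j \<omega>) (\<lambda>i. X i \<omega>)"
  by (simp add: stat_def)

lemma integrable_obs_comp:
  fixes f :: "_ \<Rightarrow> real"
  assumes "inj \<sigma>" and [measurable]: "f \<in> borel_measurable N" and "integrable M (\<lambda>\<omega>. f (obs \<omega>))"
  shows "integrable M (\<lambda>\<omega>. f (obs \<omega> \<circ> \<sigma>))"
proof -
  have "integrable (distr M N obs) f" using assms(3) by (simp add: integrable_distr_eq)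
  then have "integrable (distr M N (\<lambda>\<omega>. obs \<omega> \<circ> \<sigma>)) f" unfolding distr_obs_comp[OF assms(1)] .
  then show ?thesis by (rule integrable_distr[OF obs_comp_measurable])
qed

lemma LS_asymptotics:
  fixes \<beta> \<tau> :: real and m n :: "nat \<Rightarrow> nat"
  assumes beta: "1 / 2 < \<beta>"
    and asm: "Asm1 M D P X \<beta>" "Asm2 M \<Omega> D P X \<beta>" "Asm3 M \<Omega> D X" "Asm4 M \<Omega> D X \<beta>"
    and lim: "filterlim m at_top sequentially" "filterlim n at_top sequentially"
    and tau: "0 < \<tau>" "\<tau> < 1"
    and ratio: "(\<lambda>k. real (m k) / (real (m k) + real (n k))) \<longlonglongrightarrow> \<tau>"
  shows "weak_conv_m
      (\<lambda>k. distr M borel (\<lambda>\<omega>.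
        sqrt (6 * real (m k) * real (n k) / (real (m k) + real (n k)))
          * ((LS D \<Omega> (m k) (n k) (\<lambda>i. X i \<omega>) (\<lambda>j. Y j \<omega>)
            - LS D \<Omega> (n k) (m k) (\<lambda>j. Y j \<omega>) (\<lambda>i. X i \<omega>)) / sqrt 2)))
      std_normal_distribution" (is ?A)
    and "weak_conv_m
      (\<lambda>k. distr M borel (\<lambda>\<omega>.
        12 * real (m k) * real (n k) / (real (m k) + real (n k))
          * (max \<bar>LS D \<Omega> (m k) (n k) (\<lambda>i. X i \<omega>) (\<lambda>j. Y j \<omega>) - 1 / 2\<bar>
                 \<bar>LS D \<Omega> (n k) (m k) (\<lambda>j. Y j \<omega>) (\<lambda>i. X i \<omega>) - 1 / 2\<bar>)\<^sup>2))
      (chi_square_distribution 1)" (is ?B)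
proof -
  have beta0: "0 < \<beta>" using beta by simp
  let ?sw = "case_sum Inr Inl :: nat + nat \<Rightarrow> nat + nat"
  have sw: "inj ?sw" by (auto simp: inj_def split: sum.splits)
  define c where "c k = sqrt (12 * real (m k) * real (n k) / (real (m k) + real (n k)))" for k
  define W where "W k \<omega> = c k * (rank_mean (n k) Inr (obs \<omega>) - rank_mean (m k) Inl (obs \<omega>))" for k \<omega>
  define r where "r k \<omega> = c k * remainder (m k) (n k) (obs \<omega>)" for k \<omega>
  define r' where "r' k \<omega> = c k * remainder (n k) (m k) (obs \<omega> \<circ> ?sw)" for k \<omega>
  note obs_comp_measurable[of ?sw, measurable]
  have [measurable]: "W k \<in> borel_measurable M" "r k \<in> borel_measurable M" "r' k \<in> borel_measurable M" for k
    unfolding W_def[abs_def] r_def[abs_def] r'_def[abs_def] by measurable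
  have c0: "c k \<ge> 0" for k by (simp add: c_def)
  have r: "c k * (LS D \<Omega> (m k) (n k) (\<lambda>i. X i \<omega>) (\<lambda>j. Y j \<omega>) - 1 / 2) = W k \<omega> + r k \<omega>" for k \<omega>
    by (simp add: r_def W_def remainder_def stat_obs algebra_simps)
  \<comment> \<open>The rank means trade places, so the leading term only changes its sign.\<close>
  have r': "c k * (LS D \<Omega> (n k) (m k) (\<lambda>j. Y j \<omega>) (\<lambda>i. X i \<omega>) - 1 / 2) = - W k \<omega> + r' k \<omega>" for k \<omega>
    by (simp add: r'_def W_def remainder_def stat_obs_swap rank_mean_def algebra_simps)

  have W: "weak_conv_m (\<lambda>k. distr M borel (W k)) std_normal_distribution"
  proof -
    \<comment> \<open>Normalising each sample separately leaves these weights; the squares of their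
      limits are \<tau> and 1 - \<tau>, with sum 1.\<close>
    define a where "a k = sqrt (real (m k) / (real (m k) + real (n k)))" for k
    define b where "b k = - sqrt (real (n k) / (real (m k) + real (n k)))" for k
    have "(\<lambda>k. 1 - real (m k) / (real (m k) + real (n k))) \<longlonglongrightarrow> 1 - \<tau>"
      by (intro tendsto_diff tendsto_const ratio)
    moreover have "\<forall>\<^sub>F k in sequentially. 1 - real (m k) / (real (m k) + real (n k)) = real (n k) / (real (m k) + real (n k))"
      using lim(1)[unfolded filterlim_at_top, rule_format, of 1] by eventually_elim (simp add: field_simps)
    ultimately have "(\<lambda>k. real (n k) / (real (m k) + real (n k))) \<longlonglongrightarrow> 1 - \<tau>"
      by (rule Lim_transform_eventually)
    then have ab: "a \<longlonglongrightarrow> sqrt \<tau>" "b \<longlonglongrightarrow> - sqrt (1 - \<tau>)"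
      unfolding a_def b_def using ratio by (auto intro!: tendsto_intros)
    have eq: "W k = (\<lambda>\<omega>. a k * normed_rank_sum Inr (n k) \<omega> + b k * normed_rank_sum Inl (m k) \<omega>)" for k
    proof -
      have e: "c k = a k * sqrt (12 * n k)" and e': "c k = - b k * sqrt (12 * m k)"
        by (simp_all add: c_def a_def b_def mult_ac flip: real_sqrt_mult)
      show ?thesis
      proof
        fix \<omega>
        show "W k \<omega> = a k * normed_rank_sum Inr (n k) \<omega> + b k * normed_rank_sum Inl (m k) \<omega>"
          using arg_cong[OF e, of "\<lambda>t. t * rank_mean (n k) Inr (obs \<omega>)"]
            arg_cong[OF e', of "\<lambda>t. t * rank_mean (m k) Inl (obs \<omega>)"]
          unfolding W_def normed_rank_sum_def right_diff_distrib by (simp only: mult.assoc minus_mult_left[symmetric])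
      qed
    qed
    show ?thesis unfolding eq
      using tau by (intro weak_conv_m_indep_combination[OF normed_rank_sums_indep _ _ _ _ _ _ ab _ lim(2,1)]
          normed_rank_sum_square[OF asm(1) beta0] normed_rank_sum_weak_conv[OF asm(1) beta0]) auto
  qed

  \<comment> \<open>Both n / (m + n) and m / (m + n) are at most 1.\<close>
  have c_le: "c k \<le> sqrt 12 * sqrt (m k)" "c k \<le> sqrt 12 * sqrt (n k)" for k
    by (auto simp: c_def divide_le_eq distrib_left mult_left_mono simp flip: real_sqrt_mult intro!: real_sqrt_le_mono)
  have K: "\<forall>\<^sub>F k in sequentially. real (m k) \<le> 2 / (1 - \<tau>) * real (n k)"
    "\<forall>\<^sub>F k in sequentially. real (n k) \<le> 2 / \<tau> * real (m k)"
  proof -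
    \<comment> \<open>The bounds (1 + \<tau>) / 2 and \<tau> / 2 enclose the limit \<tau>. The upper
      one gives (1 - \<tau>) m < (1 + \<tau>) n \<le> 2 n, the lower one \<tau> n \<le> 2 m.\<close>
    have up: "\<forall>\<^sub>F k in sequentially. real (m k) / (real (m k) + real (n k)) < (1 + \<tau>) / 2"
      and low: "\<forall>\<^sub>F k in sequentially. \<tau> / 2 < real (m k) / (real (m k) + real (n k))"
      by (rule order_tendstoD[OF ratio], use tau in simp)+
    have pos: "\<forall>\<^sub>F k in sequentially. 1 \<le> m k" using lim(1) by (simp add: filterlim_at_top)
    show "\<forall>\<^sub>F k in sequentially. real (m k) \<le> 2 / (1 - \<tau>) * real (n k)"
      using up pos
    proof eventually_elim
      case (elim k)
      then have "(1 - \<tau>) * real (m k) < (1 + \<tau>) * real (n k)" by (simp add: divide_less_eq algebra_simps)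
      also have "\<dots> \<le> 2 * real (n k)" using tau by (intro mult_right_mono) auto
      finally show ?case using tau by (simp add: field_simps)
    qed
    show "\<forall>\<^sub>F k in sequentially. real (n k) \<le> 2 / \<tau> * real (m k)"
      using low pos
    proof eventually_elim
      case (elim k)
      then have "\<tau> * real (m k) + \<tau> * real (n k) < 2 * real (m k)" by (simp add: less_divide_eq algebra_simps)
      moreover have "0 \<le> \<tau> * real (m k)" using tau by simp
      ultimately have "\<tau> * real (n k) \<le> 2 * real (m k)" by linarith
      then show ?case using tau by (simp add: field_simps)
    qed
  qed
  have int_r: "integrable M (r k)" "integrable M (r' k)" for k
    unfolding r_def[abs_def] r'_def[abs_def]
    by (auto intro!: integrable_mult_right integrable_remainder integrable_obs_comp[OF sw])
  have le_r: "expectation (\<lambda>\<omega>. \<bar>r k \<omega>\<bar>) \<le> sqrt 12 * (sqrt (m k) * expectation (\<lambda>\<omega>. \<bar>remainder (m k) (n k) (obs \<omega>)\<bar>))" for k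
    using mult_right_mono[OF c_le(1)[of k], of "expectation (\<lambda>\<omega>. \<bar>remainder (m k) (n k) (obs \<omega>)\<bar>)"] c0[of k]
    by (simp add: r_def abs_mult mult.assoc)
  have le_r': "expectation (\<lambda>\<omega>. \<bar>r' k \<omega>\<bar>) \<le> sqrt 12 * (sqrt (n k) * expectation (\<lambda>\<omega>. \<bar>remainder (n k) (m k) (obs \<omega>)\<bar>))" for k
    using mult_right_mono[OF c_le(2)[of k], of "expectation (\<lambda>\<omega>. \<bar>remainder (n k) (m k) (obs \<omega>)\<bar>)"] c0[of k]
      expectation_obs_comp[OF sw, of "\<lambda>z. \<bar>remainder (n k) (m k) z\<bar>"]
    by (simp add: r'_def abs_mult mult.assoc)
  have lims: "(\<lambda>k. sqrt 12 * (sqrt (m k) * expectation (\<lambda>\<omega>. \<bar>remainder (m k) (n k) (obs \<omega>)\<bar>))) \<longlonglongrightarrow> 0"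
    "(\<lambda>k. sqrt 12 * (sqrt (n k) * expectation (\<lambda>\<omega>. \<bar>remainder (n k) (m k) (obs \<omega>)\<bar>))) \<longlonglongrightarrow> 0"
    by (intro tendsto_mult_right_zero remainder_limit[OF asm beta lim K(1)] remainder_limit[OF asm beta lim(2,1) K(2)])+
  have lim_r: "(\<lambda>k. expectation (\<lambda>\<omega>. \<bar>r k \<omega>\<bar>)) \<longlonglongrightarrow> 0" "(\<lambda>k. expectation (\<lambda>\<omega>. \<bar>r' k \<omega>\<bar>)) \<longlonglongrightarrow> 0"
    by (rule tendsto_sandwich[OF _ _ tendsto_const lims(1)] tendsto_sandwich[OF _ _ tendsto_const lims(2)];
        simp add: le_r le_r')+
  have lim_rr: "(\<lambda>k. expectation (\<lambda>\<omega>. \<bar>r k \<omega>\<bar>) + expectation (\<lambda>\<omega>. \<bar>r' k \<omega>\<bar>)) \<longlonglongrightarrow> 0"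
    using tendsto_add[OF lim_r] by simp
  have slutsky: "weak_conv_m (\<lambda>k. distr M borel (\<lambda>\<omega>. W k \<omega> + R k \<omega>)) std_normal_distribution"
    if [measurable]: "\<And>k. R k \<in> borel_measurable M" and R: "\<And>k \<omega>. \<bar>R k \<omega>\<bar> \<le> \<bar>r k \<omega>\<bar> + \<bar>r' k \<omega>\<bar>" for R
  proof (rule weak_conv_m_add_L1_null[OF _ _ _ real_dist_normal_dist W])
    have i: "integrable M (\<lambda>\<omega>. \<bar>r k \<omega>\<bar> + \<bar>r' k \<omega>\<bar>)" for k using int_r by simp
    show iR: "integrable M (R k)" for k
      by (rule Bochner_Integration.integrable_bound[OF i]) (use R in auto)
    have "expectation (\<lambda>\<omega>. \<bar>R k \<omega>\<bar>) \<le> expectation (\<lambda>\<omega>. \<bar>r k \<omega>\<bar>) + expectation (\<lambda>\<omega>. \<bar>r' k \<omega>\<bar>)" for k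
    proof -
      have "expectation (\<lambda>\<omega>. \<bar>R k \<omega>\<bar>) \<le> expectation (\<lambda>\<omega>. \<bar>r k \<omega>\<bar> + \<bar>r' k \<omega>\<bar>)"
        by (intro integral_mono integrable_abs iR i R)
      then show ?thesis using int_r by simp
    qed
    then show "(\<lambda>k. expectation (\<lambda>\<omega>. \<bar>R k \<omega>\<bar>)) \<longlonglongrightarrow> 0"
      by (intro tendsto_sandwich[OF _ _ tendsto_const lim_rr] always_eventually) auto
  qed simp
  have scale: "sqrt (6 * real (m k) * real (n k) / (real (m k) + real (n k))) * (x / sqrt 2) = c k * x / 2" (is "?s * _ = _") for k x
  proof -
    have "?s * (x / sqrt 2) = ?s * x * (1 / sqrt 2)" by simp
    also have "1 / sqrt 2 = sqrt 2 / 2" by (simp add: field_simps)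
    also have "?s * x * (sqrt 2 / 2) = (?s * sqrt 2) * x / 2" by simp
    also have "?s * sqrt 2 = c k" unfolding c_def real_sqrt_mult[symmetric] by simp
    finally show ?thesis .
  qed
  have diff: "c k * (LS D \<Omega> (m k) (n k) (\<lambda>i. X i \<omega>) (\<lambda>j. Y j \<omega>) - LS D \<Omega> (n k) (m k) (\<lambda>j. Y j \<omega>) (\<lambda>i. X i \<omega>)) / 2
      = W k \<omega> + (r k \<omega> - r' k \<omega>) / 2" (is "c k * (?L - ?L') / 2 = _") for k \<omega>
  proof -
    have "c k * (x - y) = c k * (x - 1 / 2) - c k * (y - 1 / 2)" for x y by (simp add: algebra_simps)
    from this[of ?L ?L'] have "c k * (?L - ?L') = (W k \<omega> + r k \<omega>) - (- W k \<omega> + r' k \<omega>)" unfolding r r' .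
    then show ?thesis by simp
  qed
  have conv: "weak_conv_m (\<lambda>k. distr M borel (\<lambda>\<omega>. W k \<omega> + (r k \<omega> - r' k \<omega>) / 2)) std_normal_distribution"
  proof (rule slutsky)
    show "\<bar>(r k \<omega> - r' k \<omega>) / 2\<bar> \<le> \<bar>r k \<omega>\<bar> + \<bar>r' k \<omega>\<bar>" for k \<omega>
      by (rule order.trans[OF _ abs_triangle_ineq4]) simp
  qed measurable
  show ?A unfolding scale diff by (rule conv)

  define mx where "mx k \<omega> = max \<bar>W k \<omega> + r k \<omega>\<bar> \<bar>- W k \<omega> + r' k \<omega>\<bar>" for k \<omega>
  \<comment> \<open>The sign follows \<open>W\<close>, so that \<open>W + \<rho>\<close> is
    \<open>mx\<close> or \<open>- mx\<close>. Squaring removes the sign, and the maximum becomes an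
    additive perturbation of \<open>W\<close> itself.\<close>
  define \<rho> where "\<rho> k \<omega> = (if 0 \<le> W k \<omega> then mx k \<omega> - \<bar>W k \<omega>\<bar> else \<bar>W k \<omega>\<bar> - mx k \<omega>)" for k \<omega>
  have [measurable]: "mx k \<in> borel_measurable M" for k unfolding mx_def[abs_def] by measurable
  have [measurable]: "\<rho> k \<in> borel_measurable M" for k unfolding \<rho>_def[abs_def] by measurable
  have "weak_conv_m (\<lambda>k. distr M borel (\<lambda>\<omega>. W k \<omega> + \<rho> k \<omega>)) std_normal_distribution"
  proof (rule slutsky)
    show "\<bar>\<rho> k \<omega>\<bar> \<le> \<bar>r k \<omega>\<bar> + \<bar>r' k \<omega>\<bar>" for k \<omega>
      using max_abs_perturb[of "W k \<omega>" "r k \<omega>" "r' k \<omega>"]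
      by (cases "0 \<le> W k \<omega>") (simp_all only: \<rho>_def mx_def if_True if_False abs_minus_commute)
  qed measurable
  then have "weak_conv_m (\<lambda>k. distr (distr M borel (\<lambda>\<omega>. W k \<omega> + \<rho> k \<omega>)) borel (\<lambda>x. x\<^sup>2)) (distr std_normal_distribution borel (\<lambda>x. x\<^sup>2))"
    by (intro weak_conv_m_distr_continuous real_dist_normal_dist) (auto intro!: continuous_intros)
  also have "(\<lambda>k. distr (distr M borel (\<lambda>\<omega>. W k \<omega> + \<rho> k \<omega>)) borel (\<lambda>x. x\<^sup>2)) = (\<lambda>k. distr M borel (\<lambda>\<omega>. (W k \<omega> + \<rho> k \<omega>)\<^sup>2))"
    by (simp add: distr_distr comp_def)
  also have "(\<lambda>k \<omega>. (W k \<omega> + \<rho> k \<omega>)\<^sup>2) = (\<lambda>k \<omega>. 12 * real (m k) * real (n k) / (real (m k) + real (n k))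
          * (max \<bar>LS D \<Omega> (m k) (n k) (\<lambda>i. X i \<omega>) (\<lambda>j. Y j \<omega>) - 1 / 2\<bar>
                 \<bar>LS D \<Omega> (n k) (m k) (\<lambda>j. Y j \<omega>) (\<lambda>i. X i \<omega>) - 1 / 2\<bar>)\<^sup>2)" (is "_ = (\<lambda>k \<omega>. _ * (?max k \<omega>)\<^sup>2)")
  proof (intro ext)
    fix k \<omega>
    have "mx k \<omega> = c k * ?max k \<omega>"
      unfolding mx_def r[symmetric] r'[symmetric] by (simp add: abs_mult c0 max_mult_distrib_left)
    moreover have "(W k \<omega> + \<rho> k \<omega>)\<^sup>2 = (mx k \<omega>)\<^sup>2" by (auto simp: \<rho>_def power2_eq_square)
    moreover have "(c k)\<^sup>2 = 12 * real (m k) * real (n k) / (real (m k) + real (n k))" by (simp add: c_def)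
    ultimately show "(W k \<omega> + \<rho> k \<omega>)\<^sup>2 = 12 * real (m k) * real (n k) / (real (m k) + real (n k)) * (?max k \<omega>)\<^sup>2"
      by (simp add: power_mult_distrib)
  qed
  finally show ?B by (simp only: chi_square_distribution_1)
qed

end

theorem corollary2p10:
  fixes M :: "'a measure" and \<Omega> :: "'b measure"
    and D :: "'b \<Rightarrow> 'b measure \<Rightarrow> real"
    and P Q :: "'b measure" and X Y :: "nat \<Rightarrow> 'a \<Rightarrow> 'b"
    and \<beta> \<tau> :: real and m n :: "nat \<Rightarrow> nat"
  assumes samples: "two_sample_depth M \<Omega> D P Q X Y"
    and beta: "1 / 2 < \<beta>" "\<beta> \<le> 1"
    and asm1: "Asm1 M D P X \<beta>"
    and asm2: "Asm2 M \<Omega> D P X \<beta>"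
    and asm3: "Asm3 M \<Omega> D X"
    and asm4: "Asm4 M \<Omega> D X \<beta>"
    and m_lim: "filterlim m at_top sequentially"
    and n_lim: "filterlim n at_top sequentially"
    and tau: "0 < \<tau>" "\<tau> < 1"
    and ratio: "(\<lambda>k. real (m k) / (real (m k) + real (n k))) \<longlonglongrightarrow> \<tau>"
    and null_hypothesis: "P = Q"
  shows "weak_conv_m
      (\<lambda>k. distr M borel (\<lambda>\<omega>.
        sqrt (6 * real (m k) * real (n k) / (real (m k) + real (n k)))
          * ((LS D \<Omega> (m k) (n k) (\<lambda>i. X i \<omega>) (\<lambda>j. Y j \<omega>)
            - LS D \<Omega> (n k) (m k) (\<lambda>j. Y j \<omega>) (\<lambda>i. X i \<omega>)) / sqrt 2)))
      std_normal_distribution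
    \<and> weak_conv_m
      (\<lambda>k. distr M borel (\<lambda>\<omega>.
        12 * real (m k) * real (n k) / (real (m k) + real (n k))
          * (max \<bar>LS D \<Omega> (m k) (n k) (\<lambda>i. X i \<omega>) (\<lambda>j. Y j \<omega>) - 1 / 2\<bar>
                 \<bar>LS D \<Omega> (n k) (m k) (\<lambda>j. Y j \<omega>) (\<lambda>i. X i \<omega>) - 1 / 2\<bar>)\<^sup>2))
      (chi_square_distribution 1)"
proof -
  interpret two_sample_null M \<Omega> D P X Y
    using samples null_hypothesis by (simp add: two_sample_null_def)
  show ?thesis
    using LS_asymptotics[OF beta(1) asm1 asm2 asm3 asm4 m_lim n_lim tau ratio] by blast
qed

end
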